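(* Let $d$ be a non-zero square-free integer and let $E^d/\mathbb{Q}: y^2=x^3-11d^2x+14d^3$, an elliptic curve with complex multiplication by $\mathbb{Z}[2i]$ (so $j(E^d)=287496$). Up to conjugation in $\mathrm{GL}(2,\mathbb{Z}_2)$ there are exactly $5$ possible $2$-adic images $G_{E^d,2^\infty}$, and $G_{E^d,2^\infty}$ is conjugate in $\mathrm{GL}(2,\mathbb{Z}_2)$ to: \begin{itemize} \item $\langle G^{2,1},c_1\rangle$ if $d=2$; \item $\langle G^{2,2},c_1\rangle$ if $d=1$; \item $\langle G^{2,2},c_{-1}\rangle$ if $d=-1$; \item $\langle G^{2,1},c_{-1}\rangle$ if $d=-2$; \item the full group $\mathcal{N}_{-4,0}(2^\infty)$ if $d\notin\pm(\mathbb{Q}^\times)^2$ and $d\notin\pm2(\mathbb{Q}^\times)^2$. \end{itemize}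
   Context: For an elliptic curve $E/\mathbb{Q}$, $G_{E,2^\infty}\subseteq \mathrm{GL}(2,\mathbb{Z}_2)$ denotes the image of the representation of $\mathrm{Gal}(\overline{\mathbb{Q}}/\mathbb{Q})$ on the $2$-adic Tate module $T_2(E)$, after a choice of $\mathbb{Z}_2$-basis. Let $$\mathcal{C}_{-4,0}(2^\infty)=\left\{\begin{pmatrix} a&b\\-4b&a\end{pmatrix}: a,b\in\mathbb{Z}_2,\ a^2+4b^2\in\mathbb{Z}_2^\times\right\},$$ for $\varepsilon\in\{\pm1\}$ let $c_\varepsilon=\begin{pmatrix}\varepsilon&0\\0&-\varepsilon\end{pmatrix}$, and set $\mathcal{N}_{-4,0}(2^\infty)=\langle\mathcal{C}_{-4,0}(2^\infty),c_1\rangle$. Here $\langle\cdots\rangle$ denotes the closed subgroup of $\mathrm{GL}(2,\mathbb{Z}_2)$ (topologically) generated by the listed elements or subgroups. Define $$G^{2,1}=\left\langle 5\,\mathrm{Id},\begin{pmatrix}1&1\\-4&1\end{pmatrix}\right\rangle,\qquad G^{2,2}=\left\langle 5\,\mathrm{Id},\begin{pmatrix}-1&-1\\4&-1\end{pmatrix}\right\rangle.$$ *)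

theory Defs
  imports
    "HOL-Analysis.Analysis"
    "HOL-Algebra.Group"
    "HOL-Computational_Algebra.Computational_Algebra"
begin

section \<open>The 2-adic integers\<close>

text \<open>
  \<open>\<int>\<^sub>2\<close> is the inverse limit of the rings \<open>\<int>/2\<^sup>n\<int>\<close>; the residue
  modulo \<open>2\<^sup>n\<close> is represented by its least nonnegative representative.
\<close>

typedef z2 = "{x :: nat \<Rightarrow> int. \<forall>n. x n \<in> {0..<2 ^ n} \<and> x (Suc n) mod 2 ^ n = x n}"
  morphisms res Abs_z2
  by (rule exI[of _ "\<lambda>_. 0"]) auto

setup_lifting type_definition_z2

lemma z2_eqI: "(\<And>n. res x n = res y n) \<Longrightarrow> x = y"
  by (metis ext res_inject)

lemma res_Suc_mod: "res x (Suc n) mod 2 ^ n = res x n"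
  using res[of x] by simp

lemma res_mod [simp]: "res x n mod 2 ^ n = res x n"
  using res[of x] by simp

lemma res_0 [simp]: "res x 0 = 0"
  using res[of x] by (auto dest: spec[of _ 0])

lemma mod_mod_pow2: "(k :: int) mod (2 * 2 ^ n) mod 2 ^ n = k mod 2 ^ n"
  by (simp add: mod_mod_cancel)

instantiation z2 :: comm_ring_1
begin

lift_definition zero_z2 :: z2 is "\<lambda>_. 0" by simp

lift_definition one_z2 :: z2 is "\<lambda>n. 1 mod 2 ^ n"
  by (simp add: mod_mod_pow2)

lift_definition plus_z2 :: "z2 \<Rightarrow> z2 \<Rightarrow> z2" is "\<lambda>x y n. (x n + y n) mod 2 ^ n"
  by (simp add: mod_mod_pow2) (metis mod_add_eq)

lift_definition uminus_z2 :: "z2 \<Rightarrow> z2" is "\<lambda>x n. (- x n) mod 2 ^ n"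
  by (simp add: mod_mod_pow2) (metis mod_minus_eq)

lift_definition minus_z2 :: "z2 \<Rightarrow> z2 \<Rightarrow> z2" is "\<lambda>x y n. (x n - y n) mod 2 ^ n"
  by (simp add: mod_mod_pow2) (metis mod_diff_eq)

lift_definition times_z2 :: "z2 \<Rightarrow> z2 \<Rightarrow> z2" is "\<lambda>x y n. (x n * y n) mod 2 ^ n"
  by (simp add: mod_mod_pow2) (metis mod_mult_eq)

instance
proof
  fix a b c :: z2
  show "a * b * c = a * (b * c)"
    by (rule z2_eqI) (simp add: times_z2.rep_eq mod_mult_left_eq mod_mult_right_eq mult.assoc)
  show "a * b = b * a"
    by (rule z2_eqI) (simp add: times_z2.rep_eq mult.commute)
  show "1 * a = a"
    by (rule z2_eqI) (simp add: times_z2.rep_eq one_z2.rep_eq mod_mult_left_eq)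
  show "a + b + c = a + (b + c)"
    by (rule z2_eqI) (simp add: plus_z2.rep_eq mod_add_left_eq mod_add_right_eq add.assoc)
  show "a + b = b + a"
    by (rule z2_eqI) (simp add: plus_z2.rep_eq add.commute)
  show "0 + a = a"
    by (rule z2_eqI) (simp add: plus_z2.rep_eq zero_z2.rep_eq)
  show "- a + a = 0"
    by (rule z2_eqI)
      (simp add: plus_z2.rep_eq uminus_z2.rep_eq zero_z2.rep_eq mod_add_left_eq)
  show "a - b = a + - b"
    by (rule z2_eqI)
      (simp add: plus_z2.rep_eq uminus_z2.rep_eq minus_z2.rep_eq mod_add_right_eq)
  show "(a + b) * c = a * c + b * c"
    by (rule z2_eqI)
      (simp add: plus_z2.rep_eq times_z2.rep_eq mod_mult_left_eq mod_add_eq distrib_right)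
  show "(0 :: z2) \<noteq> 1"
  proof
    assume "(0 :: z2) = 1"
    hence "res 0 1 = res 1 1" by simp
    thus False by (simp add: zero_z2.rep_eq one_z2.rep_eq)
  qed
qed

end

instantiation z2 :: topological_space
begin

text \<open>The sets \<open>{y. res y n = res x n} = x + 2\<^sup>n \<int>\<^sub>2\<close> form a neighbourhood basis of \<open>x\<close>.\<close>

definition open_z2 :: "z2 set \<Rightarrow> bool" where
  "open_z2 U \<longleftrightarrow> (\<forall>x\<in>U. \<exists>n. {y. res y n = res x n} \<subseteq> U)"

instance
proof
  show "open (UNIV :: z2 set)"
    by (simp add: open_z2_def)
next
  fix S T :: "z2 set"
  have mono: "res y m = res x m" if "res y n = res x n" "m \<le> n" for x y :: z2 and m n
    using that(2,1) by (induction n rule: dec_induct) (auto, metis res_Suc_mod)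
  assume S: "open S" and T: "open T"
  show "open (S \<inter> T)"
    unfolding open_z2_def
  proof
    fix x assume "x \<in> S \<inter> T"
    then obtain m n where "{y. res y m = res x m} \<subseteq> S" "{y. res y n = res x n} \<subseteq> T"
      using S T unfolding open_z2_def by blast
    moreover have "res y m = res x m \<and> res y n = res x n"
      if "res y (max m n) = res x (max m n)" for y
      using mono[OF that] by simp
    ultimately have "{y. res y (max m n) = res x (max m n)} \<subseteq> S \<inter> T"
      by blast
    thus "\<exists>n. {y. res y n = res x n} \<subseteq> S \<inter> T" by blast
  qed
next
  fix K :: "z2 set set"
  assume "\<forall>S\<in>K. open S"
  thus "open (\<Union>K)"
    unfolding open_z2_def by (meson UnionE Union_upper subset_trans)
qed

end


section \<open>The topological group \<open>GL(2, \<int>\<^sub>2)\<close>\<close>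

definition mat2 :: "z2 \<Rightarrow> z2 \<Rightarrow> z2 \<Rightarrow> z2 \<Rightarrow> z2 ^ 2 ^ 2" where
  "mat2 a b c d = vector [vector [a, b], vector [c, d]]"

definition GL2 :: "(z2 ^ 2 ^ 2) monoid" where
  "GL2 = \<lparr>carrier = {A. invertible A}, mult = (**), one = mat 1\<rparr>"

lemma group_GL2: "group GL2"
proof (rule groupI)
  fix A assume "A \<in> carrier GL2"
  thus "\<exists>B\<in>carrier GL2. B \<otimes>\<^bsub>GL2\<^esub> A = \<one>\<^bsub>GL2\<^esub>"
    unfolding GL2_def invertible_def by auto
qed (auto simp: GL2_def invertible_mult matrix_mul_assoc, auto simp: invertible_def)

text \<open>
  The closed subgroup of \<open>GL(2, \<int>\<^sub>2)\<close> topologically generated by \<open>X\<close>; the topology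
  is the one induced from \<open>\<int>\<^sub>2\<^sup>4\<close>.
\<close>

definition topgen :: "(z2 ^ 2 ^ 2) set \<Rightarrow> (z2 ^ 2 ^ 2) set" where
  "topgen X = \<Inter>{H. subgroup H GL2 \<and> closedin (top_of_set (carrier GL2)) H \<and> X \<subseteq> H}"

definition conj_rel :: "((z2 ^ 2 ^ 2) set \<times> (z2 ^ 2 ^ 2) set) set" where
  "conj_rel = {(G, H). \<exists>M\<in>carrier GL2. H = (\<lambda>A. M \<otimes>\<^bsub>GL2\<^esub> A \<otimes>\<^bsub>GL2\<^esub> inv\<^bsub>GL2\<^esub> M) ` G}"

definition cartan :: "(z2 ^ 2 ^ 2) set" where
  "cartan = {mat2 a b (- 4 * b) a | a b. a\<^sup>2 + 4 * b\<^sup>2 dvd 1}"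

definition c_eps :: "z2 \<Rightarrow> z2 ^ 2 ^ 2" where
  "c_eps e = mat2 e 0 0 (- e)"

definition normalizer_cartan :: "(z2 ^ 2 ^ 2) set" where
  "normalizer_cartan = topgen (cartan \<union> {c_eps 1})"

definition G21 :: "(z2 ^ 2 ^ 2) set" where
  "G21 = topgen {mat 5, mat2 1 1 (- 4) 1}"

definition G22 :: "(z2 ^ 2 ^ 2) set" where
  "G22 = topgen {mat 5, mat2 (- 1) (- 1) 4 (- 1)}"


section \<open>Elliptic curves in short Weierstrass form\<close>

datatype 'k point = Infinity | Affine 'k 'k

text \<open>
  The group law on \<open>y\<^sup>2 = x\<^sup>3 + a x + b\<close>; it does not mention \<open>b\<close>, and it is only
  meaningful for points on a common curve.
\<close>

fun ell_add :: "'k :: field \<Rightarrow> 'k point \<Rightarrow> 'k point \<Rightarrow> 'k point" where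
  "ell_add a Infinity Q = Q"
| "ell_add a P Infinity = P"
| "ell_add a (Affine x1 y1) (Affine x2 y2) =
     (if x1 = x2 \<and> y1 = - y2 then Infinity
      else let l = (if x1 = x2 then (3 * x1\<^sup>2 + a) / (2 * y1) else (y2 - y1) / (x2 - x1));
               x3 = l\<^sup>2 - x1 - x2
           in Affine x3 (l * (x1 - x3) - y1))"

fun ell_mult :: "'k :: field \<Rightarrow> nat \<Rightarrow> 'k point \<Rightarrow> 'k point" where
  "ell_mult a 0 P = Infinity"
| "ell_mult a (Suc n) P = ell_add a P (ell_mult a n P)"

definition ell_disc :: "'k :: field \<Rightarrow> 'k \<Rightarrow> 'k" where
  "ell_disc a b = - 16 * (4 * a ^ 3 + 27 * b\<^sup>2)"

definition ell_j :: "'k :: field \<Rightarrow> 'k \<Rightarrow> 'k" where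
  "ell_j a b = 1728 * (4 * a ^ 3) / (4 * a ^ 3 + 27 * b\<^sup>2)"


section \<open>The 2-adic Galois representation\<close>

definition Qbar :: "complex set" where
  "Qbar = {z. algebraic z}"

definition abs_Gal :: "(complex \<Rightarrow> complex) set" where
  "abs_Gal = {\<sigma>. \<sigma> \<in> extensional Qbar \<and> bij_betw \<sigma> Qbar Qbar \<and>
     (\<forall>x\<in>Qbar. \<forall>y\<in>Qbar. \<sigma> (x + y) = \<sigma> x + \<sigma> y \<and> \<sigma> (x * y) = \<sigma> x * \<sigma> y) \<and>
     (\<forall>q\<in>\<rat>. \<sigma> q = q)}"

text \<open>
  In the remaining definitions \<open>a\<close>, \<open>b\<close> are the rational coefficients of
  \<open>E : y\<^sup>2 = x\<^sup>3 + a x + b\<close>.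
\<close>

definition ell_points :: "rat \<Rightarrow> rat \<Rightarrow> complex point set" where
  "ell_points a b = insert Infinity
     {Affine x y | x y. x \<in> Qbar \<and> y \<in> Qbar \<and> y\<^sup>2 = x ^ 3 + of_rat a * x + of_rat b}"

definition ell_torsion :: "rat \<Rightarrow> rat \<Rightarrow> nat \<Rightarrow> complex point set" where
  "ell_torsion a b n = {P \<in> ell_points a b. ell_mult (of_rat a) n P = Infinity}"

definition tate :: "rat \<Rightarrow> rat \<Rightarrow> (nat \<Rightarrow> complex point) set" where
  "tate a b = {P. \<forall>n. P n \<in> ell_torsion a b (2 ^ n) \<and> ell_mult (of_rat a) 2 (P (Suc n)) = P n}"

text \<open>The \<open>\<int>\<^sub>2\<close>-linear combination \<open>x P + y Q\<close> in the Tate module.\<close>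

definition tate_comb ::
  "rat \<Rightarrow> z2 \<Rightarrow> (nat \<Rightarrow> complex point) \<Rightarrow> z2 \<Rightarrow> (nat \<Rightarrow> complex point) \<Rightarrow> nat \<Rightarrow> complex point"
where
  "tate_comb a x P y Q = (\<lambda>n. ell_add (of_rat a)
     (ell_mult (of_rat a) (nat (res x n)) (P n)) (ell_mult (of_rat a) (nat (res y n)) (Q n)))"

definition tate_basis ::
  "rat \<Rightarrow> rat \<Rightarrow> (nat \<Rightarrow> complex point) \<Rightarrow> (nat \<Rightarrow> complex point) \<Rightarrow> bool" where
  "tate_basis a b P Q \<longleftrightarrow> P \<in> tate a b \<and> Q \<in> tate a b \<and>
     (\<forall>R\<in>tate a b. \<exists>!xy. R = tate_comb a (fst xy) P (snd xy) Q)"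

definition gal_act ::
  "(complex \<Rightarrow> complex) \<Rightarrow> (nat \<Rightarrow> complex point) \<Rightarrow> nat \<Rightarrow> complex point" where
  "gal_act \<sigma> P = (\<lambda>n. map_point \<sigma> (P n))"

text \<open>
  Matrices act on column vectors: the columns of the matrix of \<open>\<sigma>\<close> are the coordinates
  of \<open>\<sigma> P\<close> and \<open>\<sigma> Q\<close>. The convention matters: transposition exchanges the
  conjugacy classes of \<open>\<langle>G\<^sub>2\<^sub>i, c\<^sub>1\<rangle>\<close> and \<open>\<langle>G\<^sub>2\<^sub>i, c\<^sub>-\<^sub>1\<rangle>\<close>. The basis condition makes \<open>M\<close> unique for each \<open>\<sigma>\<close>.
\<close>

definition gal_image ::
  "rat \<Rightarrow> rat \<Rightarrow> (nat \<Rightarrow> complex point) \<Rightarrow> (nat \<Rightarrow> complex point) \<Rightarrow> (z2 ^ 2 ^ 2) set" where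
  "gal_image a b P Q = {M. \<exists>\<sigma>\<in>abs_Gal.
     gal_act \<sigma> P = tate_comb a (M $ 1 $ 1) P (M $ 2 $ 1) Q \<and>
     gal_act \<sigma> Q = tate_comb a (M $ 1 $ 2) P (M $ 2 $ 2) Q}"

text \<open>
  All the groups \<open>G\<^sub>E\<close> obtained from the various choices of a \<open>\<int>\<^sub>2\<close>-basis of the
  Tate module.
\<close>

definition adic_images :: "rat \<Rightarrow> rat \<Rightarrow> (z2 ^ 2 ^ 2) set set" where
  "adic_images a b = {gal_image a b P Q | P Q. tate_basis a b P Q}"


section \<open>The family of curves with complex multiplication by \<open>\<int>[2i]\<close>\<close>

definition Ed_a :: "int \<Rightarrow> rat" where "Ed_a d = - 11 * (of_int d)\<^sup>2"

definition Ed_b :: "int \<Rightarrow> rat" where "Ed_b d = 14 * of_int d ^ 3"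

definition Ed_images :: "int \<Rightarrow> (z2 ^ 2 ^ 2) set set" where
  "Ed_images d = adic_images (Ed_a d) (Ed_b d)"

lemma Ed_nonsingular: "d \<noteq> 0 \<Longrightarrow> ell_disc (Ed_a d) (Ed_b d) \<noteq> 0"
  by (simp add: ell_disc_def Ed_a_def Ed_b_def power_mult_distrib flip: power_mult)

lemma Ed_j: "d \<noteq> 0 \<Longrightarrow> ell_j (Ed_a d) (Ed_b d) = 287496"
  by (simp add: ell_j_def Ed_a_def Ed_b_def power_mult_distrib divide_simps flip: power_mult)

end

theory Submission
  imports Defs
begin

no_notation fps_nth (infixl "$" 75)

text \<open>
  The endomorphism \<open>\<eta> = [2 i]\<close> of \<open>y\<^sup>2 = x\<^sup>3 - 11 x + 14\<close> satisfies \<open>\<eta>\<^sup>2 = -4\<close> and is, up to a scaling,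
  a composition of two 2-isogenies. For a suitable \<open>Q\<close> in the Tate module, \<open>\<eta> Q\<close> and \<open>Q\<close> form a basis,
  and since \<open>\<sigma> \<eta> = \<plusminus> \<eta> \<sigma>\<close>, with the sign given by \<open>\<sigma>(i) = \<plusminus> i\<close>, the Galois image lies in the normalizer
  of the Cartan group.

  The normalizer has three characters with values in \<open>\<plusminus>1\<close>, and their common kernel is \<open>1 + 4 \<int>\<^sub>2[i]\<close>.
  A closed subgroup with enough elements contains this kernel, because a square and a commutator
  generate it modulo 8 and repeated squaring reaches the deeper levels; it is then determined by
  the values of the characters. On the Galois image they are given by the action of \<open>\<sigma>\<close> on \<open>i\<close>, \<open>\<surd>2\<close> and
  \<open>\<surd>(2 d)\<close>, the last one since \<open>(3 d, \<plusminus> 2 d \<surd>(2 d))\<close> are the points of order 4 killed by \<open>\<eta>\<close>. If neither \<open>\<plusminus>d\<close>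
  nor \<open>\<plusminus>2 d\<close> is a square, the three square roots are independent over the rationals and the image is
  the full normalizer; otherwise there is one relation, which gives a subgroup of index 2. Its four
  forms are not conjugate to each other because of trace, fixed vectors and \<open>-1\<close>.

  The image is closed: where a sequence of automorphisms is eventually constant, its limit is an
  embedding of a subfield, and this extends to all algebraic numbers by Zorn's lemma.
\<close>

subsection \<open>2-adic integers\<close>

text \<open>All curves are twists of one: with u^2 = d, scaling by u identifies E^1 with E^d over
  the field of u. So torsion, endomorphism and basis are found once, on E^1, and d enters only
  through the sign of the action on u. The endomorphism comes from y^2 = x^3 - 16 x, which is
  2-isogenous to E^1 and has the automorphism (x, y) -> (-x, -i y); placed between the isogeny and
  its dual, this gives an endomorphism of square -4. The signs on i and sqrt 2 are independent of
  each other for every d, so the generation argument applies to every d; only the sign on sqrt(2 d)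
  can depend on them. For d = 1, 2, -1, -2 this root is sqrt 2, 2, sqrt(-2), 2 i up to sign. These
  are the four relations, and with the generic case they make five groups. The group law is given by
  bare formulas, and associativity splits into many degenerate cases. It is proved for generic
  points with the help of a parabola and reaches all points by comparing translations outside finite
  sets, so that no degenerate case is computed.\<close>

lemma res_lower [simp]: "0 \<le> res x n" and res_upper [simp]: "res x n < 2 ^ n"
  using res[of x] by auto

lemma res_mod_le: "m \<le> n \<Longrightarrow> res x n mod 2 ^ m = res x m"
proof (induction n rule: dec_induct)
  case base
  show ?case by simp
next
  case (step n)
  have "res x m = (res x (Suc n) mod 2 ^ n) mod 2 ^ m"
    using step by (simp add: res_Suc_mod)
  also have "\<dots> = res x (Suc n) mod 2 ^ m"
    using step by (simp add: mod_mod_cancel le_imp_power_dvd)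
  finally show ?case by simp
qed

lemma res_of_nat: "res (of_nat k) n = int k mod 2 ^ n"
proof (induction k)
  case 0
  show ?case by (simp add: zero_z2.rep_eq)
next
  case (Suc k)
  have "res (of_nat (Suc k)) n = (1 mod 2 ^ n + int k mod 2 ^ n) mod 2 ^ n"
    using Suc by (simp only: of_nat_Suc plus_z2.rep_eq one_z2.rep_eq)
  thus ?case by (simp only: mod_add_eq) simp
qed

lemma res_of_int: "res (of_int k) n = k mod 2 ^ n"
proof (cases k rule: int_cases2)
  case (nonneg m)
  thus ?thesis by (simp add: res_of_nat)
next
  case (nonpos m)
  thus ?thesis by (simp add: res_of_nat uminus_z2.rep_eq mod_minus_eq)
qed

lemma two_power_eq_of_int: "(2 :: z2) ^ n = of_int (2 ^ n)"
  by simp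

lemma two_power_dvd_iff_res: "2 ^ n dvd x \<longleftrightarrow> res x n = 0"
proof
  assume "2 ^ n dvd x"
  then obtain y where "x = 2 ^ n * y" ..
  thus "res x n = 0"
    by (simp only: two_power_eq_of_int times_z2.rep_eq res_of_int) simp
next
  assume x: "res x n = 0"
  \<comment> \<open>Division by \<open>2 ^ n\<close> loses n digits, so the residue of the quotient
    modulo \<open>2 ^ m\<close> is read off from the residue of \<open>x\<close> modulo
    \<open>2 ^ (n + m)\<close>.\<close>
  define f where "f m = res x (n + m) div 2 ^ n" for m
  have f: "f m \<in> {0..<2 ^ m} \<and> f (Suc m) mod 2 ^ m = f m" for m
  proof -
    have "res x (n + m) < 2 ^ m * 2 ^ n"
      using res_upper[of x "n + m"] by (simp add: power_add mult.commute)
    moreover have "res x (n + m) div 2 ^ n * 2 ^ n \<le> res x (n + m)"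
      by (simp add: div_mult_mod_eq[symmetric] minus_mod_eq_div_mult[symmetric])
    ultimately have "res x (n + m) div 2 ^ n * 2 ^ n < 2 ^ m * 2 ^ n" by linarith
    hence "res x (n + m) div 2 ^ n < 2 ^ m" by (rule mult_right_less_imp_less) simp
    hence "f m \<in> {0..<2 ^ m}"
      unfolding f_def by (simp add: pos_imp_zdiv_nonneg_iff)
    moreover have "res x (Suc (n + m)) mod (2 ^ n * 2 ^ m) = res x (n + m)"
      by (metis power_add res_Suc_mod)
    hence "res x (n + m) div 2 ^ n = res x (Suc (n + m)) mod (2 ^ n * 2 ^ m) div 2 ^ n" by simp
    hence "f (Suc m) mod 2 ^ m = f m"
      unfolding f_def by (simp add: zmod_zmult2_eq)
    ultimately show ?thesis by simp
  qed
  define y where "y = Abs_z2 f"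
  have y: "res y m = f m" for m
    unfolding y_def using f by (subst Abs_z2_inverse) auto
  have "x = 2 ^ n * y"
  proof (rule z2_eqI)
    fix m
    have "res x (n + m) mod 2 ^ n = 0"
      using res_mod_le[of n "n + m" x] x by simp
    hence "2 ^ n * f m = res x (n + m)"
      unfolding f_def by (metis add_0_right mult_div_mod_eq)
    moreover have "res (2 ^ n * y) m = (2 ^ n * f m) mod 2 ^ m"
      by (simp only: two_power_eq_of_int times_z2.rep_eq res_of_int y) (simp add: mod_mult_left_eq)
    ultimately show "res x m = res (2 ^ n * y) m"
      using res_mod_le[of m "n + m" x] by simp
  qed
  thus "2 ^ n dvd x" by simp
qed

lemma res_eq_iff_dvd: "res x n = res y n \<longleftrightarrow> 2 ^ n dvd x - y"
proof -
  have "2 ^ n dvd x - y \<longleftrightarrow> (res x n - res y n) mod 2 ^ n = 0"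
    by (simp add: two_power_dvd_iff_res minus_z2.rep_eq)
  also have "\<dots> \<longleftrightarrow> res x n mod 2 ^ n = res y n mod 2 ^ n"
    by (simp only: mod_eq_dvd_iff mod_eq_0_iff_dvd)
  finally show ?thesis by simp
qed

lemma z2_eq_0I: "(\<And>n. 2 ^ n dvd x) \<Longrightarrow> (x :: z2) = 0"
  by (rule z2_eqI) (simp add: two_power_dvd_iff_res zero_z2.rep_eq)

lemma z2_double_eq_0:
  assumes "2 * x = (0 :: z2)"
  shows "x = 0"
proof (rule z2_eqI)
  fix n
  have "res (2 * x) (Suc n) = 0" using assms by (simp add: zero_z2.rep_eq)
  hence "(2 mod 2 ^ Suc n * res x (Suc n)) mod 2 ^ Suc n = 0"
    using res_of_int[of 2 "Suc n"] by (simp only: times_z2.rep_eq of_int_numeral)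
  hence "2 * 2 ^ n dvd 2 * res x (Suc n)"
    by (simp only: mod_mult_left_eq mod_eq_0_iff_dvd power_Suc)
  hence "2 ^ n dvd res x (Suc n)" by simp
  thus "res x n = res 0 n"
    by (metis mod_eq_0_iff_dvd res_Suc_mod zero_z2.rep_eq)
qed

lemma z2_two_power_dvd_double: "2 * 2 ^ n dvd 2 * x \<longleftrightarrow> 2 ^ n dvd (x :: z2)"
proof
  assume "2 * 2 ^ n dvd 2 * x"
  then obtain y where "2 * x = 2 * 2 ^ n * y" ..
  hence "2 * (x - 2 ^ n * y) = 0" by (simp add: algebra_simps)
  hence "x = 2 ^ n * y" using z2_double_eq_0 by fastforce
  thus "2 ^ n dvd x" by simp
qed (rule mult_dvd_mono[OF dvd_refl])

lemma z2_even_or_odd: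
  fixes x :: z2
  obtains y where "x = 2 * y" | y where "x = 1 + 2 * y"
proof -
  have "res x 1 \<in> {0, 1}" using res_lower[of x 1] res_upper[of x 1] by (simp del: One_nat_def res_lower res_upper) linarith
  hence "2 ^ 1 dvd x \<or> 2 ^ 1 dvd x - 1"
    using res_eq_iff_dvd[of x 1 0] res_eq_iff_dvd[of x 1 1]
    by (simp add: one_z2.rep_eq zero_z2.rep_eq)
  thus ?thesis
  proof
    assume "2 ^ 1 dvd x"
    thus ?thesis using that(1) by auto
  next
    assume "2 ^ 1 dvd x - 1"
    then obtain y where "x - 1 = 2 * y" by auto
    hence "x = 1 + 2 * y" by (simp add: algebra_simps)
    thus ?thesis by (rule that(2))
  qed
qed

lemma z2_not_two_dvd_one [simp]: "\<not> 2 dvd (1 :: z2)"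
  using two_power_dvd_iff_res[of 1 1] by (simp add: one_z2.rep_eq)

lemma z2_odd_iff: "\<not> 2 dvd x \<longleftrightarrow> (\<exists>y. x = 1 + 2 * (y :: z2))"
proof
  assume "\<not> 2 dvd x"
  thus "\<exists>y. x = 1 + 2 * y" by (cases x rule: z2_even_or_odd) auto
next
  assume "\<exists>y. x = 1 + 2 * y"
  thus "\<not> 2 dvd x"
    by (metis add.commute add_diff_cancel_left' dvd_diff dvd_triv_left z2_not_two_dvd_one)
qed

lemma z2_two_dvd_add_iff: "2 dvd x + (y :: z2) \<longleftrightarrow> (2 dvd x \<longleftrightarrow> 2 dvd y)"
proof (cases "2 dvd x \<or> 2 dvd y")
  case True
  thus ?thesis by (metis dvd_add_left_iff dvd_add_right_iff)
next
  case False
  then obtain u v where "x = 1 + 2 * u" "y = 1 + 2 * v" by (auto simp: z2_odd_iff)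
  hence "x + y = 2 * (1 + u + v)" by (simp add: algebra_simps)
  thus ?thesis using False by simp
qed

lemma z2_two_dvd_mult_iff: "2 dvd x * (y :: z2) \<longleftrightarrow> 2 dvd x \<or> 2 dvd y"
proof (cases "2 dvd x \<or> 2 dvd y")
  case False
  then obtain u v where "x = 1 + 2 * u" "y = 1 + 2 * v" by (auto simp: z2_odd_iff)
  hence "x * y = 1 + 2 * (u + v + 2 * u * v)" by (simp add: algebra_simps)
  thus ?thesis using False z2_odd_iff by blast
qed auto

lemma z2_odd_dvd_one:
  fixes x :: z2
  assumes "\<not> 2 dvd x"
  shows "x dvd 1"
proof -
  \<comment> \<open>Bezout coefficients invert \<open>x\<close> modulo each \<open>2 ^ n\<close>.
    Their compatibility is not visible from this choice; it follows from the uniqueness of inverses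
    modulo \<open>2 ^ n\<close>.\<close>
  define g where "g n = fst (bezout_coefficients (res x n) (2 ^ n)) mod 2 ^ n" for n
  have odd: "odd (res x n)" if "n > 0" for n
  proof -
    have "res x n mod 2 = res x 1" using res_mod_le[of 1 n x] that by simp
    moreover have "res x 1 \<noteq> 0" using assms two_power_dvd_iff_res[of 1 x] by simp
    ultimately show ?thesis by presburger
  qed
  have cop: "coprime (res x n) (2 ^ n)" for n
    using odd[of n] by (cases "n = 0") auto
  have g: "res x n * g n mod 2 ^ n = 1 mod 2 ^ n" for n
  proof -
    have "fst (bezout_coefficients (res x n) (2 ^ n)) * res x n +
        snd (bezout_coefficients (res x n) (2 ^ n)) * 2 ^ n = 1"
      using cop[of n] by (simp add: bezout_coefficients_fst_snd)
    hence "fst (bezout_coefficients (res x n) (2 ^ n)) * res x n mod 2 ^ n = 1 mod 2 ^ n"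
      by (metis mod_mult_self1 mult.commute)
    thus ?thesis unfolding g_def by (simp add: mod_mult_right_eq mult.commute)
  qed
  have compat: "g (Suc n) mod 2 ^ n = g n" for n
  proof -
    have "res x (Suc n) * g (Suc n) mod 2 ^ n = 1 mod 2 ^ n"
      using g[of "Suc n"] by (metis mod_mod_pow2 power_Suc)
    hence "res x n * g (Suc n) mod 2 ^ n = res x n * g n mod 2 ^ n"
      using g[of n] by (metis mod_mult_left_eq res_Suc_mod)
    hence "2 ^ n dvd res x n * (g (Suc n) - g n)"
      by (simp add: mod_eq_dvd_iff algebra_simps)
    hence "2 ^ n dvd g (Suc n) - g n"
      using cop[of n] by (simp add: coprime_commute coprime_dvd_mult_right_iff)
    hence "g (Suc n) mod 2 ^ n = g n mod 2 ^ n" by (simp add: mod_eq_dvd_iff)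
    thus ?thesis by (simp add: g_def)
  qed
  define y where "y = Abs_z2 g"
  have y: "res y n = g n" for n
    unfolding y_def using compat by (subst Abs_z2_inverse) (auto simp: g_def)
  have "1 = x * y"
    by (rule z2_eqI) (simp add: times_z2.rep_eq y g one_z2.rep_eq)
  thus ?thesis by (rule dvdI)
qed

lemma z2_dvd_one_iff: "x dvd 1 \<longleftrightarrow> \<not> 2 dvd (x :: z2)"
  using z2_odd_dvd_one dvd_trans z2_not_two_dvd_one by blast

lemma z2_odd_mod4:
  assumes "\<not> 2 dvd (x :: z2)"
  shows "4 dvd x + 1 \<longleftrightarrow> \<not> 4 dvd x - 1"
proof -
  obtain y where x: "x = 1 + 2 * y" using assms z2_odd_iff by blast
  have "4 dvd x - 1 \<longleftrightarrow> 2 dvd y"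
    using z2_two_power_dvd_double[of 1 y] by (simp add: x)
  moreover have x1: "x + 1 = 2 * (y + 1)" by (simp add: x algebra_simps)
  have "4 dvd x + 1 \<longleftrightarrow> 2 dvd y + 1"
    unfolding x1 using z2_two_power_dvd_double[of 1 "y + 1"] by (simp del: distrib_left_numeral)
  ultimately show ?thesis by (simp add: z2_two_dvd_add_iff)
qed


instance z2 :: idom
proof
  fix x y :: z2
  assume "x \<noteq> 0" "y \<noteq> 0"
  show "x * y \<noteq> 0"
  proof
    assume xy: "x * y = 0"
    obtain n where n: "\<not> 2 ^ n dvd x" using \<open>x \<noteq> 0\<close> z2_eq_0I by blast
    \<comment> \<open>Once the exact power \<open>2 ^ l\<close> is taken out of \<open>x\<close>,
      the cofactor is odd and hence a unit; what remains is that multiplication by 2 is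
      injective.\<close>
    define k where "k = (LEAST k. \<not> 2 ^ k dvd x)"
    have k: "\<not> 2 ^ k dvd x" unfolding k_def using n by (rule LeastI)
    then obtain l where l: "k = Suc l" by (cases k) auto
    have "2 ^ l dvd x" using not_less_Least[of l "\<lambda>k. \<not> 2 ^ k dvd x"] l by (simp add: k_def)
    then obtain u where u: "x = 2 ^ l * u" ..
    have "\<not> 2 dvd u"
      using k by (auto simp: u l dvd_def algebra_simps)
    then obtain v where v: "1 = u * v" using z2_odd_dvd_one by blast
    have "2 ^ l * y = x * y * v" using v by (simp add: u algebra_simps flip: mult.assoc)
    hence "2 ^ l * y = 0" using xy by simp
    moreover have "2 ^ i * y \<noteq> 0" for i
      using \<open>y \<noteq> 0\<close> z2_double_eq_0 by (induction i) (auto simp: mult.assoc)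
    ultimately show False by blast
  qed
qed

section \<open>Matrices with entries in the 2-adic integers\<close>

lemma mat2_nth [simp]:
  "mat2 a b c d $ 1 $ 1 = a" "mat2 a b c d $ 1 $ 2 = b"
  "mat2 a b c d $ 2 $ 1 = c" "mat2 a b c d $ 2 $ 2 = d"
  by (simp_all add: mat2_def)

lemma mat2_eqI:
  "A $ 1 $ 1 = B $ 1 $ 1 \<Longrightarrow> A $ 1 $ 2 = B $ 1 $ 2 \<Longrightarrow> A $ 2 $ 1 = B $ 2 $ 1 \<Longrightarrow> A $ 2 $ 2 = B $ 2 $ 2 \<Longrightarrow>
    A = (B :: z2 ^ 2 ^ 2)"
  by (simp add: vec_eq_iff forall_2)

lemma matrix_mult_nth: "(A ** B) $ i $ j = A $ i $ 1 * B $ 1 $ j + A $ i $ 2 * B $ 2 $ j"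
  for A B :: "z2 ^ 2 ^ 2"
  by (simp add: matrix_matrix_mult_def sum_2)

lemma mat2_mult:
  "mat2 a b c d ** mat2 a' b' c' d' = mat2 (a * a' + b * c') (a * b' + b * d') (c * a' + d * c') (c * b' + d * d')"
  by (rule mat2_eqI) (simp_all add: matrix_mult_nth)

lemma mat_eq_mat2: "mat k = mat2 k 0 0 k"
  by (rule mat2_eqI) (simp_all add: mat_def)

lemma carrier_GL2 [simp]: "A \<in> carrier GL2 \<longleftrightarrow> invertible A"
  and mult_GL2 [simp]: "A \<otimes>\<^bsub>GL2\<^esub> B = A ** B"
  and one_GL2 [simp]: "\<one>\<^bsub>GL2\<^esub> = mat 1"
  by (simp_all add: GL2_def)

lemma inv_GL2_eq:
  assumes "A ** B = mat 1" "B ** A = mat 1"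
  shows "invertible A" "inv\<^bsub>GL2\<^esub> A = B"
proof -
  show A: "invertible A" using assms by (auto simp: invertible_def)
  have "invertible B" using assms by (auto simp: invertible_def)
  thus "inv\<^bsub>GL2\<^esub> A = B"
    using group.inv_equality[OF group_GL2, of B A] A assms by simp
qed

lemma invertible_imp_inv_GL2:
  assumes "invertible A"
  shows "A ** inv\<^bsub>GL2\<^esub> A = mat 1" "inv\<^bsub>GL2\<^esub> A ** A = mat 1" "invertible (inv\<^bsub>GL2\<^esub> A)"
  using group.r_inv[OF group_GL2, of A] group.l_inv[OF group_GL2, of A]
    group.inv_closed[OF group_GL2, of A] assms by simp_all

subsection \<open>Congruence and closed sets\<close>

definition mat_cong :: "nat \<Rightarrow> z2 ^ 2 ^ 2 \<Rightarrow> z2 ^ 2 ^ 2 \<Rightarrow> bool" where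
  "mat_cong n A B \<longleftrightarrow> (\<forall>i j. res (A $ i $ j) n = res (B $ i $ j) n)"

lemma mat_cong_refl [simp]: "mat_cong n A A"
  and mat_cong_sym: "mat_cong n A B \<Longrightarrow> mat_cong n B A"
  and mat_cong_trans: "mat_cong n A B \<Longrightarrow> mat_cong n B C \<Longrightarrow> mat_cong n A C"
  by (simp_all add: mat_cong_def)

lemma mat_cong_mono: "mat_cong n A B \<Longrightarrow> m \<le> n \<Longrightarrow> mat_cong m A B"
  unfolding mat_cong_def by (metis res_mod_le)

lemma mat_cong_mult: "mat_cong n A A' \<Longrightarrow> mat_cong n B B' \<Longrightarrow> mat_cong n (A ** B) (A' ** B')"
  by (simp add: mat_cong_def matrix_mult_nth plus_z2.rep_eq times_z2.rep_eq)

text \<open>Only four entries are involved, so the levels of an open box have a maximum, and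
  congruence modulo powers of 2 describes the product topology.\<close>

lemma open_mat_iff: "open (U :: (z2 ^ 2 ^ 2) set) \<longleftrightarrow> (\<forall>A\<in>U. \<exists>n. \<forall>B. mat_cong n A B \<longrightarrow> B \<in> U)"
proof
  assume U: "open U"
  show "\<forall>A\<in>U. \<exists>n. \<forall>B. mat_cong n A B \<longrightarrow> B \<in> U"
  proof
    fix A assume "A \<in> U"
    then obtain R where R: "\<And>i. open (R i)" "\<And>i. A $ i \<in> R i" "\<And>B. (\<And>i. B $ i \<in> R i) \<Longrightarrow> B \<in> U"
      using U unfolding open_vec_def[of U] by metis
    have "\<exists>S. (\<forall>j. open (S j) \<and> A $ i $ j \<in> S j) \<and> (\<forall>y. (\<forall>j. y $ j \<in> S j) \<longrightarrow> y \<in> R i)" for i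
      using R(1,2)[of i] unfolding open_vec_def by blast
    then obtain S where S: "\<And>i j. open (S i j)" "\<And>i j. A $ i $ j \<in> S i j"
        "\<And>i y. (\<And>j. y $ j \<in> S i j) \<Longrightarrow> y \<in> R i"
      by metis
    have "\<exists>n. {y. res y n = res (A $ i $ j) n} \<subseteq> S i j" for i j
      using S(1,2)[of i j] unfolding open_z2_def by blast
    then obtain n where n: "\<And>i j y. res y (n i j) = res (A $ i $ j) (n i j) \<Longrightarrow> y \<in> S i j"
      by (simp add: subset_iff) metis
    define m where "m = max (max (n 1 1) (n 1 2)) (max (n 2 1) (n 2 2))"
    have m: "n i j \<le> m" for i j
      using exhaust_2[of i] exhaust_2[of j] by (auto simp: m_def)
    have "B \<in> U" if "mat_cong m A B" for B
    proof (rule R(3), rule S(3), rule n)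
      fix i j
      show "res (B $ i $ j) (n i j) = res (A $ i $ j) (n i j)"
        using mat_cong_mono[OF that m[of i j]] by (simp add: mat_cong_def)
    qed
    thus "\<exists>n. \<forall>B. mat_cong n A B \<longrightarrow> B \<in> U" by blast
  qed
next
  assume U: "\<forall>A\<in>U. \<exists>n. \<forall>B. mat_cong n A B \<longrightarrow> B \<in> U"
  show "open U"
    unfolding open_vec_def[of U]
  proof
    fix A assume "A \<in> U"
    then obtain n where n: "\<And>B. mat_cong n A B \<Longrightarrow> B \<in> U" using U by blast
    have op: "open {y. res y n = res x n}" for x
      unfolding open_z2_def by (intro ballI exI[of _ n]) auto
    have "open {v :: z2 ^ 2. \<forall>j. v $ j \<in> {y. res y n = res (A $ i $ j) n}}" for i
      using op by (intro open_vector_box) auto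
    thus "\<exists>R. (\<forall>i. open (R i) \<and> A $ i \<in> R i) \<and> (\<forall>B. (\<forall>i. B $ i \<in> R i) \<longrightarrow> B \<in> U)"
      using n by (intro exI[of _ "\<lambda>i. {v. \<forall>j. v $ j \<in> {y. res y n = res (A $ i $ j) n}}"])
        (auto simp: mat_cong_def)
  qed
qed

abbreviation closed_subgroup_GL2 :: "(z2 ^ 2 ^ 2) set \<Rightarrow> bool" where
  "closed_subgroup_GL2 H \<equiv> subgroup H GL2 \<and> closedin (top_of_set (carrier GL2)) H"

text \<open>Approximation modulo powers of 2 replaces topology from here on: the bit subgroups and
  the Galois image are shown to be closed in this form.\<close>

lemma closedin_GL2_iff:
  assumes "H \<subseteq> carrier GL2"
  shows "closedin (top_of_set (carrier GL2)) H \<longleftrightarrow>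
    (\<forall>A\<in>carrier GL2. (\<forall>n. \<exists>B\<in>H. mat_cong n A B) \<longrightarrow> A \<in> H)"
proof
  assume "closedin (top_of_set (carrier GL2)) H"
  then obtain T where T: "closed T" "H = carrier GL2 \<inter> T" by (auto simp: closedin_closed)
  show "\<forall>A\<in>carrier GL2. (\<forall>n. \<exists>B\<in>H. mat_cong n A B) \<longrightarrow> A \<in> H"
  proof (intro ballI impI)
    fix A assume A: "A \<in> carrier GL2" "\<forall>n. \<exists>B\<in>H. mat_cong n A B"
    have "A \<in> T"
    proof (rule ccontr)
      assume "A \<notin> T"
      then obtain n where "\<And>B. mat_cong n A B \<Longrightarrow> B \<notin> T"
        using T(1) unfolding closed_def open_mat_iff by blast
      thus False using A(2) T(2) by blast
    qed
    thus "A \<in> H" using A T by blast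
  qed
next
  assume *: "\<forall>A\<in>carrier GL2. (\<forall>n. \<exists>B\<in>H. mat_cong n A B) \<longrightarrow> A \<in> H"
  define T where "T = {A. \<forall>n. \<exists>B\<in>H. mat_cong n A B}"
  have "open (- T)"
    unfolding open_mat_iff
  proof
    fix A assume "A \<in> - T"
    then obtain n where "\<And>B. B \<in> H \<Longrightarrow> \<not> mat_cong n A B" by (auto simp: T_def)
    thus "\<exists>n. \<forall>B. mat_cong n A B \<longrightarrow> B \<in> - T"
      unfolding T_def by (auto intro!: exI[of _ n]) (metis mat_cong_trans)
  qed
  moreover have "H = carrier GL2 \<inter> T"
    using assms * by (auto simp: T_def intro: mat_cong_refl)
  ultimately show "closedin (top_of_set (carrier GL2)) H"
    by (auto simp: closedin_closed closed_def)
qed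

lemma topgen_superset: "X \<subseteq> topgen X"
  by (auto simp: topgen_def)

lemma topgen_subset: "closed_subgroup_GL2 H \<Longrightarrow> X \<subseteq> H \<Longrightarrow> topgen X \<subseteq> H"
  by (auto simp: topgen_def)

subsection \<open>The normalizer of the Cartan subgroup\<close>

text \<open>With i a square root of -1, \<open>nmat 1 a b\<close> is multiplication by a + 2 b i,
  and \<open>nmat (- 1) a b\<close> is \<open>c_eps 1\<close> times that matrix. So \<open>s\<close>
  tells the two cosets of the Cartan group apart.\<close>

definition nmat :: "z2 \<Rightarrow> z2 \<Rightarrow> z2 \<Rightarrow> z2 ^ 2 ^ 2" where
  "nmat s a b = mat2 a b (- 4 * s * b) (s * a)"

text \<open>The norm a^2 + 4 b^2 is a unit exactly if \<open>a\<close> is odd.\<close>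

definition norm_cartan :: "(z2 ^ 2 ^ 2) set" where
  "norm_cartan = {nmat s a b | s a b. (s = 1 \<or> s = - 1) \<and> \<not> 2 dvd a}"

lemma nmat_mult:
  "s' = 1 \<or> s' = - 1 \<Longrightarrow> nmat s a b ** nmat s' a' b' = nmat (s * s') (a * a' - 4 * s' * b * b') (a * b' + s' * a' * b)"
  by (elim disjE) (simp_all add: nmat_def mat2_mult algebra_simps)

lemma nmat_1_mult [simp]:
  "nmat s a b ** nmat 1 a' b' = nmat s (a * a' - 4 * b * b') (a * b' + a' * b)"
  by (simp add: nmat_mult)

lemma nmat_m1_mult [simp]:
  "nmat s a b ** nmat (- 1) a' b' = nmat (- s) (a * a' + 4 * b * b') (a * b' - a' * b)"
  by (simp add: nmat_mult)

lemma mat_1_eq_nmat: "mat 1 = nmat 1 1 0"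
  by (simp add: mat_eq_mat2 nmat_def)

lemma norm_cartan_cases:
  assumes "A \<in> norm_cartan"
  obtains a b where "A = nmat 1 a b" "\<not> 2 dvd a" | a b where "A = nmat (- 1) a b" "\<not> 2 dvd a"
  using assms unfolding norm_cartan_def by blast

lemma nmat_in_norm_cartan: "\<not> 2 dvd a \<Longrightarrow> nmat 1 a b \<in> norm_cartan" "\<not> 2 dvd a \<Longrightarrow> nmat (- 1) a b \<in> norm_cartan"
  unfolding norm_cartan_def by blast+

text \<open>The inverse is the complex conjugate divided by the norm, and \<open>n\<close> is the
  inverse of the norm.\<close>

lemma nmat_1_inverse:
  assumes "(a * a + 4 * b * b) * n = 1"
  shows "nmat 1 a b ** nmat 1 (a * n) (- b * n) = mat 1" "nmat 1 (a * n) (- b * n) ** nmat 1 a b = mat 1"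
proof -
  have "a * (a * n) - 4 * b * (- b * n) = 1" "a * n * a - 4 * (- b * n) * b = 1"
    using assms by algebra+
  moreover have "a * (- b * n) + a * n * b = 0" "a * n * b + a * (- b * n) = 0"
    by algebra+
  ultimately show "nmat 1 a b ** nmat 1 (a * n) (- b * n) = mat 1"
      "nmat 1 (a * n) (- b * n) ** nmat 1 a b = mat 1"
    unfolding nmat_1_mult mat_1_eq_nmat by (simp_all only:)
qed

text \<open>An element outside the Cartan group squares to the scalar a^2 + 4 b^2, so its inverse is
  a multiple of itself.\<close>

lemma nmat_m1_inverse:
  assumes "(a * a + 4 * b * b) * n = 1"
  shows "nmat (- 1) a b ** nmat (- 1) (a * n) (b * n) = mat 1" "nmat (- 1) (a * n) (b * n) ** nmat (- 1) a b = mat 1"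
proof -
  have "a * (a * n) + 4 * b * (b * n) = 1" "a * n * a + 4 * (b * n) * b = 1"
    using assms by algebra+
  moreover have "a * (b * n) - a * n * b = 0" "a * n * b - a * (b * n) = 0"
    by algebra+
  ultimately show "nmat (- 1) a b ** nmat (- 1) (a * n) (b * n) = mat 1"
      "nmat (- 1) (a * n) (b * n) ** nmat (- 1) a b = mat 1"
    unfolding nmat_m1_mult mat_1_eq_nmat by (simp_all only: minus_minus)
qed

lemma z2_two_dvd_four [simp]: "2 dvd (4 :: z2)"
  using dvd_triv_left[of 2 "2 :: z2"] by simp

lemma z2_dvd_cong: "k dvd x - y \<Longrightarrow> k dvd x \<longleftrightarrow> k dvd (y :: z2)"
  by (metis diff_add_cancel dvd_add_right_iff)

lemma nmat_norm_unit:
  assumes "\<not> 2 dvd (a :: z2)"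
  obtains n where "(a * a + 4 * b * b) * n = 1" "\<not> 2 dvd n"
proof -
  have "\<not> 2 dvd a * a + 4 * b * b"
    using assms by (simp add: z2_two_dvd_add_iff z2_two_dvd_mult_iff)
  hence "a * a + 4 * b * b dvd 1"
    by (simp add: z2_dvd_one_iff mult.assoc)
  then obtain n where n: "1 = (a * a + 4 * b * b) * n" ..
  hence "\<not> 2 dvd n" by (metis dvd_mult z2_not_two_dvd_one)
  thus ?thesis using that n by simp
qed

text \<open>\<open>True\<close> stands for the value -1. The third entry detects \<open>s\<close>,
  since \<open>s * a - a\<close> is 0 or \<open>- 2 * a\<close> with \<open>a\<close> odd; in this
  form all three depend on the matrix modulo 4 only.\<close>

definition bits :: "z2 ^ 2 ^ 2 \<Rightarrow> bool \<times> bool \<times> bool" where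
  "bits A = (\<not> 4 dvd A $ 1 $ 1 - 1, \<not> 2 dvd A $ 1 $ 2, \<not> 4 dvd A $ 2 $ 2 - A $ 1 $ 1)"

fun xor3 :: "bool \<times> bool \<times> bool \<Rightarrow> bool \<times> bool \<times> bool \<Rightarrow> bool \<times> bool \<times> bool" where
  "xor3 (a, b, c) (a', b', c') = (a \<noteq> a', b \<noteq> b', c \<noteq> c')"

lemma bits_nmat_1 [simp]: "bits (nmat 1 a b) = (\<not> 4 dvd a - 1, \<not> 2 dvd b, False)"
  by (simp add: bits_def nmat_def)

lemma bits_nmat_m1:
  assumes "\<not> 2 dvd a"
  shows "bits (nmat (- 1) a b) = (\<not> 4 dvd a - 1, \<not> 2 dvd b, True)"
proof -
  have "- a - a = 2 * - a" by simp
  thus ?thesis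
    using assms z2_two_power_dvd_double[of 1 "- a"] by (simp add: bits_def nmat_def)
qed

text \<open>\<open>4 * c\<close> stands for the term \<open>- 4 * s' * b * b'\<close> in the upper
  left entry of a product. It vanishes modulo 4, where the odd residues are just 1 and -1.\<close>

lemma z2_four_dvd_mult_minus_1:
  assumes "\<not> 2 dvd (a :: z2)" "\<not> 2 dvd a'"
  shows "4 dvd a * a' + 4 * c - 1 \<longleftrightarrow> (4 dvd a - 1 \<longleftrightarrow> 4 dvd a' - 1)"
proof -
  obtain u where u: "a = 1 + 2 * u" using assms(1) z2_odd_iff[of a] by blast
  obtain v where v: "a' = 1 + 2 * v" using assms(2) z2_odd_iff[of a'] by blast
  note uv = u v
  have *: "4 dvd 2 * w \<longleftrightarrow> 2 dvd w" for w :: z2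
    using z2_two_power_dvd_double[of 1 w] by simp
  have "a * a' + 4 * c - 1 = 2 * (u + v + 2 * (u * v + c))" unfolding uv by algebra
  hence "4 dvd a * a' + 4 * c - 1 \<longleftrightarrow> 2 dvd u + v + 2 * (u * v + c)" by (simp only: *)
  also have "\<dots> \<longleftrightarrow> (2 dvd u \<longleftrightarrow> 2 dvd v)" unfolding z2_two_dvd_add_iff by simp
  also have "2 dvd u \<longleftrightarrow> 4 dvd a - 1" using *[of u] by (simp add: uv)
  also have "2 dvd v \<longleftrightarrow> 4 dvd a' - 1" using *[of v] by (simp add: uv)
  finally show ?thesis .
qed

lemma z2_one_neq_minus_one [simp]: "(1 :: z2) \<noteq> - 1"
proof
  assume "(1 :: z2) = - 1"
  hence "1 + 1 = 1 + - (1 :: z2)" by (rule arg_cong)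
  hence "2 * (1 :: z2) = 0" by simp
  thus False using z2_double_eq_0[of 1] by simp
qed

lemma bits_nmat:
  assumes "\<not> 2 dvd a" "s = 1 \<or> s = - 1"
  shows "bits (nmat s a b) = (\<not> 4 dvd a - 1, \<not> 2 dvd b, s \<noteq> 1)"
  using assms(2)
proof
  assume "s = - 1"
  thus ?thesis using bits_nmat_m1[OF assms(1)] z2_one_neq_minus_one[symmetric] by (simp only:) simp
qed simp

lemma bits_mult:
  assumes "A \<in> norm_cartan" "B \<in> norm_cartan"
  shows "A ** B \<in> norm_cartan" "bits (A ** B) = xor3 (bits A) (bits B)"
proof -
  obtain s a b where A: "A = nmat s a b" "s = 1 \<or> s = - 1" "\<not> 2 dvd a"
    using assms(1) unfolding norm_cartan_def by blast
  obtain s' a' b' where B: "B = nmat s' a' b'" "s' = 1 \<or> s' = - 1" "\<not> 2 dvd a'"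
    using assms(2) unfolding norm_cartan_def by blast
  define c where "c = - s' * b * b'"
  have s's: "s * s' = 1 \<or> s * s' = - 1" "s * s' \<noteq> 1 \<longleftrightarrow> (s \<noteq> 1) \<noteq> (s' \<noteq> 1)"
    using A(2) B(2) by auto
  have AB: "A ** B = nmat (s * s') (a * a' + 4 * c) (a * b' + s' * a' * b)"
    unfolding A(1) B(1) nmat_mult[OF B(2)] c_def by (simp add: mult.assoc)
  have odd: "\<not> 2 dvd a * a' + 4 * c"
    using A(3) B(3) by (simp add: z2_two_dvd_add_iff z2_two_dvd_mult_iff)
  \<comment> \<open>Since \<open>a\<close>, \<open>a'\<close> and \<open>s'\<close> are odd, the
    upper right entry of the product is b + b' modulo 2.\<close>
  have "\<not> 2 dvd s'" using B(2) by auto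
  hence "2 dvd a * b' + s' * a' * b \<longleftrightarrow> (2 dvd b' \<longleftrightarrow> 2 dvd b)"
    using A(3) B(3) by (simp add: z2_two_dvd_add_iff z2_two_dvd_mult_iff)
  thus "bits (A ** B) = xor3 (bits A) (bits B)"
    unfolding AB bits_nmat[OF odd s's(1)] unfolding A(1) B(1) bits_nmat[OF A(3,2)] bits_nmat[OF B(3,2)]
      z2_four_dvd_mult_minus_1[OF A(3) B(3)] s's(2) xor3.simps by blast
  show "A ** B \<in> norm_cartan"
    unfolding AB norm_cartan_def using odd s's(1) by blast
qed

lemma norm_cartan_inverse:
  assumes "A \<in> norm_cartan"
  shows "invertible A" "inv\<^bsub>GL2\<^esub> A \<in> norm_cartan" "bits (inv\<^bsub>GL2\<^esub> A) = bits A"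
proof -
  obtain B where B: "B \<in> norm_cartan" "A ** B = mat 1" "B ** A = mat 1"
    using assms
  proof (cases rule: norm_cartan_cases)
    case (1 a b)
    obtain n where n: "(a * a + 4 * b * b) * n = 1" "\<not> 2 dvd n" using nmat_norm_unit 1 by blast
    have "nmat 1 (a * n) (- b * n) \<in> norm_cartan"
      using 1 n by (intro nmat_in_norm_cartan) (simp add: z2_two_dvd_mult_iff)
    thus ?thesis using that nmat_1_inverse[OF n(1)] 1 by blast
  next
    case (2 a b)
    obtain n where n: "(a * a + 4 * b * b) * n = 1" "\<not> 2 dvd n" using nmat_norm_unit 2 by blast
    have "nmat (- 1) (a * n) (b * n) \<in> norm_cartan"
      using 2 n by (intro nmat_in_norm_cartan) (simp add: z2_two_dvd_mult_iff)
    thus ?thesis using that nmat_m1_inverse[OF n(1)] 2 by blast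
  qed
  have inv: "inv\<^bsub>GL2\<^esub> A = B" by (rule inv_GL2_eq(2)[OF B(2,3)])
  show "invertible A" by (rule inv_GL2_eq(1)[OF B(2,3)])
  show "inv\<^bsub>GL2\<^esub> A \<in> norm_cartan" using B inv by simp
  have "xor3 (bits A) (bits B) = (False, False, False)"
    using bits_mult(2)[OF assms B(1)] B(2) by (simp add: mat_1_eq_nmat)
  thus "bits (inv\<^bsub>GL2\<^esub> A) = bits A"
    unfolding inv by (cases "bits A"; cases "bits B") auto
qed

definition bit_subgroup :: "(bool \<times> bool \<times> bool) set \<Rightarrow> (z2 ^ 2 ^ 2) set" where
  "bit_subgroup S = {A \<in> norm_cartan. bits A \<in> S}"

lemma mat_cong_bits:
  assumes "mat_cong n A B" "n \<ge> 2"
  shows "bits A = bits B"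
proof -
  have c: "mat_cong 2 A B" "mat_cong 1 A B" using assms mat_cong_mono by auto
  have 4: "4 dvd A $ i $ j - B $ i $ j" for i j
    using c(1) res_eq_iff_dvd[of "A $ i $ j" 2 "B $ i $ j"] by (simp add: mat_cong_def)
  have 2: "2 dvd A $ i $ j - B $ i $ j" for i j
    using c(2) res_eq_iff_dvd[of "A $ i $ j" 1 "B $ i $ j"] by (simp add: mat_cong_def)
  have "4 dvd A $ 1 $ 1 - 1 \<longleftrightarrow> 4 dvd B $ 1 $ 1 - 1"
    using 4[of 1 1] by (intro z2_dvd_cong) simp
  moreover have "2 dvd A $ 1 $ 2 \<longleftrightarrow> 2 dvd B $ 1 $ 2"
    using 2 by (rule z2_dvd_cong)
  moreover have "4 dvd (A $ 2 $ 2 - B $ 2 $ 2) - (A $ 1 $ 1 - B $ 1 $ 1)"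
    using 4[of 1 1] 4[of 2 2] by (rule dvd_diff[rotated])
  hence "4 dvd A $ 2 $ 2 - A $ 1 $ 1 \<longleftrightarrow> 4 dvd B $ 2 $ 2 - B $ 1 $ 1"
    by (intro z2_dvd_cong) (simp add: algebra_simps)
  ultimately show ?thesis by (simp add: bits_def)
qed

lemma norm_cartan_nmat_iff:
  "A \<in> norm_cartan \<longleftrightarrow> \<not> 2 dvd A $ 1 $ 1 \<and>
    (\<exists>s. (s = 1 \<or> s = - 1) \<and> A $ 2 $ 1 = - 4 * s * A $ 1 $ 2 \<and> A $ 2 $ 2 = s * A $ 1 $ 1)"
proof
  assume "A \<in> norm_cartan"
  thus "\<not> 2 dvd A $ 1 $ 1 \<and>
    (\<exists>s. (s = 1 \<or> s = - 1) \<and> A $ 2 $ 1 = - 4 * s * A $ 1 $ 2 \<and> A $ 2 $ 2 = s * A $ 1 $ 1)"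
    by (auto simp: norm_cartan_def nmat_def)
next
  assume "\<not> 2 dvd A $ 1 $ 1 \<and>
    (\<exists>s. (s = 1 \<or> s = - 1) \<and> A $ 2 $ 1 = - 4 * s * A $ 1 $ 2 \<and> A $ 2 $ 2 = s * A $ 1 $ 1)"
  then obtain s where s: "s = 1 \<or> s = - 1" "A $ 2 $ 1 = - 4 * s * A $ 1 $ 2" "A $ 2 $ 2 = s * A $ 1 $ 1"
    and odd: "\<not> 2 dvd A $ 1 $ 1" by blast
  have "A = nmat s (A $ 1 $ 1) (A $ 1 $ 2)"
    by (rule mat2_eqI) (simp_all add: s(2,3) nmat_def)
  thus "A \<in> norm_cartan" unfolding norm_cartan_def using s(1) odd by blast
qed

text \<open>The sign \<open>s\<close> of the approximating elements may vary with n. If each sign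
  failed at some level, both would fail at every higher level, although one of them works
  there.\<close>

lemma mat_cong_norm_cartan:
  assumes "\<And>n. \<exists>B\<in>norm_cartan. mat_cong n A B"
  shows "A \<in> norm_cartan"
proof -
  have "\<exists>s. (s = 1 \<or> s = - 1) \<and> \<not> 2 dvd A $ 1 $ 1 \<and> (\<forall>m. 2 ^ m dvd A $ 2 $ 1 + 4 * s * A $ 1 $ 2 \<and>
      2 ^ m dvd A $ 2 $ 2 - s * A $ 1 $ 1)"
  proof -
    have "\<exists>s. (s = 1 \<or> s = - 1) \<and> \<not> 2 dvd A $ 1 $ 1 \<and> 2 ^ n dvd A $ 2 $ 1 + 4 * s * A $ 1 $ 2 \<and>
        2 ^ n dvd A $ 2 $ 2 - s * A $ 1 $ 1" if n: "n \<ge> 1" for n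
    proof -
      obtain B where B: "B \<in> norm_cartan" "mat_cong n A B" using assms by blast
      then obtain s where s: "s = 1 \<or> s = - 1" "B $ 2 $ 1 = - 4 * s * B $ 1 $ 2" "B $ 2 $ 2 = s * B $ 1 $ 1"
        and odd: "\<not> 2 dvd B $ 1 $ 1" unfolding norm_cartan_nmat_iff by blast
      have d: "2 ^ n dvd A $ i $ j - B $ i $ j" for i j
        using B(2) by (simp add: mat_cong_def res_eq_iff_dvd)
      have "2 ^ n dvd (A $ 2 $ 1 - B $ 2 $ 1) + 4 * s * (A $ 1 $ 2 - B $ 1 $ 2)"
        by (intro dvd_add dvd_mult d)
      hence "2 ^ n dvd A $ 2 $ 1 + 4 * s * A $ 1 $ 2"
        by (simp add: s(2) algebra_simps)
      moreover have "2 ^ n dvd (A $ 2 $ 2 - B $ 2 $ 2) - s * (A $ 1 $ 1 - B $ 1 $ 1)"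
        by (intro dvd_diff dvd_mult d)
      hence "2 ^ n dvd A $ 2 $ 2 - s * A $ 1 $ 1"
        by (simp add: s(3) algebra_simps)
      moreover have "2 dvd A $ 1 $ 1 - B $ 1 $ 1"
        using d[of 1 1] n by (metis dvd_power dvd_trans less_le_trans zero_less_one)
      hence "\<not> 2 dvd A $ 1 $ 1" using odd by (metis diff_add_cancel dvd_add_right_iff)
      ultimately show ?thesis using s(1) by blast
    qed
    note * = this
    have mono: "2 ^ m dvd x" if "2 ^ n dvd x" "m \<le> n" for m n and x :: z2
      using that le_imp_power_dvd dvd_trans by blast
    show ?thesis
    proof (rule ccontr)
      assume neg: "\<not> ?thesis"
      obtain m1 where m1: "\<not> (2 ^ m1 dvd A $ 2 $ 1 + 4 * 1 * A $ 1 $ 2 \<and> 2 ^ m1 dvd A $ 2 $ 2 - 1 * A $ 1 $ 1)"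
        using neg *[of 1] by blast
      obtain m2 where m2: "\<not> (2 ^ m2 dvd A $ 2 $ 1 + 4 * (- 1) * A $ 1 $ 2 \<and> 2 ^ m2 dvd A $ 2 $ 2 - (- 1) * A $ 1 $ 1)"
        using neg *[of 1] by blast
      define n where "n = 1 + m1 + m2"
      have n: "1 \<le> n" "m1 \<le> n" "m2 \<le> n" by (simp_all add: n_def)
      from *[OF n(1)] show False
        using m1 m2 mono[OF _ n(2)] mono[OF _ n(3)] by blast
    qed
  qed
  then obtain s where s: "s = 1 \<or> s = - 1" "\<not> 2 dvd A $ 1 $ 1"
      "\<And>m. 2 ^ m dvd A $ 2 $ 1 + 4 * s * A $ 1 $ 2" "\<And>m. 2 ^ m dvd A $ 2 $ 2 - s * A $ 1 $ 1" by blast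
  from z2_eq_0I[OF s(3)] z2_eq_0I[OF s(4)] s(1,2) show ?thesis
    unfolding norm_cartan_nmat_iff by (intro conjI exI[of _ s]) (auto simp: add_eq_0_iff2)
qed

lemma closed_subgroup_bit_subgroup:
  assumes "(False, False, False) \<in> S" "\<And>x y. x \<in> S \<Longrightarrow> y \<in> S \<Longrightarrow> xor3 x y \<in> S"
  shows "closed_subgroup_GL2 (bit_subgroup S)"
proof
  show "subgroup (bit_subgroup S) GL2"
  proof (rule group.subgroupI[OF group_GL2])
    have "mat 1 \<in> bit_subgroup S"
      using assms(1) by (simp add: bit_subgroup_def mat_1_eq_nmat nmat_in_norm_cartan)
    thus "bit_subgroup S \<noteq> {}" by blast
  qed (auto simp: bit_subgroup_def norm_cartan_inverse bits_mult assms)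
  show "closedin (top_of_set (carrier GL2)) (bit_subgroup S)"
  proof (subst closedin_GL2_iff)
    show "bit_subgroup S \<subseteq> carrier GL2" by (auto simp: bit_subgroup_def norm_cartan_inverse)
    show "\<forall>A\<in>carrier GL2. (\<forall>n. \<exists>B\<in>bit_subgroup S. mat_cong n A B) \<longrightarrow> A \<in> bit_subgroup S"
    proof (intro ballI impI)
      fix A assume A: "\<forall>n. \<exists>B\<in>bit_subgroup S. mat_cong n A B"
      have "A \<in> norm_cartan" using A by (intro mat_cong_norm_cartan) (auto simp: bit_subgroup_def)
      moreover obtain B where "B \<in> bit_subgroup S" "mat_cong 2 A B" using A by blast
      hence "bits A \<in> S" using mat_cong_bits[of 2 A B] by (simp add: bit_subgroup_def)
      ultimately show "A \<in> bit_subgroup S" by (simp add: bit_subgroup_def)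
    qed
  qed
qed

section \<open>The filtration of the common kernel of the characters\<close>

definition level_mat :: "nat \<Rightarrow> z2 \<Rightarrow> z2 \<Rightarrow> z2 ^ 2 ^ 2" where
  "level_mat k u v = nmat 1 (1 + 4 * 2 ^ k * u) (2 * 2 ^ k * v)"

text \<open>\<open>level_mat k u v\<close> is 1 + K z with K = 2^(k+2) and z = u + v i. Its square
  is 1 + 2 K (z + K z^2 / 2): one level deeper, with z unchanged modulo 2.\<close>

lemma level_mat_square:
  "level_mat k u v ** level_mat k u v = level_mat (Suc k) (u + 2 * 2 ^ k * (u * u - v * v)) (v + 4 * 2 ^ k * u * v)"
proof -
  have "(1 + 4 * K * u) * (1 + 4 * K * u) - 4 * (2 * K * v) * (2 * K * v) = 1 + 4 * (2 * K) * (u + 2 * K * (u * u - v * v))"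
    and "(1 + 4 * K * u) * (2 * K * v) + (1 + 4 * K * u) * (2 * K * v) = 2 * (2 * K) * (v + 4 * K * u * v)"
    for K :: z2
    by algebra+
  thus ?thesis unfolding level_mat_def nmat_1_mult power_Suc by (simp only:)
qed

lemma level_mat_0_mult:
  "level_mat 0 u v ** level_mat 0 u' v' =
    level_mat 0 (u + u' + 2 * (2 * u * u' - 2 * v * v')) (v + v' + 2 * (2 * (u * v' + u' * v)))"
proof -
  have "(1 + 4 * u) * (1 + 4 * u') - 4 * (2 * v) * (2 * v') = 1 + 4 * (u + u' + 2 * (2 * u * u' - 2 * v * v'))"
    and "(1 + 4 * u) * (2 * v') + (1 + 4 * u') * (2 * v) = 2 * (v + v' + 2 * (2 * (u * v' + u' * v)))"
    by algebra+
  thus ?thesis unfolding level_mat_def nmat_1_mult power_0 mult_1_right by (simp only:)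
qed

lemma level_mat_quotient:
  assumes "2 dvd u' - u" "2 dvd v' - v"
  obtains u'' v'' where "level_mat k u' v' = level_mat k u v ** level_mat (Suc k) u'' v''"
proof -
  define K :: z2 where "K = 2 ^ k"
  obtain p where p: "u' - u = 2 * p" using assms(1) ..
  obtain q where q: "v' - v = 2 * q" using assms(2) ..
  have "\<not> 2 dvd 1 + 4 * K * u"
    by (simp add: z2_two_dvd_add_iff z2_two_dvd_mult_iff)
  then obtain n where n: "((1 + 4 * K * u) * (1 + 4 * K * u) + 4 * (2 * K * v) * (2 * K * v)) * n = 1"
    using nmat_norm_unit by blast
  define A where "A = 1 + 4 * K * u"
  \<comment> \<open>These are the coordinates of (p + q i) / (1 + 4 K (u + v i)), computed with the
    conjugate of the denominator and the inverse \<open>n\<close> of its norm.\<close>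
  define u'' where "u'' = n * (A * p + 4 * K * v * q)"
  define v'' where "v'' = n * (A * q - 4 * K * v * p)"
  have 1: "1 + 4 * K * u' = A * (1 + 4 * (2 * K) * u'') - 4 * (2 * K * v) * (2 * (2 * K) * v'')"
    using n p unfolding u''_def v''_def A_def by algebra
  have 2: "2 * K * v' = A * (2 * (2 * K) * v'') + (1 + 4 * (2 * K) * u'') * (2 * K * v)"
    using n q unfolding u''_def v''_def A_def by algebra
  have "level_mat k u' v' = level_mat k u v ** level_mat (Suc k) u'' v''"
    unfolding level_mat_def nmat_1_mult power_Suc K_def[symmetric] A_def[symmetric] 1[symmetric] 2[symmetric] ..
  thus ?thesis by (rule that)
qed

lemma mat_cong_level_mat: "mat_cong k (level_mat k u v) (mat 1)"
proof -
  have "2 ^ k dvd level_mat k u v $ i $ j - mat 1 $ i $ j" for i j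
    using exhaust_2[of i] exhaust_2[of j] unfolding level_mat_def mat_eq_mat2 nmat_def
    by (elim disjE) (simp_all add: mult.assoc mult.left_commute[of _ "2 ^ k"])
  thus ?thesis by (simp add: mat_cong_def res_eq_iff_dvd)
qed

text \<open>Elements outside the Cartan group act on it by complex conjugation, which makes the
  commutator in \<open>level_0_generators\<close> computable.\<close>

lemma nmat_conj: "nmat (- 1) c d ** nmat 1 a b = nmat 1 a (- b) ** nmat (- 1) c d"
  by (simp add: algebra_simps)

text \<open>\<open>h1\<close> is a + 2 b i with \<open>b\<close> odd, and \<open>h2\<close> lies
  outside the Cartan group, so that their commutator is nontrivial.\<close>

locale norm_cartan_subgroup =
  fixes H :: "(z2 ^ 2 ^ 2) set" and h1 h2 :: "z2 ^ 2 ^ 2"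
  assumes closed: "closed_subgroup_GL2 H"
    and subset: "H \<subseteq> norm_cartan"
    and h1: "h1 \<in> H" "fst (snd (bits h1))" "\<not> snd (snd (bits h1))"
    and h2: "h2 \<in> H" "snd (snd (bits h2))"
begin

lemma mult_closed: "A \<in> H \<Longrightarrow> B \<in> H \<Longrightarrow> A ** B \<in> H"
  and inv_closed: "A \<in> H \<Longrightarrow> inv\<^bsub>GL2\<^esub> A \<in> H"
  and one_closed: "mat 1 \<in> H"
  using closed subgroup.m_closed[of H GL2] subgroup.m_inv_closed[of H GL2] subgroup.one_closed[of H GL2]
  by auto

text \<open>
  With \<open>i = \<surd>-1\<close> and \<open>h\<^sub>1 = a + 2 b i\<close>, \<open>a\<close> and \<open>b\<close> odd, one has
  \<open>h\<^sub>1\<^sup>2 \<equiv> 1 + 4 (1 + i)\<close> and \<open>[h\<^sub>2, h\<^sub>1] = h\<^sub>1\<^sup>* / h\<^sub>1 \<equiv> 1 + 4 i\<close> modulo 8.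
\<close>

lemma level_0_generators:
  obtains u v u' v' where "level_mat 0 u v \<in> H" "\<not> 2 dvd u" "\<not> 2 dvd v"
    "level_mat 0 u' v' \<in> H" "2 dvd u'" "\<not> 2 dvd v'"
proof -
  obtain a b where ab: "h1 = nmat 1 a b" "\<not> 2 dvd a"
    using h1 subset bits_nmat_m1 by (metis norm_cartan_cases snd_conv subsetD)
  have b: "\<not> 2 dvd b" using h1(2) ab by simp
  obtain c d where cd: "h2 = nmat (- 1) c d"
    using h2 subset bits_nmat_1 by (metis norm_cartan_cases snd_conv subsetD)
  obtain p where p: "a = 1 + 2 * p" using ab(2) z2_odd_iff[of a] by blast
  \<comment> \<open>(1 + 2 p)^2 - 4 b^2 = 1 + 4 u; as \<open>p * (p + 1)\<close> is even and
    \<open>b\<close> is odd, \<open>u\<close> is odd.\<close>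
  define u where "u = p * (p + 1) - b * b"
  define v where "v = a * b"
  have pp: "2 dvd p * (p + 1)" by (simp add: z2_two_dvd_mult_iff z2_two_dvd_add_iff)
  have "\<not> 2 dvd u"
  proof
    assume "2 dvd u"
    hence "2 dvd p * (p + 1) - u" using pp by (rule dvd_diff[rotated])
    thus False using b by (simp add: u_def z2_two_dvd_mult_iff)
  qed
  have v: "\<not> 2 dvd v" using ab b by (simp add: v_def z2_two_dvd_mult_iff)
  have "a * a - 4 * b * b = 1 + 4 * u" "a * b + a * b = 2 * v"
    unfolding u_def v_def p by algebra+
  hence "h1 ** h1 = level_mat 0 u v"
    unfolding ab(1) nmat_1_mult level_mat_def power_0 mult_1_right by (simp only:)
  hence uvH: "level_mat 0 u v \<in> H" using mult_closed[OF h1(1) h1(1)] by simp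
  obtain n where n: "(a * a + 4 * b * b) * n = 1" "\<not> 2 dvd n" using nmat_norm_unit ab(2) by blast
  \<comment> \<open>The conjugate of \<open>h1\<close> divided by \<open>h1\<close> is n (a - 2 b
    i)^2 = 1 - 8 n b^2 - 4 n a b i, because n (a^2 + 4 b^2) = 1.\<close>
  define u' where "u' = 2 * (- (n * b * b))"
  define v' where "v' = - (n * a * b)"
  have inv1: "inv\<^bsub>GL2\<^esub> h1 = nmat 1 (a * n) (- b * n)"
    unfolding ab(1) by (rule inv_GL2_eq(2)[OF nmat_1_inverse[OF n(1)]])
  have "invertible h2" using h2 subset norm_cartan_inverse by blast
  hence "nmat 1 a (- b) = h2 ** h1 ** inv\<^bsub>GL2\<^esub> h2"
    unfolding ab(1) cd nmat_conj using invertible_imp_inv_GL2(1)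
    by (simp only: matrix_mul_assoc[symmetric] matrix_mul_rid)
  hence conj: "nmat 1 a (- b) \<in> H" using h1 h2 by (simp only: mult_closed inv_closed)
  have "nmat 1 a (- b) ** nmat 1 (a * n) (- b * n) \<in> H"
    by (rule mult_closed[OF conj inv_closed[OF h1(1), unfolded inv1]])
  moreover have "a * (a * n) - 4 * (- b) * (- b * n) = 1 + 4 * u'"
    unfolding u'_def using n(1) by algebra
  moreover have "a * (- b * n) + a * n * (- b) = 2 * v'"
    unfolding v'_def by (simp add: algebra_simps)
  ultimately have "level_mat 0 u' v' \<in> H"
    unfolding nmat_1_mult level_mat_def power_0 mult_1_right by (simp only:)
  moreover have "2 dvd u'" by (simp add: u'_def)
  moreover have "\<not> 2 dvd v'" using ab b n by (simp add: v'_def z2_two_dvd_mult_iff)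
  ultimately show ?thesis using that[OF uvH \<open>\<not> 2 dvd u\<close> v] by blast
qed

text \<open>At level 0 the generators have parities (1, 1) and (0, 1), which span all four classes
  of (u, v) modulo 2. Squaring preserves the classes and raises the level.\<close>

lemma level_parity: "\<exists>u v. level_mat k u v \<in> H \<and> (2 dvd u \<longleftrightarrow> x) \<and> (2 dvd v \<longleftrightarrow> y)"
proof (induction k)
  case 0
  obtain u v u' v' where uv: "level_mat 0 u v \<in> H" "\<not> 2 dvd u" "\<not> 2 dvd v"
    "level_mat 0 u' v' \<in> H" "2 dvd u'" "\<not> 2 dvd v'" by (rule level_0_generators)
  define r where "r = u + u' + 2 * (2 * u * u' - 2 * v * v')"
  define s where "s = v + v' + 2 * (2 * (u * v' + u' * v))"
  have "level_mat 0 r s \<in> H"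
    using mult_closed[OF uv(1,4)] unfolding level_mat_0_mult r_def s_def .
  moreover have "\<not> 2 dvd r" "2 dvd s"
    using uv by (simp_all add: r_def s_def z2_two_dvd_add_iff)
  moreover have "level_mat 0 0 0 \<in> H"
    using one_closed by (simp add: level_mat_def mat_1_eq_nmat)
  ultimately show ?case using uv by (cases x; cases y) (metis dvd_0_right)+
next
  case (Suc k)
  then obtain u v where uv: "level_mat k u v \<in> H" "2 dvd u \<longleftrightarrow> x" "2 dvd v \<longleftrightarrow> y" by blast
  define r where "r = u + 2 * 2 ^ k * (u * u - v * v)"
  define s where "s = v + 4 * 2 ^ k * u * v"
  have "level_mat (Suc k) r s \<in> H"
    using mult_closed[OF uv(1,1)] unfolding level_mat_square r_def s_def .
  moreover have "2 dvd r \<longleftrightarrow> x" "2 dvd s \<longleftrightarrow> y"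
    using uv(2,3) by (simp_all add: r_def s_def z2_two_dvd_add_iff z2_two_dvd_mult_iff)
  ultimately show ?case by blast
qed

text \<open>At each level a factor of matching parity is split off into \<open>H\<close>. The rest
  tends to the identity, so the closedness of \<open>H\<close> will absorb it.\<close>

lemma level_approx: "\<exists>h\<in>H. \<exists>u' v'. level_mat 0 u v = h ** level_mat k u' v'"
proof (induction k)
  case 0
  show ?case using one_closed by (metis matrix_mul_lid)
next
  case (Suc k)
  then obtain h u' v' where h: "h \<in> H" "level_mat 0 u v = h ** level_mat k u' v'" by blast
  obtain r s where rs: "level_mat k r s \<in> H" "2 dvd r \<longleftrightarrow> 2 dvd u'" "2 dvd s \<longleftrightarrow> 2 dvd v'"
    using level_parity by blast
  have "2 dvd u' - r" "2 dvd v' - s"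
    using rs(2,3) z2_two_dvd_add_iff[of u' "- r"] z2_two_dvd_add_iff[of v' "- s"] by simp_all
  then obtain u'' v'' where "level_mat k u' v' = level_mat k r s ** level_mat (Suc k) u'' v''"
    by (rule level_mat_quotient)
  hence "level_mat 0 u v = (h ** level_mat k r s) ** level_mat (Suc k) u'' v''"
    using h(2) by (simp only: matrix_mul_assoc)
  thus ?case using mult_closed[OF h(1) rs(1)] by blast
qed

lemma level_0_in: "level_mat 0 u v \<in> H"
proof -
  have "invertible (level_mat 0 u v)"
    unfolding level_mat_def
    by (intro norm_cartan_inverse(1) nmat_in_norm_cartan) (simp add: z2_two_dvd_add_iff z2_two_dvd_mult_iff)
  moreover have "\<exists>B\<in>H. mat_cong n (level_mat 0 u v) B" for n
  proof -
    obtain h u' v' where h: "h \<in> H" "level_mat 0 u v = h ** level_mat n u' v'"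
      using level_approx by blast
    have "mat_cong n (h ** level_mat n u' v') (h ** mat 1)"
      by (intro mat_cong_mult mat_cong_refl mat_cong_level_mat)
    thus ?thesis using h by auto
  qed
  moreover have "H \<subseteq> carrier GL2" using subset norm_cartan_inverse by auto
  ultimately show ?thesis using closed closedin_GL2_iff by auto
qed

text \<open>If \<open>A\<close> has the bits of some \<open>h\<close> in \<open>H\<close>, then
  \<open>A\<close> times the inverse of \<open>h\<close> has trivial bits, that is, it has the form
  \<open>level_mat 0 u v\<close> and lies in \<open>H\<close>.\<close>

lemma eq_bit_subgroup: "H = bit_subgroup (bits ` H)"
proof
  show "H \<subseteq> bit_subgroup (bits ` H)" using subset by (auto simp: bit_subgroup_def)
  show "bit_subgroup (bits ` H) \<subseteq> H"
  proof
    fix A assume "A \<in> bit_subgroup (bits ` H)"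
    then obtain h where A: "A \<in> norm_cartan" "h \<in> H" "bits A = bits h" by (auto simp: bit_subgroup_def)
    have h: "h \<in> norm_cartan" "invertible h" using A(2) subset norm_cartan_inverse by blast+
    define B where "B = A ** inv\<^bsub>GL2\<^esub> h"
    have "B \<in> norm_cartan"
      unfolding B_def by (intro bits_mult norm_cartan_inverse A h)
    moreover have "bits B = (False, False, False)"
      unfolding B_def using bits_mult(2)[OF A(1) norm_cartan_inverse(2)[OF h(1)]] norm_cartan_inverse(3)[OF h(1)] A(3)
      by (cases "bits h") auto
    ultimately obtain a b where ab: "B = nmat 1 a b" "4 dvd a - 1" "2 dvd b"
      using bits_nmat_m1 by (cases rule: norm_cartan_cases) auto
    then obtain u v where uv: "a - 1 = 4 * u" "b = 2 * v" by (auto elim!: dvdE)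
    have "a = 1 + 4 * u" using uv(1) by (simp add: algebra_simps)
    hence "B = level_mat 0 u v" using ab uv by (simp add: level_mat_def)
    hence "B \<in> H" using level_0_in by simp
    moreover have "A = B ** h"
      unfolding B_def using invertible_imp_inv_GL2(2)[OF h(2)]
      by (simp only: matrix_mul_assoc[symmetric] matrix_mul_rid)
    ultimately show "A \<in> H" using A(2) mult_closed by simp
  qed
qed

end

section \<open>The groups of the statement in terms of the characters\<close>

lemma xor3_0 [simp]: "xor3 (False, False, False) x = x" "xor3 x (False, False, False) = x" "xor3 x x = (False, False, False)"
  by (cases x; simp)+

lemma bits_image_closed:
  assumes "subgroup H GL2" "H \<subseteq> norm_cartan"
  shows "(False, False, False) \<in> bits ` H" "x \<in> bits ` H \<Longrightarrow> y \<in> bits ` H \<Longrightarrow> xor3 x y \<in> bits ` H"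
proof -
  have "mat 1 \<in> H" using subgroup.one_closed[OF assms(1)] by simp
  thus "(False, False, False) \<in> bits ` H" by (force simp: mat_1_eq_nmat)
  assume "x \<in> bits ` H" "y \<in> bits ` H"
  then obtain A B where "A \<in> H" "B \<in> H" "x = bits A" "y = bits B" by blast
  moreover from this have "A ** B \<in> H" using subgroup.m_closed[OF assms(1)] by simp
  ultimately show "xor3 x y \<in> bits ` H"
    using assms(2) bits_mult(2)[of A B] by (metis imageI subsetD)
qed

text \<open>\<open>S\<close> is the group generated by \<open>s1\<close> and \<open>s2\<close>. The
  conditions on them say that \<open>A\<close> and \<open>B\<close> can serve as \<open>h1\<close>
  and \<open>h2\<close> of the locale, so a closed subgroup containing \<open>X\<close> is
  determined by its bits.\<close>

lemma topgen_eq_bit_subgroup: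
  assumes X: "X \<subseteq> bit_subgroup S"
    and S: "S = {(False, False, False), s1, s2, xor3 s1 s2}"
    and m: "A \<in> X" "bits A = s1" "B \<in> X" "bits B = s2"
    and s: "fst (snd s1)" "\<not> snd (snd s1)" "snd (snd s2)"
  shows "topgen X = bit_subgroup S"
proof
  have "xor3 x y \<in> S" if "x \<in> S" "y \<in> S" for x y
  proof -
    have [simp]: "xor3 s1 (xor3 s1 s2) = s2" "xor3 s2 (xor3 s1 s2) = s1" "xor3 (xor3 s1 s2) s2 = s1"
        "xor3 (xor3 s1 s2) s1 = s2" "xor3 s2 s1 = xor3 s1 s2"
      by (cases s1; cases s2; auto)+
    show ?thesis using that unfolding S by auto
  qed
  hence cl: "closed_subgroup_GL2 (bit_subgroup S)"
    by (intro closed_subgroup_bit_subgroup) (simp_all add: S)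
  show "topgen X \<subseteq> bit_subgroup S" by (rule topgen_subset[OF cl X])
  show "bit_subgroup S \<subseteq> topgen X"
    unfolding topgen_def
  proof (rule Inter_greatest)
    fix H' assume "H' \<in> {H. subgroup H GL2 \<and> closedin (top_of_set (carrier GL2)) H \<and> X \<subseteq> H}"
    hence H': "closed_subgroup_GL2 H'" "X \<subseteq> H'" by auto
    \<comment> \<open>\<open>H'\<close> need not lie in the normalizer, as the locale requires; its
      intersection with the bit subgroup does.\<close>
    define H where "H = H' \<inter> bit_subgroup S"
    have H: "closed_subgroup_GL2 H" "X \<subseteq> H"
      unfolding H_def using H' cl X group.subgroups_Inter_pair[OF group_GL2] by auto
    have sub: "H \<subseteq> norm_cartan" by (auto simp: H_def bit_subgroup_def)
    interpret norm_cartan_subgroup H A B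
      using H sub m s by unfold_locales auto
    have "S \<subseteq> bits ` H"
    proof -
      have "s1 \<in> bits ` H" "s2 \<in> bits ` H" using m H by auto
      thus ?thesis unfolding S using bits_image_closed[of H] H sub by auto
    qed
    hence "bit_subgroup S \<subseteq> bit_subgroup (bits ` H)" by (auto simp: bit_subgroup_def)
    thus "bit_subgroup S \<subseteq> H'" using eq_bit_subgroup H_def by blast
  qed
qed

lemma c_eps_eq_nmat: "c_eps e = nmat (- 1) e 0"
  by (simp add: c_eps_def nmat_def)

lemma z2_mod4_simps [simp]:
  "\<not> 4 dvd (- 1 - 1 :: z2)" "\<not> 2 dvd (5 :: z2)" "\<not> 2 dvd (- 1 :: z2)"
  "\<not> 4 dvd (- 2 :: z2)" "\<not> 4 dvd (2 :: z2)"
proof -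
  have "4 dvd (- 2 :: z2) \<longleftrightarrow> 2 dvd (- 1 :: z2)"
    using z2_two_power_dvd_double[of 1 "- 1"] by simp
  thus "\<not> 4 dvd (- 2 :: z2)" "\<not> 4 dvd (- 1 - 1 :: z2)" "\<not> 4 dvd (2 :: z2)" by simp_all
  show "\<not> 2 dvd (5 :: z2)" using z2_two_dvd_add_iff[of 1 4] by simp
qed simp

lemma topgen_insert_topgen: "closed_subgroup_GL2 H \<Longrightarrow> topgen X \<union> Y \<subseteq> H \<longleftrightarrow> X \<union> Y \<subseteq> H"
  using topgen_superset[of X] topgen_subset[of H X] by auto

lemma topgen_topgen_Un: "topgen (topgen X \<union> Y) = topgen (X \<union> Y)"
  unfolding topgen_def[of "topgen X \<union> Y"] topgen_def[of "X \<union> Y"]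
  using topgen_insert_topgen by (intro arg_cong[of _ _ Inter]) blast

lemma mat_5_eq: "mat 5 = nmat 1 5 0"
  by (simp add: mat_eq_mat2 nmat_def)

text \<open>Each group is the kernel of one character: the first, or its product with the second,
  with the second and the third, or with the third.\<close>

lemma topgen_G21_c1: "topgen (G21 \<union> {c_eps 1}) = bit_subgroup {x. \<not> fst x}"
  and topgen_G22_c1: "topgen (G22 \<union> {c_eps 1}) = bit_subgroup {x. fst x = fst (snd x)}"
  and topgen_G22_cm1: "topgen (G22 \<union> {c_eps (- 1)}) = bit_subgroup {x. fst x = (fst (snd x) \<noteq> snd (snd x))}"
  and topgen_G21_cm1: "topgen (G21 \<union> {c_eps (- 1)}) = bit_subgroup {x. fst x = snd (snd x)}"
proof -
  have g: "mat2 1 1 (- 4) 1 = nmat 1 1 1" "mat2 (- 1) (- 1) 4 (- 1) = nmat 1 (- 1) (- 1)"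
    by (simp_all add: nmat_def)
  note * = G21_def G22_def topgen_topgen_Un mat_5_eq g c_eps_eq_nmat
  have S: "{x. \<not> fst x} = {(False, False, False), (False, True, False), (False, False, True),
        xor3 (False, True, False) (False, False, True)}"
      "{x. fst x = fst (snd x)} = {(False, False, False), (True, True, False), (False, False, True),
        xor3 (True, True, False) (False, False, True)}"
      "{x. fst x = (fst (snd x) \<noteq> snd (snd x))} = {(False, False, False), (True, True, False), (True, False, True),
        xor3 (True, True, False) (True, False, True)}"
      "{x. fst x = snd (snd x)} = {(False, False, False), (False, True, False), (True, False, True),
        xor3 (False, True, False) (True, False, True)}"
    by (simp_all add: set_eq_iff all_bool_eq)
  have b: "bits (nmat (- 1) 1 0) = (False, False, True)" "bits (nmat (- 1) (- 1) 0) = (True, False, True)"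
      "bits (nmat 1 1 1) = (False, True, False)" "bits (nmat 1 (- 1) (- 1)) = (True, True, False)"
      "bits (nmat 1 5 0) = (False, False, False)"
    by (simp_all add: bits_nmat_m1)
  have n: "nmat (- 1) 1 0 \<in> norm_cartan" "nmat (- 1) (- 1) 0 \<in> norm_cartan" "nmat 1 1 1 \<in> norm_cartan"
      "nmat 1 (- 1) (- 1) \<in> norm_cartan" "nmat 1 5 0 \<in> norm_cartan"
    by (simp_all add: nmat_in_norm_cartan)
  show "topgen (G21 \<union> {c_eps 1}) = bit_subgroup {x. \<not> fst x}"
    unfolding * by (rule topgen_eq_bit_subgroup[OF _ S(1) _ b(3) _ b(1)]) (simp_all add: bit_subgroup_def b n)
  show "topgen (G22 \<union> {c_eps 1}) = bit_subgroup {x. fst x = fst (snd x)}"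
    unfolding * by (rule topgen_eq_bit_subgroup[OF _ S(2) _ b(4) _ b(1)]) (simp_all add: bit_subgroup_def b n)
  show "topgen (G22 \<union> {c_eps (- 1)}) = bit_subgroup {x. fst x = (fst (snd x) \<noteq> snd (snd x))}"
    unfolding * by (rule topgen_eq_bit_subgroup[OF _ S(3) _ b(4) _ b(2)]) (simp_all add: bit_subgroup_def b n)
  show "topgen (G21 \<union> {c_eps (- 1)}) = bit_subgroup {x. fst x = snd (snd x)}"
    unfolding * by (rule topgen_eq_bit_subgroup[OF _ S(4) _ b(3) _ b(2)]) (simp_all add: bit_subgroup_def b n)
qed

lemma normalizer_cartan_eq: "normalizer_cartan = bit_subgroup UNIV"
proof
  have UNIV: "closed_subgroup_GL2 (bit_subgroup UNIV)"
    by (rule closed_subgroup_bit_subgroup) auto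
  have cartan: "cartan = {nmat 1 a b | a b. \<not> 2 dvd a}"
  proof -
    have "a\<^sup>2 + 4 * b\<^sup>2 dvd 1 \<longleftrightarrow> \<not> 2 dvd a" for a b :: z2
      by (simp add: z2_dvd_one_iff z2_two_dvd_add_iff power2_eq_square z2_two_dvd_mult_iff)
    thus ?thesis unfolding cartan_def nmat_def by simp
  qed
  show "normalizer_cartan \<subseteq> bit_subgroup UNIV"
    unfolding normalizer_cartan_def
    by (rule topgen_subset[OF UNIV])
      (auto simp: cartan c_eps_eq_nmat bit_subgroup_def nmat_in_norm_cartan)
  show "bit_subgroup UNIV \<subseteq> normalizer_cartan"
    unfolding normalizer_cartan_def topgen_def
  proof (rule Inter_greatest, rule subsetI)
    fix H A assume "H \<in> {H. subgroup H GL2 \<and> closedin (top_of_set (carrier GL2)) H \<and> cartan \<union> {c_eps 1} \<subseteq> H}"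
    hence H: "subgroup H GL2" "cartan \<subseteq> H" "nmat (- 1) 1 0 \<in> H" by (auto simp: c_eps_eq_nmat)
    assume "A \<in> bit_subgroup UNIV"
    hence "A \<in> norm_cartan" by (simp add: bit_subgroup_def)
    thus "A \<in> H"
    proof (cases rule: norm_cartan_cases)
      case (1 a b)
      thus ?thesis using H(2) by (auto simp: cartan)
    next
      case (2 a b)
      \<comment> \<open>\<open>c_eps 1\<close> times a + 2 b i equals a - 2 b i times
        \<open>c_eps 1\<close>, so the elements outside the Cartan group are products of
        generators.\<close>
      have "nmat 1 a (- b) ** nmat (- 1) 1 0 \<in> H"
        using subgroup.m_closed[OF H(1), of "nmat 1 a (- b)" "nmat (- 1) 1 0"] H(2,3) 2 by (auto simp: cartan)
      thus ?thesis using 2 by simp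
    qed
  qed
qed

subsection \<open>Conjugacy\<close>

lemma conj_rel_iff: "(G, H) \<in> conj_rel \<longleftrightarrow> (\<exists>M. invertible M \<and> H = (\<lambda>A. M ** A ** inv\<^bsub>GL2\<^esub> M) ` G)"
  by (auto simp: conj_rel_def)

lemma conj_relI:
  assumes "M ** N = mat 1" "N ** M = mat 1" "H = (\<lambda>A. M ** A ** N) ` G"
  shows "(G, H) \<in> conj_rel"
  using assms inv_GL2_eq[OF assms(1,2)] by (auto simp: conj_rel_iff)

lemma conj_relE:
  assumes "(G, H) \<in> conj_rel"
  obtains M N where "M ** N = mat 1" "N ** M = mat 1" "H = (\<lambda>A. M ** A ** N) ` G"
  using assms invertible_imp_inv_GL2 that unfolding conj_rel_iff by blast

lemma conj_rel_refl: "(G, G) \<in> conj_rel"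
  by (rule conj_relI[of "mat 1" "mat 1"]) auto

lemma conj_rel_sym:
  assumes "(G, H) \<in> conj_rel"
  shows "(H, G) \<in> conj_rel"
proof -
  obtain M N where MN: "M ** N = mat 1" "N ** M = mat 1" "H = (\<lambda>A. M ** A ** N) ` G"
    using assms by (rule conj_relE)
  have "N ** (M ** A ** N) ** M = A" for A
    using MN(2) by (metis matrix_mul_assoc matrix_mul_lid matrix_mul_rid)
  hence "G = (\<lambda>A. N ** A ** M) ` H" unfolding MN(3) image_image by simp
  thus ?thesis by (rule conj_relI[OF MN(2,1)])
qed

lemma conj_rel_trans:
  assumes "(G, H) \<in> conj_rel" "(H, K) \<in> conj_rel"
  shows "(G, K) \<in> conj_rel"
proof -
  obtain M N where MN: "M ** N = mat 1" "N ** M = mat 1" "H = (\<lambda>A. M ** A ** N) ` G"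
    using assms(1) by (rule conj_relE)
  obtain M' N' where MN': "M' ** N' = mat 1" "N' ** M' = mat 1" "K = (\<lambda>A. M' ** A ** N') ` H"
    using assms(2) by (rule conj_relE)
  show ?thesis
  proof (rule conj_relI)
    show "M' ** M ** (N ** N') = mat 1" "N ** N' ** (M' ** M) = mat 1"
      using MN MN' by (metis matrix_mul_assoc matrix_mul_rid)+
    show "K = (\<lambda>A. M' ** M ** A ** (N ** N')) ` G"
      unfolding MN' MN image_image by (simp add: matrix_mul_assoc)
  qed
qed

lemma equiv_conj_rel: "equiv UNIV conj_rel"
proof (rule equivI)
  show "refl conj_rel" by (rule refl_onI) (simp_all add: conj_rel_refl)
  show "sym conj_rel" by (rule symI) (rule conj_rel_sym)
  show "trans conj_rel" by (rule transI) (rule conj_rel_trans)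
qed simp

section \<open>Conjugacy invariants\<close>

definition fixes_mod4 :: "(z2 ^ 2 ^ 2) set \<Rightarrow> bool" where
  "fixes_mod4 G \<longleftrightarrow> (\<exists>v. (\<exists>i. \<not> 2 dvd v $ i) \<and> (\<forall>A\<in>G. \<forall>i. 4 dvd (A *v v) $ i - v $ i))"

lemma mat_vec_nth: "(A *v v) $ i = A $ i $ 1 * v $ 1 + A $ i $ 2 * v $ 2" for A :: "z2 ^ 2 ^ 2"
  by (simp add: matrix_vector_mult_def sum_2)

lemma dvd_mat_vec:
  assumes "\<And>i. k dvd v $ i"
  shows "k dvd ((A :: z2 ^ 2 ^ 2) *v v) $ i"
  unfolding mat_vec_nth using assms by (intro dvd_add dvd_mult) auto

text \<open>On the Tate module, \<open>fixes_mod4\<close> means that some point of order 4 is fixed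
  by the whole group. The image under \<open>M\<close> keeps an odd coordinate because
  \<open>N\<close> would carry an even vector back to an even one.\<close>

lemma fixes_mod4_conj:
  assumes "(G, H) \<in> conj_rel" "fixes_mod4 G"
  shows "fixes_mod4 H"
proof -
  obtain M N where MN: "M ** N = mat 1" "N ** M = mat 1" "H = (\<lambda>A. M ** A ** N) ` G"
    using assms(1) by (rule conj_relE)
  obtain v i where v: "\<not> 2 dvd v $ i" "\<And>A j. A \<in> G \<Longrightarrow> 4 dvd (A *v v) $ j - v $ j"
    using assms(2) by (auto simp: fixes_mod4_def)
  have Nv: "N *v (M *v v) = v" using MN(2) by (simp add: matrix_vector_mul_assoc)
  have "\<exists>j. \<not> 2 dvd (M *v v) $ j"
    using v(1) dvd_mat_vec[of 2 "M *v v" N i] unfolding Nv by blast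
  moreover have "4 dvd ((M ** A ** N) *v (M *v v)) $ j - (M *v v) $ j" if "A \<in> G" for A j
  proof -
    have "(M ** A ** N) *v (M *v v) = M *v (A *v v)"
      using Nv by (simp flip: matrix_vector_mul_assoc)
    hence "((M ** A ** N) *v (M *v v)) $ j - (M *v v) $ j = (M *v (A *v v - v)) $ j"
      by (simp add: matrix_vector_mult_diff_distrib)
    also have "4 dvd \<dots>" using v(2)[OF that] by (intro dvd_mat_vec) simp
    finally show ?thesis .
  qed
  ultimately show ?thesis unfolding fixes_mod4_def MN(3) by (intro exI[of _ "M *v v"]) blast
qed

definition mat_trace :: "z2 ^ 2 ^ 2 \<Rightarrow> z2" where "mat_trace A = A $ 1 $ 1 + A $ 2 $ 2"

lemma mat_trace_commute: "mat_trace (A ** B) = mat_trace (B ** A)"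
  by (simp add: mat_trace_def matrix_mult_nth algebra_simps)

lemma mat_trace_conj:
  assumes "(G, H) \<in> conj_rel"
  shows "mat_trace ` H = mat_trace ` G"
proof -
  obtain M N where MN: "M ** N = mat 1" "N ** M = mat 1" "H = (\<lambda>A. M ** A ** N) ` G"
    using assms by (rule conj_relE)
  have "mat_trace (M ** A ** N) = mat_trace A" for A
    by (subst mat_trace_commute) (simp add: matrix_mul_assoc MN)
  thus ?thesis by (simp add: MN(3) image_image)
qed

text \<open>\<open>nmat 1 (- 1) 0\<close> is the scalar -1, which is central.\<close>

lemma minus_one_conj:
  assumes "(G, H) \<in> conj_rel" "nmat 1 (- 1) 0 \<in> G"
  shows "nmat 1 (- 1) 0 \<in> H"
proof -
  obtain M N where MN: "M ** N = mat 1" "N ** M = mat 1" "H = (\<lambda>A. M ** A ** N) ` G"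
    using assms(1) by (rule conj_relE)
  have "nmat 1 (- 1) 0 ** B = - B" "B ** nmat 1 (- 1) 0 = - B" for B
    by (rule mat2_eqI; simp add: matrix_mult_nth nmat_def)+
  hence "M ** nmat 1 (- 1) 0 ** N = nmat 1 (- 1) 0 ** M ** N" by simp
  also have "\<dots> = nmat 1 (- 1) 0" by (simp add: MN(1) flip: matrix_mul_assoc)
  finally show ?thesis unfolding MN(3) using assms(2) by force
qed

instance z2 :: ring_char_0
proof
  show "inj (of_nat :: nat \<Rightarrow> z2)"
  proof (rule injI)
    fix m n :: nat
    assume *: "of_nat m = (of_nat n :: z2)"
    define k where "k = m + n"
    have "int m < 2 ^ k" "int n < 2 ^ k"
      using of_nat_less_two_power[of k, where ?'a = int] unfolding k_def by linarith+
    moreover have "int m mod 2 ^ k = int n mod 2 ^ k"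
      using arg_cong[OF *, of "\<lambda>x. res x k"] by (simp add: res_of_nat)
    ultimately show "m = n" by simp
  qed
qed

definition image_of :: "int \<Rightarrow> (z2 ^ 2 ^ 2) set" where
  "image_of d = bit_subgroup (if d = 2 then {x. \<not> fst x} else if d = 1 then {x. fst x = fst (snd x)}
     else if d = - 1 then {x. fst x = (fst (snd x) \<noteq> snd (snd x))} else if d = - 2 then {x. fst x = snd (snd x)} else UNIV)"

text \<open>Elements outside the Cartan group have trace 0, and a + 2 b i has trace 2 a. So trace -2
  forces a = -1, where the first bit is set and the third is not. The relations for d = 2 and d = -2
  exclude this; the other groups allow it with \<open>b\<close> odd.\<close>

lemma minus_two_in_trace:
  "- 2 \<in> mat_trace ` image_of d \<longleftrightarrow> d \<noteq> 2 \<and> d \<noteq> - 2"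
proof (cases "d = 2 \<or> d = - 2")
  case True
  have "mat_trace A \<noteq> - 2" if "A \<in> image_of d" for A
  proof
    assume tr: "mat_trace A = - 2"
    have "A \<in> norm_cartan" using that by (simp add: image_of_def bit_subgroup_def)
    thus False
    proof (cases rule: norm_cartan_cases)
      case (1 a b)
      hence "2 * (a + 1) = 0" using tr by (simp add: mat_trace_def nmat_def algebra_simps)
      hence "a = - 1" using z2_double_eq_0 add_eq_0_iff2 by blast
      thus False using that 1 True by (auto simp: image_of_def bit_subgroup_def)
    next
      case (2 a b)
      thus False using tr by (simp add: mat_trace_def nmat_def)
    qed
  qed
  thus ?thesis using True by force
next
  case False
  have "nmat 1 (- 1) 1 \<in> image_of d"
    using False by (simp add: image_of_def bit_subgroup_def nmat_in_norm_cartan)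
  moreover have "mat_trace (nmat 1 (- 1) 1) = - 2" by (simp add: mat_trace_def nmat_def)
  ultimately show ?thesis using False by (metis imageI)
qed

lemma fixes_mod4_image_of: "fixes_mod4 (image_of d) \<longleftrightarrow> d = 1 \<or> d = 2"
proof -
  have 4: "4 dvd 2 * x \<longleftrightarrow> 2 dvd x" for x :: z2
    using z2_two_power_dvd_double[of 1 x] by simp
  show ?thesis
  proof
    assume d: "d = 1 \<or> d = 2"
    show "fixes_mod4 (image_of d)"
    proof (cases "d = 2")
      case True
      show ?thesis
        unfolding fixes_mod4_def
      proof (intro exI conjI ballI allI)
        \<comment> \<open>For d = 2 the upper left entry is 1 modulo 4 and the lower left entry is
          divisible by 4, so the first basis vector is fixed.\<close>
        show "\<not> 2 dvd (vector [1, 0] :: z2 ^ 2) $ 1" by simp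
        fix A and i :: 2 assume "A \<in> image_of d"
        hence A: "A \<in> norm_cartan" "\<not> fst (bits A)" using True by (simp_all add: image_of_def bit_subgroup_def)
        thus "4 dvd (A *v vector [1, 0]) $ i - vector [1, 0] $ i"
          using exhaust_2[of i]
          by (cases rule: norm_cartan_cases) (auto simp: mat_vec_nth nmat_def bits_def)
      qed
    next
      case False
      show ?thesis
        unfolding fixes_mod4_def
      proof (intro exI conjI ballI allI)
        \<comment> \<open>For d = 1 the relation says that \<open>a\<close> is 1 modulo 4 exactly if
          \<open>b\<close> is even. This amounts to a + 2 b being 1 modulo 4, which is the first
          coordinate of the image of (1, 2).\<close>
        show "\<not> 2 dvd (vector [1, 2] :: z2 ^ 2) $ 1" by simp
        fix A and i :: 2 assume "A \<in> image_of d"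
        hence A: "A \<in> norm_cartan" "fst (bits A) = fst (snd (bits A))"
          using d False by (simp_all add: image_of_def bit_subgroup_def)
        have *: "4 dvd a + 2 * b - 1" "4 dvd 2 * a - 4 * b - 2" "4 dvd 4 * b - 2 * a - 2"
          if odd: "\<not> 2 dvd a" and bit: "4 dvd a - 1 \<longleftrightarrow> 2 dvd b" for a b :: z2
        proof -
          obtain u where u: "a = 1 + 2 * u" using odd z2_odd_iff[of a] by blast
          have "2 dvd u \<longleftrightarrow> 2 dvd b" using bit 4[of u] by (simp add: u)
          hence "2 dvd u + b" by (simp add: z2_two_dvd_add_iff)
          hence "4 dvd 2 * (u + b)" by (simp only: 4)
          moreover have "a + 2 * b - 1 = 2 * (u + b)" by (simp add: u algebra_simps)
          ultimately show "4 dvd a + 2 * b - 1" by (simp only:)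
          have "2 * a - 4 * b - 2 = 4 * (u - b)" "4 * b - 2 * a - 2 = 4 * (b - u - 1)"
            by (simp_all add: u algebra_simps)
          thus "4 dvd 2 * a - 4 * b - 2" "4 dvd 4 * b - 2 * a - 2" by (metis dvd_triv_left)+
        qed
        have "4 dvd A $ 1 $ 1 + 2 * A $ 1 $ 2 - 1 \<and> 4 dvd A $ 2 $ 1 + 2 * A $ 2 $ 2 - 2"
          using A
        proof (cases rule: norm_cartan_cases)
          case (1 a b)
          thus ?thesis using A(2) *[of a b] by (simp add: nmat_def bits_def algebra_simps)
        next
          case (2 a b)
          thus ?thesis using A(2) *[of a b] by (simp add: nmat_def bits_def algebra_simps)
        qed
        thus "4 dvd (A *v vector [1, 2]) $ i - vector [1, 2] $ i"
          using exhaust_2[of i] by (auto simp: mat_vec_nth algebra_simps)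
      qed
    qed
  next
    assume "fixes_mod4 (image_of d)"
    then obtain v where v: "\<exists>i. \<not> 2 dvd v $ i" "\<And>A i. A \<in> image_of d \<Longrightarrow> 4 dvd (A *v v) $ i - v $ i"
      by (auto simp: fixes_mod4_def)
    show "d = 1 \<or> d = 2"
    proof (rule ccontr)
      assume d: "\<not> ?thesis"
      \<comment> \<open>This is \<open>c_eps (- 1)\<close>; it forces the first coordinate of a
        fixed vector to be even. An element with upper right entry 1 then does the same to the
        second.\<close>
      have "nmat (- 1) (- 1) 0 \<in> image_of d"
        using d by (auto simp: image_of_def bit_subgroup_def nmat_in_norm_cartan bits_nmat_m1)
      from v(2)[OF this, of 1] have "4 dvd 2 * - v $ 1"
        by (simp add: mat_vec_nth nmat_def)
      hence 1: "2 dvd v $ 1" unfolding 4 by simp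
      have "\<exists>a. a * a = 1 \<and> nmat 1 a 1 \<in> image_of d"
      proof (cases "d = - 2")
        case True
        thus ?thesis by (intro exI[of _ 1]) (auto simp: image_of_def bit_subgroup_def nmat_in_norm_cartan)
      next
        case False
        thus ?thesis using d by (intro exI[of _ "- 1"]) (auto simp: image_of_def bit_subgroup_def nmat_in_norm_cartan)
      qed
      then obtain a where a: "a * a = 1" "nmat 1 a 1 \<in> image_of d" by blast
      have "4 dvd a * v $ 1 + v $ 2 - v $ 1"
        using v(2)[OF a(2), of 1] by (simp add: mat_vec_nth nmat_def)
      hence "2 dvd a * v $ 1 + v $ 2 - v $ 1" using dvd_trans z2_two_dvd_four by blast
      moreover have "2 dvd a * v $ 1 - v $ 1" using 1 by (intro dvd_diff) auto
      ultimately have "2 dvd (a * v $ 1 + v $ 2 - v $ 1) - (a * v $ 1 - v $ 1)" by (rule dvd_diff)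
      hence "2 dvd v $ 2" by simp
      thus False using v(1) 1 exhaust_2 by metis
    qed
  qed
qed

lemma minus_one_in_image_of: "nmat 1 (- 1) 0 \<in> image_of d \<longleftrightarrow> d \<notin> {1, - 1, 2, - 2}"
  by (auto simp: image_of_def bit_subgroup_def nmat_in_norm_cartan)

text \<open>Trace -2 separates d = 2 and d = -2 from the rest, the fixed vector separates d = 1 and
  d = 2 from the rest, and the scalar -1 occurs only in the full group.\<close>

lemma image_of_conj_iff:
  "(image_of d, image_of d') \<in> conj_rel \<longleftrightarrow> d = d' \<or> d \<notin> {1, - 1, 2, - 2} \<and> d' \<notin> {1, - 1, 2, - 2}"
proof
  assume *: "(image_of d, image_of d') \<in> conj_rel"
  have sym: "(image_of d', image_of d) \<in> conj_rel" by (rule conj_rel_sym[OF *])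
  have "d \<noteq> 2 \<and> d \<noteq> - 2 \<longleftrightarrow> d' \<noteq> 2 \<and> d' \<noteq> - 2"
    using mat_trace_conj[OF *] by (simp flip: minus_two_in_trace)
  moreover have "d = 1 \<or> d = 2 \<longleftrightarrow> d' = 1 \<or> d' = 2"
    using fixes_mod4_conj[OF *] fixes_mod4_conj[OF sym] fixes_mod4_image_of by blast
  moreover have "d \<notin> {1, - 1, 2, - 2} \<longleftrightarrow> d' \<notin> {1, - 1, 2, - 2}"
    using minus_one_conj[OF *] minus_one_conj[OF sym] unfolding minus_one_in_image_of by argo
  ultimately show "d = d' \<or> d \<notin> {1, - 1, 2, - 2} \<and> d' \<notin> {1, - 1, 2, - 2}" by auto
next
  assume *: "d = d' \<or> d \<notin> {1, - 1, 2, - 2} \<and> d' \<notin> {1, - 1, 2, - 2}"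
  hence "image_of d = image_of d'" by (auto simp: image_of_def)
  thus "(image_of d, image_of d') \<in> conj_rel" by (simp add: conj_rel_refl)
qed

subsection \<open>The group law\<close>

fun ell_neg :: "'k :: field point \<Rightarrow> 'k point" where
  "ell_neg Infinity = Infinity"
| "ell_neg (Affine x y) = Affine x (- y)"

lemma ell_neg_neg [simp]: "ell_neg (ell_neg P) = P"
  by (cases P) auto

lemma ell_add_Infinity_right [simp]: "ell_add a P Infinity = P"
  by (cases P) auto

lemma complex_eq_neg_imp_0: "(z :: complex) = - z \<Longrightarrow> z = 0"
  by (simp add: complex_eq_iff)

locale weierstrass =
  fixes a b :: complex
  assumes nonsingular: "ell_disc a b \<noteq> 0"
begin

abbreviation add (infixl \<open>\<oplus>\<close> 65) where "P \<oplus> Q \<equiv> ell_add a P Q"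

definition curve :: "complex point set" where
  "curve = insert Infinity {Affine x y | x y. y\<^sup>2 = x ^ 3 + a * x + b}"

lemma Affine_in_curve [simp]: "Affine x y \<in> curve \<longleftrightarrow> y\<^sup>2 = x ^ 3 + a * x + b"
  and Infinity_in_curve [simp]: "Infinity \<in> curve"
  by (auto simp: curve_def)

lemma ell_neg_in_curve [simp]: "ell_neg P \<in> curve \<longleftrightarrow> P \<in> curve"
  by (cases P) auto

lemma no_singular_point: "x ^ 3 + a * x + b = 0 \<Longrightarrow> 3 * x\<^sup>2 + a \<noteq> 0"
proof
  assume *: "x ^ 3 + a * x + b = 0" "3 * x\<^sup>2 + a = 0"
  have "a = - (3 * x\<^sup>2)" using *(2) by algebra
  moreover from this have "b = 2 * x ^ 3" using *(1) by algebra
  ultimately have "4 * a ^ 3 + 27 * b\<^sup>2 = 0" by algebra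
  thus False using nonsingular by (simp add: ell_disc_def)
qed

text \<open>
  \<open>collinear x\<^sub>1 y\<^sub>1 x\<^sub>2 y\<^sub>2 x\<^sub>3 y\<^sub>3\<close> states that, counted with multiplicity, the three
  points are the intersection of the curve with a line \<open>y = l x + m\<close>: the last three
  equations compare coefficients in
  \<open>x\<^sup>3 + a x + b - (l x + m)\<^sup>2 = (x - x\<^sub>1) (x - x\<^sub>2) (x - x\<^sub>3)\<close>.
\<close>

definition cubic_roots :: "complex \<Rightarrow> complex \<Rightarrow> complex \<Rightarrow> complex \<Rightarrow> complex \<Rightarrow> bool" where
  "cubic_roots l m x1 x2 x3 \<longleftrightarrow> l\<^sup>2 = x1 + x2 + x3 \<and> a - 2 * l * m = x1 * x2 + x1 * x3 + x2 * x3 \<and>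
     b - m\<^sup>2 = - (x1 * x2 * x3)"

definition collinear :: "complex \<Rightarrow> complex \<Rightarrow> complex point \<Rightarrow> complex point \<Rightarrow> complex point \<Rightarrow> bool" where
  "collinear l m P Q R \<longleftrightarrow> (\<exists>x1 x2 x3. P = Affine x1 (l * x1 + m) \<and> Q = Affine x2 (l * x2 + m) \<and>
     R = Affine x3 (l * x3 + m) \<and> cubic_roots l m x1 x2 x3)"

lemma cubic_roots_perm:
  "cubic_roots l m x1 x2 x3 \<Longrightarrow> cubic_roots l m x3 x2 x1"
  "cubic_roots l m x1 x2 x3 \<Longrightarrow> cubic_roots l m x2 x1 x3"
  by (simp_all add: cubic_roots_def add_ac mult_ac)

lemma collinear_perm:
  "collinear l m P Q R \<Longrightarrow> collinear l m R Q P"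
  "collinear l m P Q R \<Longrightarrow> collinear l m Q P R"
  unfolding collinear_def using cubic_roots_perm by blast+

lemma cubic_roots_eq:
  assumes "cubic_roots l m x1 x2 x3"
  shows "x ^ 3 + a * x + b - (l * x + m)\<^sup>2 = (x - x1) * (x - x2) * (x - x3)"
  using assms unfolding cubic_roots_def by algebra

lemma add_collinear:
  assumes "P \<in> curve" "Q \<in> curve" "P \<noteq> Infinity" "Q \<noteq> Infinity" "P \<noteq> ell_neg Q"
  shows "\<exists>l m. collinear l m P Q (ell_neg (P \<oplus> Q))"
proof -
  obtain x1 y1 where P: "P = Affine x1 y1" using assms by (cases P) auto
  obtain x2 y2 where Q: "Q = Affine x2 y2" using assms by (cases Q) auto
  have c1: "y1\<^sup>2 = x1 ^ 3 + a * x1 + b" and c2: "y2\<^sup>2 = x2 ^ 3 + a * x2 + b"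
    using assms P Q by auto
  have neg: "\<not> (x1 = x2 \<and> y1 = - y2)" using assms P Q by auto
  define l where "l = (if x1 = x2 then (3 * x1\<^sup>2 + a) / (2 * y1) else (y2 - y1) / (x2 - x1))"
  define m where "m = y1 - l * x1"
  define x3 where "x3 = l\<^sup>2 - x1 - x2"
  have y1: "y1 = l * x1 + m" by (simp add: m_def)
  have "y2 = l * x2 + m \<and> a - 2 * l * m = x1 * x2 + x1 * x3 + x2 * x3"
  proof (cases "x1 = x2")
    case True
    have "(y1 - y2) * (y1 + y2) = 0" using c1 c2 True by algebra
    hence y: "y1 = y2" using neg True by (auto simp: add_eq_0_iff2)
    have "y1 \<noteq> 0" using neg True y by auto
    hence "l * (2 * y1) = 3 * x1\<^sup>2 + a" using True by (simp add: l_def)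
    hence "a - 2 * l * m = x1 * x2 + x1 * x3 + x2 * x3"
      using True y1 unfolding x3_def by algebra
    thus ?thesis using y True y1 by simp
  next
    case False
    hence l: "l * (x2 - x1) = y2 - y1" by (simp add: l_def)
    hence y2: "y2 = l * x2 + m" using y1 by algebra
    \<comment> \<open>The difference of the two curve equations is divisible by
      \<open>x2 - x1\<close>, and the cofactor is the comparison of the linear coefficients.\<close>
    have "(x2 - x1) * (a - 2 * l * m - (x1 * x2 + x1 * x3 + x2 * x3)) = 0"
      using c1 c2 unfolding y1 y2 x3_def by algebra
    thus ?thesis using False y2 by simp
  qed
  moreover from this have "b - m\<^sup>2 = - (x1 * x2 * x3)"
    using c1 y1 unfolding x3_def by algebra
  ultimately have "cubic_roots l m x1 x2 x3" by (simp add: cubic_roots_def x3_def)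
  moreover have "P \<oplus> Q = Affine x3 (l * (x1 - x3) - y1)"
    using neg unfolding P Q l_def x3_def by (simp add: Let_def)
  hence "ell_neg (P \<oplus> Q) = Affine x3 (l * x3 + m)"
    by (simp add: m_def algebra_simps)
  ultimately show ?thesis
    using P Q y1 \<open>y2 = l * x2 + m \<and> _\<close> unfolding collinear_def by blast
qed

lemma collinear_in_curve:
  assumes "collinear l m P Q R"
  shows "P \<in> curve" "Q \<in> curve" "R \<in> curve"
proof -
  obtain x1 x2 x3 where *: "P = Affine x1 (l * x1 + m)" "Q = Affine x2 (l * x2 + m)"
      "R = Affine x3 (l * x3 + m)" "cubic_roots l m x1 x2 x3"
    using assms by (auto simp: collinear_def)
  have "(l * x + m)\<^sup>2 = x ^ 3 + a * x + b" if "(x - x1) * (x - x2) * (x - x3) = 0" for x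
    using cubic_roots_eq[OF *(4), of x] that by simp
  thus "P \<in> curve" "Q \<in> curve" "R \<in> curve"
    unfolding *(1-3) Affine_in_curve by simp_all
qed

text \<open>With this converse of \<open>add_collinear\<close>, sums can be computed from any line
  with the right intersections, without a case distinction on slopes.\<close>

lemma collinear_add:
  assumes "collinear l m P Q R"
  shows "P \<oplus> Q = ell_neg R"
proof -
  obtain x1 x2 x3 where *: "P = Affine x1 (l * x1 + m)" "Q = Affine x2 (l * x2 + m)"
      "R = Affine x3 (l * x3 + m)" and r: "cubic_roots l m x1 x2 x3"
    using assms by (auto simp: collinear_def)
  \<comment> \<open>If the first two points were opposite, their ordinate would be 0 and
    \<open>x1\<close> a double root of the cubic, contrary to nonsingularity.\<close>
  have neg: "\<not> (x1 = x2 \<and> l * x1 + m = - (l * x2 + m))"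
  proof
    assume neg: "x1 = x2 \<and> l * x1 + m = - (l * x2 + m)"
    hence "l * x1 + m = - (l * x1 + m)" by metis
    hence 0: "l * x1 + m = 0" by (rule complex_eq_neg_imp_0)
    hence "x1 ^ 3 + a * x1 + b = 0"
      using cubic_roots_eq[OF r, of x1] by simp
    moreover have "3 * x1\<^sup>2 + a = 0"
      using r neg 0 unfolding cubic_roots_def by algebra
    ultimately show False using no_singular_point by blast
  qed
  define l' where "l' = (if x1 = x2 then (3 * x1\<^sup>2 + a) / (2 * (l * x1 + m))
      else ((l * x2 + m) - (l * x1 + m)) / (x2 - x1))"
  have "l' = l"
  proof (cases "x1 = x2")
    case True
    define y where "y = l * x1 + m"
    have "y \<noteq> - y" using neg True unfolding y_def by metis
    hence "y \<noteq> 0" by auto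
    moreover have "3 * x1\<^sup>2 + a = l * (2 * y)"
      using r True unfolding cubic_roots_def y_def by algebra
    ultimately show ?thesis using True unfolding l'_def y_def[symmetric] by simp
  next
    case False
    hence "(l * x2 + m) - (l * x1 + m) = l * (x2 - x1)" by (simp add: algebra_simps)
    thus ?thesis using False by (simp add: l'_def)
  qed
  moreover have "P \<oplus> Q = (let x3 = l'\<^sup>2 - x1 - x2 in Affine x3 (l' * (x1 - x3) - (l * x1 + m)))"
    using neg unfolding * l'_def by (simp add: Let_def)
  moreover have "l\<^sup>2 - x1 - x2 = x3" using r by (simp add: cubic_roots_def)
  ultimately show ?thesis using * by (simp add: Let_def algebra_simps)
qed

lemma add_neg_right [simp]: "P \<oplus> ell_neg P = Infinity"
  and add_neg_left [simp]: "ell_neg P \<oplus> P = Infinity"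
  by (cases P; simp)+

lemma add_closed [simp]:
  assumes "P \<in> curve" "Q \<in> curve"
  shows "P \<oplus> Q \<in> curve"
proof (cases "P = Infinity \<or> Q = Infinity \<or> P = ell_neg Q")
  case True
  thus ?thesis using assms by auto
next
  case False
  then obtain l m where "collinear l m P Q (ell_neg (P \<oplus> Q))" using add_collinear assms by blast
  hence "ell_neg (P \<oplus> Q) \<in> curve" by (rule collinear_in_curve)
  thus ?thesis by simp
qed

lemma add_commute:
  assumes "P \<in> curve" "Q \<in> curve"
  shows "P \<oplus> Q = Q \<oplus> P"
proof (cases "P = Infinity \<or> Q = Infinity \<or> P = ell_neg Q")
  case True
  thus ?thesis by auto
next
  case False
  then obtain l m where "collinear l m P Q (ell_neg (P \<oplus> Q))" using add_collinear assms by blast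
  hence "collinear l m Q P (ell_neg (P \<oplus> Q))" by (rule collinear_perm)
  hence "Q \<oplus> P = ell_neg (ell_neg (P \<oplus> Q))" by (rule collinear_add)
  thus ?thesis by simp
qed

lemma neg_add: "ell_neg (P \<oplus> Q) = ell_neg P \<oplus> ell_neg Q"
proof (cases "P = Infinity \<or> Q = Infinity")
  case False
  then obtain x1 y1 x2 y2 where "P = Affine x1 y1" "Q = Affine x2 y2" by (cases P; cases Q) auto
  moreover have "(3 * x1\<^sup>2 + a) / (2 * - y1) = - ((3 * x1\<^sup>2 + a) / (2 * y1))"
      "(- y2 - - y1) / (x2 - x1) = - ((y2 - y1) / (x2 - x1))"
    by (simp_all add: minus_divide_left)
  moreover have "- y1 = - (- y2) \<longleftrightarrow> y1 = - y2" by auto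
  ultimately show ?thesis
    by (simp add: Let_def algebra_simps del: minus_diff_eq)
qed auto

text \<open>This instance of associativity is available at once: the line through P, Q and -(P + Q),
  read in another order, gives -(P + Q) + Q = -P.\<close>

lemma add_neg_cancel:
  assumes "P \<in> curve" "Q \<in> curve"
  shows "(P \<oplus> Q) \<oplus> ell_neg Q = P"
proof (cases "P = Infinity \<or> Q = Infinity \<or> P = ell_neg Q")
  case True
  thus ?thesis by auto
next
  case False
  then obtain l m where "collinear l m P Q (ell_neg (P \<oplus> Q))" using add_collinear assms by blast
  hence "collinear l m (ell_neg (P \<oplus> Q)) Q P" by (rule collinear_perm)
  hence "ell_neg (P \<oplus> Q) \<oplus> Q = ell_neg P" by (rule collinear_add)
  hence "ell_neg (ell_neg (P \<oplus> Q) \<oplus> Q) = P" by simp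
  thus ?thesis by (simp add: neg_add)
qed

lemma add_neg_cancel_left:
  assumes "P \<in> curve" "Q \<in> curve"
  shows "ell_neg Q \<oplus> (Q \<oplus> P) = P"
  using add_neg_cancel[OF assms] add_commute[of "P \<oplus> Q" "ell_neg Q"] add_commute[of P Q] assms by simp

lemma add_neg_cancel_left':
  assumes "P \<in> curve" "Q \<in> curve"
  shows "Q \<oplus> (ell_neg Q \<oplus> P) = P"
  using add_neg_cancel_left[of P "ell_neg Q"] assms by simp

lemma add_left_cancel:
  assumes "P \<in> curve" "Q \<in> curve" "R \<in> curve"
  shows "P \<oplus> Q = P \<oplus> R \<longleftrightarrow> Q = R"
  using add_neg_cancel_left assms by metis

lemma add_right_cancel:
  assumes "P \<in> curve" "Q \<in> curve" "R \<in> curve"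
  shows "Q \<oplus> P = R \<oplus> P \<longleftrightarrow> Q = R"
  using add_left_cancel assms add_commute by metis

lemma add_eq_iff:
  assumes "P \<in> curve" "Q \<in> curve" "R \<in> curve"
  shows "P \<oplus> Q = R \<longleftrightarrow> Q = R \<oplus> ell_neg P"
  using add_neg_cancel add_commute assms by (metis add_neg_cancel_left ell_neg_in_curve)

text \<open>
  The two lines through \<open>P\<close>, \<open>Q\<close>, \<open>-(P + Q)\<close> and through \<open>P + Q\<close>, \<open>R\<close>, \<open>S\<close> form a conic.
  On the curve its equation is divisible by \<open>x - x\<^sub>P\<^sub>+\<^sub>Q\<close>, and the quotient is the equation
  \<open>s y = x\<^sup>2 + \<beta> x + \<gamma>\<close> of a parabola through \<open>P\<close>, \<open>Q\<close>, \<open>R\<close>, \<open>S\<close>.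
\<close>

lemma parabola:
  assumes col1: "collinear l1 m1 (Affine x1 y1) (Affine x2 y2) (Affine x0 (- y0))"
    and col2: "collinear l2 m2 (Affine x0 y0) (Affine x3 y3) (Affine x4 y4)"
  obtains s \<beta> \<gamma> where "\<And>x y. (x, y) \<in> {(x1, y1), (x2, y2), (x3, y3), (x4, y4)} \<Longrightarrow> s * y = x\<^sup>2 + \<beta> * x + \<gamma>"
    "x1 + x2 + x3 + x4 = s\<^sup>2 - 2 * \<beta>"
proof -
  \<comment> \<open>Multiplying the two line equations, replacing y^2 by the cubic and dividing by
    \<open>x - x0\<close> produces these coefficients.\<close>
  define s where "s = l1 + l2"
  define \<beta> where "\<beta> = l1 * l2 + x0"
  define \<gamma> where "\<gamma> = a + l1 * m2 + l2 * m1 + x0 * \<beta>"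
  have y: "y1 = l1 * x1 + m1" "y2 = l1 * x2 + m1" "- y0 = l1 * x0 + m1"
      "y0 = l2 * x0 + m2" "y3 = l2 * x3 + m2" "y4 = l2 * x4 + m2"
    and r1: "cubic_roots l1 m1 x1 x2 x0" and r2: "cubic_roots l2 m2 x0 x3 x4"
    using col1 col2 by (auto simp: collinear_def)
  have m: "m1 + m2 = - s * x0" using y(3,4) unfolding s_def by algebra
  have c0: "y0\<^sup>2 = x0 ^ 3 + a * x0 + b"
    using cubic_roots_eq[OF r2, of x0] y(4) by simp
  have "(y0 - 0) * (- y0) = (l2 * x0 + m2) * (l1 * x0 + m1)" using y(3,4) by simp
  hence bm: "b + m1 * m2 = - (x0 * \<gamma>)" using c0 unfolding \<beta>_def \<gamma>_def by algebra
  have key: "(x - x0) * (x\<^sup>2 + \<beta> * x + \<gamma> - s * y) = 0"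
    if c: "y\<^sup>2 = x ^ 3 + a * x + b" and l: "(y - (l1 * x + m1)) * (y - (l2 * x + m2)) = 0" for x y
  proof -
    have "(x - x0) * (x\<^sup>2 + \<beta> * x + \<gamma> - s * y) =
        x ^ 3 + (\<beta> - x0) * x\<^sup>2 + (\<gamma> - x0 * \<beta>) * x - x0 * \<gamma> - y * (s * x - s * x0)"
      by algebra
    also have "\<dots> = (x ^ 3 + a * x + b) + l1 * l2 * x\<^sup>2 + (l1 * m2 + l2 * m1) * x + m1 * m2 - y * (s * x + (m1 + m2))"
      using bm unfolding m \<beta>_def \<gamma>_def by algebra
    also have "\<dots> = y\<^sup>2 + l1 * l2 * x\<^sup>2 + (l1 * m2 + l2 * m1) * x + m1 * m2 - y * (s * x + (m1 + m2))"
      unfolding c ..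
    also have "\<dots> = (y - (l1 * x + m1)) * (y - (l2 * x + m2))"
      unfolding s_def by algebra
    finally show ?thesis using l by simp
  qed
  have "s * y' = x\<^sup>2 + \<beta> * x + \<gamma>" if "(x, y') \<in> {(x1, y1), (x2, y2), (x3, y3), (x4, y4)}" for x y'
  proof -
    have curve: "y'\<^sup>2 = x ^ 3 + a * x + b"
      using that collinear_in_curve[OF col1] collinear_in_curve[OF col2] by auto
    show ?thesis
    proof (cases "x = x0")
      case False
      have "(y' - (l1 * x + m1)) * (y' - (l2 * x + m2)) = 0" using that y by auto
      thus ?thesis using key[OF curve] False by simp
    next
      \<comment> \<open>Here the division by \<open>x - x0\<close> loses the information. But then
        \<open>x0\<close> is a double root on one of the two lines, and the slope condition of this
        tangent replaces the lost equation.\<close>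
      case True
      have q: "x0\<^sup>2 + \<beta> * x0 + \<gamma> = 3 * x0\<^sup>2 + a + l1 * y0 - l2 * y0"
        using y(3,4) unfolding \<beta>_def \<gamma>_def by algebra
      consider "y' = - y0" "3 * x0\<^sup>2 + a = - 2 * l1 * y0" | "y' = y0" "3 * x0\<^sup>2 + a = 2 * l2 * y0"
      proof -
        have d1: "3 * x0\<^sup>2 + a = - 2 * l1 * y0" if "x1 = x0 \<or> x2 = x0"
        proof -
          have "(x0 - x1) * (x0 - x2) = 0" using that by auto
          hence "3 * x0\<^sup>2 + a = 2 * l1 * (l1 * x0 + m1)" using r1 unfolding cubic_roots_def by algebra
          also have "\<dots> = - 2 * l1 * y0" unfolding y(3)[symmetric] by simp
          finally show ?thesis .
        qed
        have d2: "3 * x0\<^sup>2 + a = 2 * l2 * y0" if "x3 = x0 \<or> x4 = x0"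
        proof -
          have "(x0 - x3) * (x0 - x4) = 0" using that by auto
          thus ?thesis using r2 y(4) unfolding cubic_roots_def by algebra
        qed
        show ?thesis using that d1 d2 \<open>(x, y') \<in> _\<close> True y by auto
      qed
      thus ?thesis
      proof cases
        case 1
        thus ?thesis using q True unfolding s_def by algebra
      next
        case 2
        show ?thesis unfolding s_def True 2(1) q 2(2) by algebra
      qed
    qed
  qed
  moreover have "x1 + x2 + x3 + x4 = s\<^sup>2 - 2 * \<beta>"
    using r1 r2 unfolding cubic_roots_def s_def \<beta>_def by algebra
  ultimately show ?thesis using that by blast
qed

text \<open>Three points not on a line determine the parabola. Its intersections with the curve are
  roots of a quartic with root sum s^2 - 2 \<beta>, which gives the fourth abscissa; the ordinate
  follows since \<open>s\<close> is not 0.\<close>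

lemma parabola_unique:
  fixes s s' \<beta> \<beta>' \<gamma> \<gamma>' x1 x2 x3 x4 x4' y1 y2 y3 y4 y4' :: complex
  assumes "\<And>x y. (x, y) \<in> {(x1, y1), (x2, y2), (x3, y3), (x4, y4)} \<Longrightarrow> s * y = x\<^sup>2 + \<beta> * x + \<gamma>"
    and "\<And>x y. (x, y) \<in> {(x1, y1), (x2, y2), (x3, y3), (x4', y4')} \<Longrightarrow> s' * y = x\<^sup>2 + \<beta>' * x + \<gamma>'"
    and "x1 + x2 + x3 + x4 = s\<^sup>2 - 2 * \<beta>" "x1 + x2 + x3 + x4' = s'\<^sup>2 - 2 * \<beta>'"
    and ne: "x1 \<noteq> x2" "x1 \<noteq> x3" "x2 \<noteq> x3"
    and nl: "\<And>l m. \<not> (y1 = l * x1 + m \<and> y2 = l * x2 + m \<and> y3 = l * x3 + m)"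
  shows "x4 = x4' \<and> y4 = y4'"
proof -
  have e: "s * y1 = x1\<^sup>2 + \<beta> * x1 + \<gamma>" "s * y2 = x2\<^sup>2 + \<beta> * x2 + \<gamma>" "s * y3 = x3\<^sup>2 + \<beta> * x3 + \<gamma>" "s * y4 = x4\<^sup>2 + \<beta> * x4 + \<gamma>"
    using assms(1) by auto
  have e': "s' * y1 = x1\<^sup>2 + \<beta>' * x1 + \<gamma>'" "s' * y2 = x2\<^sup>2 + \<beta>' * x2 + \<gamma>'" "s' * y3 = x3\<^sup>2 + \<beta>' * x3 + \<gamma>'" "s' * y4' = x4'\<^sup>2 + \<beta>' * x4' + \<gamma>'"
    using assms(2) by auto
  have s: "s = s'"
  proof (rule ccontr)
    assume "s \<noteq> s'"
    define l where "l = (\<beta> - \<beta>') / (s - s')"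
    define m where "m = (\<gamma> - \<gamma>') / (s - s')"
    have "y = l * x + m" if "s * y = x\<^sup>2 + \<beta> * x + \<gamma>" "s' * y = x\<^sup>2 + \<beta>' * x + \<gamma>'" for x y
    proof -
      have "(s - s') * y = (\<beta> - \<beta>') * x + (\<gamma> - \<gamma>')" using that by algebra
      also have "\<dots> = (s - s') * (l * x + m)"
        using \<open>s \<noteq> s'\<close> by (simp add: l_def m_def distrib_left)
      finally show ?thesis using \<open>s \<noteq> s'\<close> by simp
    qed
    thus False using nl e e' by blast
  qed
  have "(\<beta> - \<beta>') * (x1 - x2) = 0" using e(1,2) e'(1,2) s by algebra
  hence \<beta>: "\<beta> = \<beta>'" using ne by simp
  have \<gamma>: "\<gamma> = \<gamma>'" using e(1) e'(1) s \<beta> by simp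
  have "x1 + x2 + x3 + x4 = x1 + x2 + x3 + x4'" unfolding assms(3,4) s \<beta> ..
  hence x4: "x4 = x4'" by simp
  \<comment> \<open>With s = 0 a monic quadratic would vanish at three distinct abscissas.\<close>
  have "s \<noteq> 0"
  proof
    assume "s = 0"
    hence "(x1 - x2) * (x1 + x2 + \<beta>) = 0" "(x1 - x3) * (x1 + x3 + \<beta>) = 0"
      using e by algebra+
    hence "x1 + x2 + \<beta> = x1 + x3 + \<beta>" using ne by simp
    thus False using ne by simp
  qed
  moreover have "s * y4 = s * y4'" using e(4) e'(4) s \<beta> \<gamma> x4 by simp
  ultimately show ?thesis using x4 by simp
qed

text \<open>In either bracketing, the negative of the sum is the fourth point in which the parabola
  through \<open>A\<close>, \<open>B\<close> and \<open>X\<close> meets the curve.\<close>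

lemma add_assoc_generic:
  assumes A: "A \<in> curve" "A = Affine x1 y1" and B: "B \<in> curve" "B = Affine x2 y2"
    and X: "X \<in> curve" "X = Affine x3 y3"
    and ne: "x1 \<noteq> x2" "x1 \<noteq> x3" "x2 \<noteq> x3"
    and S: "A \<oplus> B = Affine xs ys" "xs \<noteq> x3"
    and T: "B \<oplus> X \<noteq> ell_neg A"
  shows "A \<oplus> (B \<oplus> X) = (A \<oplus> B) \<oplus> X"
proof -
  have "B \<oplus> X \<noteq> Infinity"
  proof
    assume "B \<oplus> X = Infinity"
    hence "B = ell_neg X" using add_neg_cancel[OF B(1) X(1)] by simp
    thus False using B(2) X(2) ne(3) by simp
  qed
  then obtain xt yt where T': "B \<oplus> X = Affine xt yt" by (cases "B \<oplus> X") auto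
  have SC: "Affine xs ys \<in> curve" "Affine xt yt \<in> curve"
    using add_closed[OF A(1) B(1)] add_closed[OF B(1) X(1)] unfolding S(1) T' by blast+
  have "Affine xs ys \<oplus> X \<noteq> Infinity"
  proof
    assume "Affine xs ys \<oplus> X = Infinity"
    hence "Affine xs ys = ell_neg X" using add_neg_cancel[OF SC(1) X(1)] by simp
    thus False using X(2) S(2) by simp
  qed
  then obtain x4 y4 where D: "(A \<oplus> B) \<oplus> X = Affine x4 y4"
    unfolding S(1) by (cases "Affine xs ys \<oplus> X") auto
  have "A \<oplus> (B \<oplus> X) \<noteq> Infinity"
  proof
    assume "A \<oplus> (B \<oplus> X) = Infinity"
    hence "A = ell_neg (B \<oplus> X)" using add_neg_cancel[OF A(1), of "B \<oplus> X"] B(1) X(1) by simp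
    thus False using T by simp
  qed
  then obtain x4' y4' where D': "A \<oplus> (B \<oplus> X) = Affine x4' y4'" by (cases "A \<oplus> (B \<oplus> X)") auto
  obtain l1 m1 where c1: "collinear l1 m1 (Affine x1 y1) (Affine x2 y2) (Affine xs (- ys))"
    using add_collinear[OF A(1) B(1)] ne(1) unfolding S(1) unfolding A(2) B(2) by auto
  obtain l2 m2 where c2: "collinear l2 m2 (Affine xs ys) (Affine x3 y3) (Affine x4 (- y4))"
    using add_collinear[OF SC(1) X(1)] S(2) D unfolding S(1) unfolding X(2) by auto
  obtain l3 m3 where c3: "collinear l3 m3 (Affine x2 y2) (Affine x3 y3) (Affine xt (- yt))"
    using add_collinear[OF B(1) X(1)] ne(3) unfolding T' unfolding X(2) B(2) by auto
  have D'': "Affine xt yt \<oplus> A = Affine x4' y4'"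
    using D' unfolding T' add_commute[OF SC(2) A(1)] .
  obtain l4 m4 where c4: "collinear l4 m4 (Affine xt yt) (Affine x1 y1) (Affine x4' (- y4'))"
    using add_collinear[OF SC(2) A(1)] T unfolding D'' T' unfolding A(2) by auto
  obtain s \<beta> \<gamma> where p: "\<And>x y. (x, y) \<in> {(x1, y1), (x2, y2), (x3, y3), (x4, - y4)} \<Longrightarrow> s * y = x\<^sup>2 + \<beta> * x + \<gamma>"
    "x1 + x2 + x3 + x4 = s\<^sup>2 - 2 * \<beta>"
    using parabola[OF c1 c2] by blast
  obtain s' \<beta>' \<gamma>' where "\<And>x y. (x, y) \<in> {(x2, y2), (x3, y3), (x1, y1), (x4', - y4')} \<Longrightarrow> s' * y = x\<^sup>2 + \<beta>' * x + \<gamma>'"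
    "x2 + x3 + x1 + x4' = s'\<^sup>2 - 2 * \<beta>'"
    using parabola[OF c3 c4] by blast
  hence p': "\<And>x y. (x, y) \<in> {(x1, y1), (x2, y2), (x3, y3), (x4', - y4')} \<Longrightarrow> s' * y = x\<^sup>2 + \<beta>' * x + \<gamma>'"
    "x1 + x2 + x3 + x4' = s'\<^sup>2 - 2 * \<beta>'"
    by (auto simp: add_ac)
  have "x4 = x4' \<and> - y4 = - y4'"
  proof (rule parabola_unique[OF p(1) p'(1) p(2) p'(2) ne])
    fix l m
    show "\<not> (y1 = l * x1 + m \<and> y2 = l * x2 + m \<and> y3 = l * x3 + m)"
    proof
      \<comment> \<open>The line would be the one through \<open>A\<close> and \<open>B\<close>, and
        \<open>X\<close> would be one of its three intersections with the curve, which the abscissas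
        exclude.\<close>
      assume l: "y1 = l * x1 + m \<and> y2 = l * x2 + m \<and> y3 = l * x3 + m"
      have y: "y1 = l1 * x1 + m1" "y2 = l1 * x2 + m1" and r: "cubic_roots l1 m1 x1 x2 xs"
        using c1 by (auto simp: collinear_def)
      have "(l - l1) * (x1 - x2) = 0" using l y by algebra
      hence "l = l1" using ne by simp
      hence "y3 = l1 * x3 + m1" using l y by simp
      moreover have "y3\<^sup>2 = x3 ^ 3 + a * x3 + b" using X by simp
      ultimately have "(x3 - x1) * (x3 - x2) * (x3 - xs) = 0"
        using cubic_roots_eq[OF r, of x3] by simp
      thus False using ne S(2) by auto
    qed
  qed
  thus ?thesis using D D' by simp
qed

end

section \<open>Translations outside finite sets, and associativity\<close>

lemma finite_square_roots: "finite {y :: complex. y\<^sup>2 = c}"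
proof -
  have "finite {y. poly [:- c, 0, 1:] y = 0}" by (rule poly_roots_finite) simp
  moreover have "{y. y\<^sup>2 = c} = {y. poly [:- c, 0, 1:] y = 0}" by (auto simp: power2_eq_square)
  ultimately show ?thesis by (simp only:)
qed

context weierstrass
begin

lemma finite_curve_x: "finite R \<Longrightarrow> finite {P \<in> curve. \<exists>x\<in>R. \<exists>y. P = Affine x y}"
  by (rule finite_subset[of _ "\<Union>x\<in>R. Affine x ` {y. y\<^sup>2 = x ^ 3 + a * x + b}"])
    (auto simp: finite_square_roots)

lemma infinite_curve: "infinite curve"
proof
  assume "finite curve"
  moreover have "(\<lambda>x. Affine x (csqrt (x ^ 3 + a * x + b))) ` UNIV \<subseteq> curve" by auto
  ultimately have "finite ((\<lambda>x. Affine x (csqrt (x ^ 3 + a * x + b))) ` UNIV)"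
    by (rule finite_subset[rotated])
  hence "finite (UNIV :: complex set)" by (rule finite_imageD) (auto simp: inj_on_def)
  thus False using infinite_UNIV_char_0 by blast
qed

lemma finite_halves: "finite {P \<in> curve. P \<oplus> P = Q}"
proof -
  have 0: "finite {x. x ^ 3 + a * x + b = 0}"
    using poly_roots_finite[of "[:b, a, 0, 1:]"] by (simp add: power3_eq_cube algebra_simps)
  show ?thesis
  proof (cases Q)
    case Infinity
    have "{P \<in> curve. P \<oplus> P = Q} \<subseteq> insert Infinity {P \<in> curve. \<exists>x\<in>{x. x ^ 3 + a * x + b = 0}. \<exists>y. P = Affine x y}"
    proof
      fix P assume "P \<in> {P \<in> curve. P \<oplus> P = Q}"
      hence P: "P \<in> curve" "P \<oplus> P = Infinity" using Infinity by auto
      hence "P = ell_neg P" using add_neg_cancel[of P P] by simp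
      thus "P \<in> insert Infinity {P \<in> curve. \<exists>x\<in>{x. x ^ 3 + a * x + b = 0}. \<exists>y. P = Affine x y}"
        using P(1) by (cases P) (auto dest: complex_eq_neg_imp_0)
    qed
    thus ?thesis by (rule finite_subset) (simp only: finite_insert finite_curve_x[OF 0])
  next
    case (Affine u v)
    \<comment> \<open>The duplication formula for the abscissa \<open>u\<close> of P + P, cleared of
      its denominator 4 y^2.\<close>
    let ?p = "[:a\<^sup>2 - 4 * b * u, - (4 * a * u + 8 * b), - 2 * a, - 4 * u, 1:]"
    have "{P \<in> curve. P \<oplus> P = Q} \<subseteq> {P \<in> curve. \<exists>x\<in>{x. poly ?p x = 0}. \<exists>y. P = Affine x y}"
    proof
      fix P assume "P \<in> {P \<in> curve. P \<oplus> P = Q}"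
      hence P: "P \<in> curve" "P \<oplus> P = Affine u v" using Affine by auto
      obtain x y where xy: "P = Affine x y" using P(2) by (cases P) auto
      have y: "y \<noteq> - y" using P(2) xy by auto
      have c: "y\<^sup>2 = x ^ 3 + a * x + b" using P(1) xy by simp
      define l where "l = (3 * x\<^sup>2 + a) / (2 * y)"
      have u: "u = l\<^sup>2 - x - x" using P(2) y unfolding xy l_def by (simp add: Let_def)
      have "y \<noteq> 0" using y by auto
      hence l: "l * (2 * y) = 3 * x\<^sup>2 + a" by (simp add: l_def)
      have "poly ?p x = a\<^sup>2 - 4 * b * u - (4 * a * u + 8 * b) * x - 2 * a * x\<^sup>2 - 4 * u * x ^ 3 + x ^ 4"
        by (simp add: power2_eq_square power3_eq_cube power4_eq_xxxx algebra_simps)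
      also have "\<dots> = 0" using u l c by algebra
      finally show "P \<in> {P \<in> curve. \<exists>x\<in>{x. poly ?p x = 0}. \<exists>y. P = Affine x y}"
        using P(1) xy by auto
    qed
    moreover have "finite {x. poly ?p x = 0}" by (rule poly_roots_finite) simp
    ultimately show ?thesis using finite_curve_x finite_subset by blast
  qed
qed

definition almost_all :: "(complex point \<Rightarrow> bool) \<Rightarrow> bool" where
  "almost_all P \<longleftrightarrow> finite {X \<in> curve. \<not> P X}"

lemma almost_all_mono:
  assumes "almost_all P" "\<And>X. X \<in> curve \<Longrightarrow> P X \<Longrightarrow> Q X"
  shows "almost_all Q"
  using assms(1) unfolding almost_all_def by (rule rev_finite_subset) (use assms(2) in auto)

lemma almost_all_conj:
  assumes "almost_all P" "almost_all Q"
  shows "almost_all (\<lambda>X. P X \<and> Q X)"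
proof -
  have "finite ({X \<in> curve. \<not> P X} \<union> {X \<in> curve. \<not> Q X})"
    using assms by (simp add: almost_all_def)
  thus ?thesis unfolding almost_all_def by (rule rev_finite_subset) auto
qed

lemma almost_all_ex:
  assumes "almost_all P"
  obtains X where "X \<in> curve" "P X"
proof -
  have "{X \<in> curve. \<not> P X} \<noteq> curve" using assms infinite_curve unfolding almost_all_def by metis
  thus ?thesis using that by blast
qed

lemma almost_all_shift:
  assumes "almost_all P" "B \<in> curve"
  shows "almost_all (\<lambda>X. P (B \<oplus> X))"
proof -
  have "{X \<in> curve. \<not> P (B \<oplus> X)} \<subseteq> (\<lambda>Y. ell_neg B \<oplus> Y) ` {Y \<in> curve. \<not> P Y}"
  proof
    fix X assume X: "X \<in> {X \<in> curve. \<not> P (B \<oplus> X)}"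
    hence "X = ell_neg B \<oplus> (B \<oplus> X)" using add_neg_cancel_left[of X B] assms(2) by simp
    thus "X \<in> (\<lambda>Y. ell_neg B \<oplus> Y) ` {Y \<in> curve. \<not> P Y}"
      by (rule image_eqI) (use X assms(2) in simp)
  qed
  thus ?thesis
    using assms(1) unfolding almost_all_def by (rule finite_subset[OF _ finite_imageI])
qed

lemma almost_all_neq: "almost_all (\<lambda>X. X \<noteq> Q)"
  unfolding almost_all_def by (rule finite_subset[of _ "{Q}"]) auto

lemma almost_all_True: "(\<And>X. X \<in> curve \<Longrightarrow> P X) \<Longrightarrow> almost_all P"
  unfolding almost_all_def by (rule finite_subset[of _ "{}"]) auto

definition composes :: "complex point \<Rightarrow> complex point \<Rightarrow> complex point \<Rightarrow> bool" where
  "composes P Q S \<longleftrightarrow> almost_all (\<lambda>X. P \<oplus> (Q \<oplus> X) = S \<oplus> X)"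

lemma x_neq:
  assumes "Affine x1 y1 \<in> curve" "Affine x2 y2 \<in> curve" "Affine x1 y1 \<noteq> Affine x2 y2" "Affine x1 y1 \<noteq> ell_neg (Affine x2 y2)"
  shows "x1 \<noteq> x2"
proof
  assume x: "x1 = x2"
  hence "y1\<^sup>2 = y2\<^sup>2" using assms(1,2) by simp
  thus False using x assms(3,4) by (auto simp: power2_eq_iff)
qed

text \<open>For fixed distinct \<open>P\<close> and \<open>Q\<close>, the hypotheses of
  \<open>add_assoc_generic\<close> exclude only finitely many points \<open>X\<close>.\<close>

lemma composes_neq:
  assumes PQ: "P \<in> curve" "Q \<in> curve" "P \<noteq> Q"
  shows "composes P Q (P \<oplus> Q)"
proof (cases "P = Infinity \<or> Q = Infinity \<or> P = ell_neg Q")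
  case True
  thus ?thesis
    unfolding composes_def using PQ add_neg_cancel_left by (intro almost_all_True) auto
next
  case False
  then obtain x1 y1 x2 y2 where P: "P = Affine x1 y1" and Q: "Q = Affine x2 y2"
    by (cases P; cases Q) auto
  have x: "x1 \<noteq> x2" using x_neq[of x1 y1 x2 y2] False PQ unfolding P Q by blast
  have "P \<oplus> Q \<noteq> Infinity"
    using add_neg_cancel[of P Q] PQ False by auto
  then obtain xs ys where S: "P \<oplus> Q = Affine xs ys" by (cases "P \<oplus> Q") auto
  have "almost_all (\<lambda>X. X \<noteq> Infinity)" by (rule almost_all_neq)
  moreover have "almost_all (\<lambda>X. \<forall>x\<in>{x1, x2, xs}. \<forall>y. X \<noteq> Affine x y)"
    using finite_curve_x[of "{x1, x2, xs}"] unfolding almost_all_def by simp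
  moreover have "almost_all (\<lambda>X. Q \<oplus> X \<noteq> ell_neg P)"
    by (rule almost_all_shift[OF almost_all_neq PQ(2)])
  ultimately have "almost_all (\<lambda>X. X \<noteq> Infinity \<and> (\<forall>x\<in>{x1, x2, xs}. \<forall>y. X \<noteq> Affine x y) \<and> Q \<oplus> X \<noteq> ell_neg P)"
    by (intro almost_all_conj)
  thus ?thesis
    unfolding composes_def
  proof (rule almost_all_mono)
    fix X assume X: "X \<in> curve"
      "X \<noteq> Infinity \<and> (\<forall>x\<in>{x1, x2, xs}. \<forall>y. X \<noteq> Affine x y) \<and> Q \<oplus> X \<noteq> ell_neg P"
    then obtain x3 y3 where X': "X = Affine x3 y3" by (cases X) auto
    show "P \<oplus> (Q \<oplus> X) = P \<oplus> Q \<oplus> X"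
      by (rule add_assoc_generic[OF PQ(1) P PQ(2) Q X(1) X' x _ _ S]) (use X(2) X' in auto)
  qed
qed

text \<open>Translations compose associatively as maps, whatever is known about
  \<open>\<oplus>\<close>.\<close>

lemma composes_trans:
  assumes c: "P \<in> curve" "Q \<in> curve" "R \<in> curve"
    and 1: "composes P Q S" and 2: "composes Q R U" and 3: "composes S R V"
  shows "composes P U V"
proof -
  have "almost_all (\<lambda>X. P \<oplus> (Q \<oplus> (R \<oplus> X)) = S \<oplus> (R \<oplus> X))"
    using almost_all_shift[OF 1[unfolded composes_def] c(3)] .
  from almost_all_conj[OF this almost_all_conj[OF 2[unfolded composes_def] 3[unfolded composes_def]]]
  show ?thesis unfolding composes_def by (rule almost_all_mono) metis
qed

lemma composes_trans':
  assumes c: "P \<in> curve" "Q \<in> curve" "R \<in> curve"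
    and 1: "composes P Q S" and 2: "composes Q R U" and 3: "composes P U V"
  shows "composes S R V"
proof -
  have "almost_all (\<lambda>X. P \<oplus> (Q \<oplus> (R \<oplus> X)) = S \<oplus> (R \<oplus> X))"
    using almost_all_shift[OF 1[unfolded composes_def] c(3)] .
  from almost_all_conj[OF this almost_all_conj[OF 2[unfolded composes_def] 3[unfolded composes_def]]]
  show ?thesis unfolding composes_def by (rule almost_all_mono) metis
qed

text \<open>By cancellation a single value determines a translation, and two cofinite conditions on
  an infinite curve have a common point. This removes the exceptions.\<close>

lemma composes_unique:
  assumes "composes P Q S" "composes P Q S'" "S \<in> curve" "S' \<in> curve"
  shows "S = S'"
proof -
  obtain X where "X \<in> curve" "S \<oplus> X = S' \<oplus> X"
    using almost_all_ex[OF almost_all_conj[OF assms(1,2)[unfolded composes_def]]] by metis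
  thus ?thesis using add_right_cancel assms by blast
qed

text \<open>
  A tangent is treated without a further computation: for a suitable \<open>Z\<close> the translation
  by \<open>P\<close> is the composition of those by \<open>-Z\<close> and \<open>P + Z\<close>, so the square of the translation by \<open>P\<close>
  is the translation by some \<open>D\<close>, and \<open>D \<noteq> -P\<close> implies \<open>P + (-D) = -P\<close> by the chord case.
\<close>

lemma composes_square_ex:
  assumes P: "P \<in> curve"
  obtains D where "D \<in> curve" "composes P P D"
proof -
  have fin: "almost_all (\<lambda>X. X \<oplus> X \<noteq> Q)" for Q
    using finite_halves[of Q] by (simp add: almost_all_def)
  \<comment> \<open>The three inequalities make the pairs (P + Z, P), (-Z, W) and (-Z, P + Z)
    consist of distinct points, so that \<open>composes_neq\<close> applies to each.\<close>
  have "almost_all (\<lambda>Z. P \<oplus> Z \<noteq> P \<and> (P \<oplus> Z) \<oplus> (P \<oplus> Z) \<noteq> Infinity \<and> Z \<oplus> Z \<noteq> ell_neg P)"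
    by (intro almost_all_conj almost_all_shift[OF almost_all_neq P] almost_all_shift[OF fin P] fin)
  then obtain Z where "Z \<in> curve"
    "P \<oplus> Z \<noteq> P \<and> (P \<oplus> Z) \<oplus> (P \<oplus> Z) \<noteq> Infinity \<and> Z \<oplus> Z \<noteq> ell_neg P"
    by (rule almost_all_ex)
  hence Z: "Z \<in> curve" "P \<oplus> Z \<noteq> P" "(P \<oplus> Z) \<oplus> (P \<oplus> Z) \<noteq> Infinity" "Z \<oplus> Z \<noteq> ell_neg P"
    by simp_all
  define W where "W = (P \<oplus> Z) \<oplus> P"
  have c: "P \<oplus> Z \<in> curve" "ell_neg Z \<in> curve" "W \<in> curve" using P Z by (simp_all add: W_def)
  have sum: "ell_neg Z \<oplus> (P \<oplus> Z) = P"
    using add_neg_cancel_left[OF P Z(1)] add_commute[OF P Z(1)] by simp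
  have "ell_neg Z \<noteq> P \<oplus> Z"
  proof
    assume "ell_neg Z = P \<oplus> Z"
    hence "ell_neg Z \<oplus> ell_neg Z = P" using sum by simp
    thus False using Z(4) neg_add[of Z Z] by (metis ell_neg_neg)
  qed
  hence 1: "composes (ell_neg Z) (P \<oplus> Z) P"
    using composes_neq[OF c(2,1)] sum by simp
  have 2: "composes (P \<oplus> Z) P W"
    unfolding W_def using composes_neq[OF c(1) P] Z(2) by simp
  have "ell_neg Z \<noteq> W"
  proof
    assume "ell_neg Z = W"
    hence "P \<oplus> Z = ell_neg Z \<oplus> ell_neg P"
      using add_neg_cancel[OF c(1) P] by (simp add: W_def)
    hence "P \<oplus> Z = ell_neg (P \<oplus> Z)" using add_commute[OF P Z(1)] by (simp add: neg_add)
    thus False using Z(3) by (metis add_neg_right)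
  qed
  hence 3: "composes (ell_neg Z) W (ell_neg Z \<oplus> W)" using composes_neq c by simp
  show ?thesis
    by (rule that[OF _ composes_trans'[OF c(2,1) P 1 2 3]]) (use c in simp)
qed

lemma composes_double:
  assumes P: "P \<in> curve"
  shows "composes P P (P \<oplus> P)"
proof -
  obtain D where D: "D \<in> curve" "composes P P D" using composes_square_ex[OF P] .
  define E where "E = P \<oplus> P"
  have E: "E \<in> curve" using P by (simp add: E_def)
  show ?thesis
  proof (cases "D = ell_neg P")
    case False
    have PD: "P \<noteq> ell_neg D" using False by auto
    hence "composes P (ell_neg D) (P \<oplus> ell_neg D)" using composes_neq P D by simp
    moreover have "composes P (ell_neg D) (ell_neg P)"
      unfolding composes_def
    proof (rule almost_all_mono)
      show "almost_all (\<lambda>X. P \<oplus> (P \<oplus> (ell_neg D \<oplus> X)) = D \<oplus> (ell_neg D \<oplus> X))"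
        by (rule almost_all_shift[OF D(2)[unfolded composes_def]]) (simp add: D)
      fix X assume X: "X \<in> curve" "P \<oplus> (P \<oplus> (ell_neg D \<oplus> X)) = D \<oplus> (ell_neg D \<oplus> X)"
      hence "P \<oplus> (P \<oplus> (ell_neg D \<oplus> X)) = X" using add_neg_cancel_left'[OF X(1) D(1)] by simp
      thus "P \<oplus> (ell_neg D \<oplus> X) = ell_neg P \<oplus> X"
        using add_neg_cancel_left[of "P \<oplus> (ell_neg D \<oplus> X)" P] P D X(1) by simp
    qed
    ultimately have "P \<oplus> ell_neg D = ell_neg P"
      by (rule composes_unique) (use P D in simp_all)
    hence "ell_neg D = ell_neg P \<oplus> ell_neg P"
      using add_eq_iff[of P "ell_neg D" "ell_neg P"] P D by simp
    hence "D = P \<oplus> P" by (metis ell_neg_neg neg_add)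
    thus ?thesis using D by simp
  next
    \<comment> \<open>The chord case is now applied to P and -(P + P). It fails only for P = -(P +
      P), and then P + P is \<open>D\<close> at once.\<close>
    case True
    show ?thesis
    proof (cases "P = ell_neg E")
      case True
      hence "E = D" using \<open>D = ell_neg P\<close> by simp
      thus ?thesis using D by (simp add: E_def)
    next
      case False
      have "P \<oplus> ell_neg E = ell_neg P"
        unfolding E_def neg_add using add_neg_cancel_left'[of "ell_neg P" P] P by simp
      hence "almost_all (\<lambda>X. P \<oplus> (ell_neg E \<oplus> X) = ell_neg P \<oplus> X)"
        using composes_neq[of P "ell_neg E"] P E False unfolding composes_def by simp
      from almost_all_shift[OF this E]
      have "almost_all (\<lambda>X. P \<oplus> (P \<oplus> X) = E \<oplus> X)"
      proof (rule almost_all_mono)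
        fix X assume X: "X \<in> curve" "P \<oplus> (ell_neg E \<oplus> (E \<oplus> X)) = ell_neg P \<oplus> (E \<oplus> X)"
        hence "P \<oplus> X = ell_neg P \<oplus> (E \<oplus> X)" using add_neg_cancel_left[OF X(1) E] by simp
        thus "P \<oplus> (P \<oplus> X) = E \<oplus> X" using add_neg_cancel_left'[of "E \<oplus> X" P] P E X by simp
      qed
      thus ?thesis by (simp add: composes_def E_def)
    qed
  qed
qed

lemma composes_add: "P \<in> curve \<Longrightarrow> Q \<in> curve \<Longrightarrow> composes P Q (P \<oplus> Q)"
  by (cases "P = Q") (auto intro: composes_neq composes_double)

theorem add_assoc:
  assumes "P \<in> curve" "Q \<in> curve" "R \<in> curve"
  shows "(P \<oplus> Q) \<oplus> R = P \<oplus> (Q \<oplus> R)"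
proof -
  have "composes P (Q \<oplus> R) ((P \<oplus> Q) \<oplus> R)"
    by (rule composes_trans[of P Q R "P \<oplus> Q" "Q \<oplus> R"]) (use assms in \<open>simp_all add: composes_add\<close>)
  moreover have "composes P (Q \<oplus> R) (P \<oplus> (Q \<oplus> R))"
    using assms by (simp add: composes_add)
  ultimately show ?thesis by (rule composes_unique) (use assms in simp_all)
qed

end

subsection \<open>Algebraic numbers\<close>

interpretation QV: vector_space "\<lambda>(q :: rat) (x :: complex). of_rat q * x"
  by unfold_locales (simp_all add: of_rat_add of_rat_mult algebra_simps)

lemma algebraic_powers_in_span:
  fixes x :: complex
  assumes "algebraic x"
  obtains m where "\<And>k. x ^ k \<in> QV.span ((^) x ` {..<m})"
proof -
  obtain p where p: "\<And>i. coeff p i \<in> \<rat>" "p \<noteq> 0" "poly p x = 0"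
    using assms unfolding algebraic_altdef by blast
  define m where "m = degree p"
  define c where "c i = (SOME q. coeff p i = of_rat q)" for i
  have c: "coeff p i = of_rat (c i)" for i
    using p(1)[of i] unfolding c_def by (metis (mono_tags, lifting) Rats_cases someI)
  have "c m \<noteq> 0"
    using p(2) c[of m] by (metis leading_coeff_0_iff m_def of_rat_0)
  have "x ^ m * of_rat (c m) = - (\<Sum>i<m. of_rat (c i) * x ^ i)"
    using p(3) unfolding poly_altdef m_def[symmetric] lessThan_Suc_atMost[symmetric] c
    by (simp add: add_eq_0_iff2 mult.commute)
  hence "x ^ m = (- (\<Sum>i<m. of_rat (c i) * x ^ i)) / of_rat (c m)"
    using \<open>c m \<noteq> 0\<close> by (subst nonzero_eq_divide_eq) simp_all
  hence xm: "x ^ m = (\<Sum>i<m. of_rat (- c i / c m) * x ^ i)"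
    by (simp add: of_rat_divide of_rat_minus sum_divide_distrib sum_negf)
  have "x ^ k \<in> QV.span ((^) x ` {..<m})" for k
  proof (induction k rule: less_induct)
    case (less k)
    show ?case
    proof (cases "k < m")
      case True
      thus ?thesis by (intro QV.span_base) auto
    next
      case False
      have "x ^ k = x ^ (k - m) * x ^ m" using False by (simp flip: power_add)
      also have "\<dots> = (\<Sum>i<m. of_rat (- c i / c m) * x ^ (k - m + i))"
        unfolding xm by (simp add: sum_distrib_left power_add mult_ac)
      also have "\<dots> \<in> QV.span ((^) x ` {..<m})"
        using False by (intro QV.span_sum QV.span_scale less.IH) auto
      finally show ?thesis .
    qed
  qed
  thus ?thesis by (rule that)
qed

text \<open>Infinitely many elements of a finite-dimensional rational space are dependent, and a
  dependence among powers is a polynomial equation. Repeated powers need their own case, as the set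
  of powers does not show them.\<close>

lemma algebraic_if_powers_in_span:
  fixes y :: complex
  assumes T: "finite T" "\<And>k. y ^ k \<in> QV.span T"
  shows "algebraic y"
proof (cases "inj (\<lambda>k. y ^ k)")
  case False
  then obtain i j where ij: "i \<noteq> j" "y ^ i = y ^ j" by (auto simp: inj_def)
  show ?thesis
  proof (rule algebraicI)
    show "monom 1 i - monom 1 j \<noteq> (0 :: complex poly)" using ij(1) by (simp add: monom_eq_iff')
    show "poly (monom 1 i - monom 1 j) y = 0" using ij(2) by (simp add: poly_monom)
  qed (auto simp: coeff_monom)
next
  case True
  let ?S = "range (\<lambda>k. y ^ k)"
  have "QV.dependent ?S"
  proof (rule ccontr)
    assume "\<not> QV.dependent ?S"
    hence "finite ?S" using QV.independent_span_bound[OF T(1), of ?S] T(2) by blast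
    thus False using True finite_imageD infinite_UNIV_nat by blast
  qed
  then obtain t u v0 where t: "finite t" "t \<subseteq> ?S" "(\<Sum>v\<in>t. of_rat (u v) * v) = 0" "v0 \<in> t" "u v0 \<noteq> 0"
    unfolding QV.dependent_explicit by blast
  define k where "k = inv_into UNIV (\<lambda>k. y ^ k)"
  have k: "y ^ k v = v" if "v \<in> t" for v
    unfolding k_def using that t(2) f_inv_into_f[of v "\<lambda>k. y ^ k" UNIV] by blast
  have k_inj: "k v = k w \<longleftrightarrow> v = w" if "v \<in> t" "w \<in> t" for v w
    using k[OF that(1)] k[OF that(2)] by metis
  define p where "p = (\<Sum>v\<in>t. monom (of_rat (u v) :: complex) (k v))"
  have coeff: "coeff p i = (\<Sum>v\<in>t. if k v = i then of_rat (u v) else 0)" for i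
    unfolding p_def by (simp add: coeff_sum)
  show ?thesis
  proof (rule algebraicI')
    show "coeff p i \<in> \<rat>" for i
      unfolding coeff by (intro Rats_sum) auto
    have "coeff p (k v0) = (\<Sum>v\<in>t. if v = v0 then of_rat (u v) else 0)"
      unfolding coeff by (intro sum.cong refl) (use k_inj t(4) in auto)
    also have "\<dots> = of_rat (u v0)" using t by simp
    finally show "p \<noteq> 0" using t(5) by auto
    show "poly p y = 0"
      unfolding p_def poly_sum poly_monom using t(3) k by (simp cong: sum.cong)
  qed
qed

lemma span_mult:
  fixes A B :: "complex set"
  assumes "x \<in> QV.span A" "y \<in> QV.span B"
  shows "x * y \<in> QV.span ((\<lambda>(a, b). a * b) ` (A \<times> B))"
  using assms(1)
proof (induction rule: QV.span_induct_alt)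
  case base
  show ?case using QV.span_zero by simp
next
  case (step c a z)
  have "a * y \<in> QV.span ((\<lambda>(a, b). a * b) ` (A \<times> B))"
    using assms(2)
  proof (induction rule: QV.span_induct_alt)
    case base
    show ?case using QV.span_zero by simp
  next
    case (step d b w)
    have "a * b \<in> QV.span ((\<lambda>(a, b). a * b) ` (A \<times> B))"
      using step(1) \<open>a \<in> A\<close> by (intro QV.span_base) auto
    hence "of_rat d * (a * b) + a * w \<in> QV.span ((\<lambda>(a, b). a * b) ` (A \<times> B))"
      using step(2) by (intro QV.span_add QV.span_scale)
    thus ?case by (simp add: algebra_simps)
  qed
  hence "of_rat c * (a * y) + z * y \<in> QV.span ((\<lambda>(a, b). a * b) ` (A \<times> B))"
    using step(2) by (intro QV.span_add QV.span_scale)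
  thus ?case by (simp add: algebra_simps)
qed

text \<open>All powers of the sum and of the product lie in the span of finitely many monomials in
  \<open>x\<close> and \<open>y\<close>.\<close>

lemma algebraic_polynomial:
  fixes x y :: complex
  assumes "algebraic x" "algebraic y"
  shows "algebraic (x + y)" "algebraic (x * y)"
proof -
  obtain m where m: "\<And>k. x ^ k \<in> QV.span ((^) x ` {..<m})" using algebraic_powers_in_span assms(1) by blast
  obtain n where n: "\<And>k. y ^ k \<in> QV.span ((^) y ` {..<n})" using algebraic_powers_in_span assms(2) by blast
  define T where "T = (\<lambda>(a, b). a * b) ` ((^) x ` {..<m} \<times> (^) y ` {..<n})"
  have fin: "finite T" by (simp add: T_def)
  have T: "x ^ i * y ^ j \<in> QV.span T" for i j
    unfolding T_def by (rule span_mult[OF m n])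
  show "algebraic (x * y)"
    by (rule algebraic_if_powers_in_span[OF fin]) (simp add: power_mult_distrib T)
  show "algebraic (x + y)"
  proof (rule algebraic_if_powers_in_span[OF fin])
    fix k
    have "(\<Sum>i\<le>k. of_rat (of_nat (k choose i)) * (x ^ i * y ^ (k - i))) \<in> QV.span T"
      by (intro QV.span_sum QV.span_scale T)
    thus "(x + y) ^ k \<in> QV.span T" by (simp add: binomial_ring mult.assoc)
  qed
qed

lemma Qbar_add [simp]: "x \<in> Qbar \<Longrightarrow> y \<in> Qbar \<Longrightarrow> x + y \<in> Qbar"
  and Qbar_mult [simp]: "x \<in> Qbar \<Longrightarrow> y \<in> Qbar \<Longrightarrow> x * y \<in> Qbar"
  and Qbar_uminus [simp]: "x \<in> Qbar \<Longrightarrow> - x \<in> Qbar"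
  and Qbar_inverse [simp]: "x \<in> Qbar \<Longrightarrow> inverse x \<in> Qbar"
  and Qbar_csqrt [simp]: "x \<in> Qbar \<Longrightarrow> csqrt x \<in> Qbar"
  and Qbar_of_rat [simp]: "of_rat q \<in> Qbar"
  and Qbar_0 [simp]: "0 \<in> Qbar" and Qbar_1 [simp]: "1 \<in> Qbar" and Qbar_i [simp]: "\<i> \<in> Qbar"
  and Qbar_numeral [simp]: "numeral n \<in> Qbar" and Qbar_of_int [simp]: "of_int k \<in> Qbar"
  by (auto simp: Qbar_def algebraic_polynomial rat_imp_algebraic)

lemma Qbar_diff [simp]: "x \<in> Qbar \<Longrightarrow> y \<in> Qbar \<Longrightarrow> x - y \<in> Qbar"
  using Qbar_add[of x "- y"] by simp

lemma Qbar_divide [simp]: "x \<in> Qbar \<Longrightarrow> y \<in> Qbar \<Longrightarrow> x / y \<in> Qbar"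
  by (simp add: divide_inverse)

lemma Qbar_power [simp]: "x \<in> Qbar \<Longrightarrow> x ^ n \<in> Qbar"
  by (induction n) auto

subsection \<open>Extension of embeddings\<close>

text \<open>Partial ring homomorphisms on subrings of \<open>Qbar\<close>. As graphs, they are
  extended by inclusion, and the union of a chain is again one, as Zorn's lemma requires.\<close>

definition hom_graphs :: "(complex \<times> complex) set set" where
  "hom_graphs = {G. G \<subseteq> Qbar \<times> Qbar \<and> single_valued G \<and> (1, 1) \<in> G \<and>
     (\<forall>x x' y y'. (x, x') \<in> G \<longrightarrow> (y, y') \<in> G \<longrightarrow> (x + y, x' + y') \<in> G \<and> (x * y, x' * y') \<in> G) \<and>
     (\<forall>x x'. (x, x') \<in> G \<longrightarrow> (- x, - x') \<in> G)}"

locale hom_graph =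
  fixes G assumes G: "G \<in> hom_graphs"
begin

lemma in_Qbar: "(x, x') \<in> G \<Longrightarrow> x \<in> Qbar" "(x, x') \<in> G \<Longrightarrow> x' \<in> Qbar"
  and unique: "(x, x') \<in> G \<Longrightarrow> (x, x'') \<in> G \<Longrightarrow> x' = x''"
  and one: "(1, 1) \<in> G"
  and add: "(x, x') \<in> G \<Longrightarrow> (y, y') \<in> G \<Longrightarrow> (x + y, x' + y') \<in> G"
  and mult: "(x, x') \<in> G \<Longrightarrow> (y, y') \<in> G \<Longrightarrow> (x * y, x' * y') \<in> G"
  and uminus: "(x, x') \<in> G \<Longrightarrow> (- x, - x') \<in> G"
  using G by (auto simp: hom_graphs_def single_valued_def)

lemma zero: "(0, 0) \<in> G"
  using add[OF one uminus[OF one]] by simp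

lemma diff: "(x, x') \<in> G \<Longrightarrow> (y, y') \<in> G \<Longrightarrow> (x - y, x' - y') \<in> G"
  using add[OF _ uminus] by fastforce

lemma of_nat: "(of_nat k, of_nat k) \<in> G"
  by (induction k) (auto simp: zero intro: add one)

lemma of_int: "(of_int k, of_int k) \<in> G"
  by (cases k rule: int_cases2) (auto intro: of_nat uminus)

lemma int_poly: "(x, x') \<in> G \<Longrightarrow> (poly (map_poly of_int p) x, poly (map_poly of_int p) x') \<in> G"
  by (induction p) (auto simp: map_poly_pCons zero intro!: add mult of_int)

lemma int_poly_root: "(x, x') \<in> G \<Longrightarrow> poly (map_poly of_int p) x = 0 \<Longrightarrow> poly (map_poly of_int p) x' = 0"
  using int_poly[of x x' p] unique[OF _ zero] by simp

text \<open>The domain is only a ring, so injectivity needs an argument: a nonzero algebraic number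
  is a root of an integer polynomial with nonzero constant term, and so is its image.\<close>

lemma zero_imp_zero:
  assumes "(x, 0) \<in> G"
  shows "x = 0"
proof (rule ccontr)
  assume "x \<noteq> 0"
  moreover have "algebraic x" using in_Qbar(1)[OF assms] by (simp add: Qbar_def)
  ultimately obtain p where p: "coeff p 0 \<noteq> 0" "poly (map_poly of_int p) x = 0"
    using algebraicE'_nonzero by blast
  have "poly (map_poly of_int p) 0 = (0 :: complex)" by (rule int_poly_root[OF assms p(2)])
  thus False using p(1) by (simp add: poly_0_coeff_0 coeff_map_poly)
qed

definition polys :: "(complex poly \<times> complex poly) set" where
  "polys = {(f, f'). \<forall>i. (coeff f i, coeff f' i) \<in> G}"

lemma polys_add: "(f, f') \<in> polys \<Longrightarrow> (g, g') \<in> polys \<Longrightarrow> (f + g, f' + g') \<in> polys"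
  and polys_uminus: "(f, f') \<in> polys \<Longrightarrow> (- f, - f') \<in> polys"
  by (auto simp: polys_def add uminus)

lemma polys_diff: "(f, f') \<in> polys \<Longrightarrow> (g, g') \<in> polys \<Longrightarrow> (f - g, f' - g') \<in> polys"
  by (auto simp: polys_def diff)

lemma sum_in: "finite A \<Longrightarrow> (\<And>i. i \<in> A \<Longrightarrow> (f i, f' i) \<in> G) \<Longrightarrow> (sum f A, sum f' A) \<in> G"
  by (induction A rule: finite_induct) (auto simp: zero add)

lemma polys_mult:
  assumes "(f, f') \<in> polys" "(g, g') \<in> polys"
  shows "(f * g, f' * g') \<in> polys"
  using assms by (auto simp: polys_def coeff_mult intro!: sum_in mult)

lemma polys_monom: "(c, c') \<in> G \<Longrightarrow> (monom c n, monom c' n) \<in> polys"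
  by (auto simp: polys_def coeff_monom zero)

lemma polys_degree:
  assumes "(f, f') \<in> polys"
  shows "degree f' = degree f"
proof -
  have "coeff f i = 0 \<longleftrightarrow> coeff f' i = 0" for i
    using assms zero_imp_zero[of "coeff f i"] unique[OF zero, of "coeff f' i"]
    by (auto simp: polys_def dest: spec[of _ i])
  thus ?thesis by (simp add: degree_def)
qed

text \<open>\<open>p\<close> has least degree among the polynomials over the domain that vanish at
  \<alpha>, and \<beta> is a root of its image. Whatever vanishes at \<alpha> then has an image
  vanishing at \<beta>, so evaluation at the two numbers is a well-defined extension.\<close>

lemma extend:
  assumes "\<alpha> \<in> Qbar"
  obtains \<beta> G' where "G' \<in> hom_graphs" "G \<subseteq> G'" "(\<alpha>, \<beta>) \<in> G'"
proof -
  obtain r where r: "r \<noteq> 0" "poly (map_poly of_int r) \<alpha> = 0"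
    using assms algebraicE' unfolding Qbar_def by blast
  let ?r = "map_poly of_int r :: complex poly"
  have "(?r, ?r) \<in> polys" by (simp add: polys_def coeff_map_poly of_int)
  moreover have "?r \<noteq> 0" using r(1) by (metis map_poly_0 of_int_0 of_int_eq_0_iff coeff_map_poly poly_eqI coeff_0)
  ultimately obtain p p' where p: "(p, p') \<in> polys" "p \<noteq> 0" "poly p \<alpha> = 0"
    and min: "\<And>f f'. (f, f') \<in> polys \<Longrightarrow> f \<noteq> 0 \<Longrightarrow> poly f \<alpha> = 0 \<Longrightarrow> degree p \<le> degree f"
    using exists_least_iff[of "\<lambda>n. \<exists>f f'. (f, f') \<in> polys \<and> f \<noteq> 0 \<and> poly f \<alpha> = 0 \<and> degree f = n"] r(2)
    by (metis not_less)
  have p': "degree p' = degree p" by (rule polys_degree[OF p(1)])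
  have "degree p > 0"
  proof (rule ccontr)
    assume "\<not> degree p > 0"
    then obtain c where "p = [:c:]" using degree_eq_zeroE by blast
    thus False using p by simp
  qed
  hence "degree p' > 0" using p' by simp
  then obtain \<beta> where \<beta>: "poly p' \<beta> = 0" using alg_closed_imp_poly_has_root by blast
  have lp: "lead_coeff p' \<noteq> 0" using \<open>degree p' > 0\<close> by auto
  have root: "poly f' \<beta> = 0" if "(f, f') \<in> polys" "poly f \<alpha> = 0" for f f'
    using that
  proof (induction "degree f" arbitrary: f f' rule: less_induct)
    case less
    have f': "degree f' = degree f" by (rule polys_degree[OF less(2)])
    show ?case
    proof (cases "f = 0")
      case True
      hence "(0, coeff f' i) \<in> G" for i using less(2) by (auto simp: polys_def)
      hence "coeff f' i = 0" for i using unique[OF zero] by metis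
      hence "f' = 0" by (simp add: poly_eqI)
      thus ?thesis by simp
    next
      case False
      hence le: "degree p \<le> degree f" using min less(2,3) by blast
      define n where "n = degree f - degree p"
      \<comment> \<open>Pseudo-division: \<open>p\<close> cannot be made monic over a ring, so
        \<open>f\<close> is multiplied by the leading coefficient of \<open>p\<close> before the
        leading terms cancel.\<close>
      define g where "g = smult (lead_coeff p) f - monom (lead_coeff f) n * p"
      define g' where "g' = smult (lead_coeff p') f' - monom (lead_coeff f') n * p'"
      have lc: "(lead_coeff p, lead_coeff p') \<in> G" "(lead_coeff f, lead_coeff f') \<in> G"
        using p(1) less(2) p' f' by (auto simp: polys_def)
      have "(monom (lead_coeff p) 0 * f, monom (lead_coeff p') 0 * f') \<in> polys"
        by (intro polys_mult polys_monom lc less(2))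
      hence "(g, g') \<in> polys"
        unfolding g_def g'_def by (intro polys_diff polys_mult polys_monom lc p(1)) (simp add: monom_0)
      moreover have "poly g \<alpha> = 0" using less(3) p(3) by (simp add: g_def)
      moreover have "poly g' \<beta> = 0"
      proof (cases "degree f = 0")
        case True
        thus ?thesis using le \<open>degree p > 0\<close> by simp
      next
        case False
        have "degree (monom (lead_coeff f) n * p) \<le> degree f"
          using degree_mult_le[of "monom (lead_coeff f) n" p] degree_monom_le[of "lead_coeff f" n] le
          by (simp add: n_def)
        hence "degree g \<le> degree f"
          unfolding g_def by (intro degree_diff_le) auto
        moreover have "coeff g (degree f) = 0"
          using le by (simp add: g_def coeff_monom_mult n_def)
        ultimately have deg: "degree g < degree f"
          using False by (metis coeff_0_degree_minus_1 diff_less le_neq_implies_less less_numeral_extra(1) leading_coeff_0_iff degree_0 neq0_conv)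
        show ?thesis using less(1)[OF deg] \<open>(g, g') \<in> polys\<close> \<open>poly g \<alpha> = 0\<close> by blast
      qed
      hence "lead_coeff p' * poly f' \<beta> = 0" using \<beta> by (simp add: g'_def)
      thus ?thesis using lp by simp
    qed
  qed
  define G' where "G' = {(poly f \<alpha>, poly f' \<beta>) | f f'. (f, f') \<in> polys}"
  have G'I: "(poly f \<alpha>, poly f' \<beta>) \<in> G'" if "(f, f') \<in> polys" for f f'
    using that by (auto simp: G'_def)
  have "\<beta> \<in> Qbar"
  proof -
    have "poly ?r \<beta> = 0" using root[OF \<open>(?r, ?r) \<in> polys\<close> r(2)] .
    moreover have "\<And>i. coeff ?r i \<in> \<int>" by (simp add: coeff_map_poly)
    ultimately show ?thesis using \<open>?r \<noteq> 0\<close> algebraicI unfolding Qbar_def by blast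
  qed
  have Qbar: "poly f \<alpha> \<in> Qbar \<and> poly f' \<beta> \<in> Qbar" if "(f, f') \<in> polys" for f f'
  proof -
    have "(\<Sum>i\<in>A. h i) \<in> Qbar" if "finite A" "\<And>i. h i \<in> Qbar" for h :: "nat \<Rightarrow> complex" and A
      using that by (induction A rule: finite_induct) auto
    moreover have "coeff f i \<in> Qbar" "coeff f' i \<in> Qbar" for i using that in_Qbar[of "coeff f i" "coeff f' i"] by (auto simp: polys_def)
    ultimately show ?thesis using \<open>\<beta> \<in> Qbar\<close> assms by (simp add: poly_altdef)
  qed
  show ?thesis
  proof (rule that)
    show "G' \<in> hom_graphs"
      unfolding hom_graphs_def
    proof (intro CollectI conjI allI impI)
      show "G' \<subseteq> Qbar \<times> Qbar" using Qbar by (auto simp: G'_def)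
      show "single_valued G'"
      proof (rule single_valuedI)
        fix x y z assume "(x, y) \<in> G'" "(x, z) \<in> G'"
        then obtain f f' g g' where fg: "(f, f') \<in> polys" "x = poly f \<alpha>" "y = poly f' \<beta>"
          "(g, g') \<in> polys" "x = poly g \<alpha>" "z = poly g' \<beta>" by (auto simp: G'_def)
        have "poly (f' - g') \<beta> = 0" by (rule root[OF polys_diff[OF fg(1,4)]]) (use fg in simp)
        thus "y = z" using fg by simp
      qed
      show "(1, 1) \<in> G'"
        using G'I[OF polys_monom[OF one, of 0]] by (simp add: poly_monom)
    next
      fix x x' y y' assume "(x, x') \<in> G'" "(y, y') \<in> G'"
      then obtain f f' g g' where fg: "(f, f') \<in> polys" "x = poly f \<alpha>" "x' = poly f' \<beta>"
        "(g, g') \<in> polys" "y = poly g \<alpha>" "y' = poly g' \<beta>" by (auto simp: G'_def)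
      show "(x + y, x' + y') \<in> G'"
        using G'I[OF polys_add[OF fg(1,4)]] fg by simp
      show "(x * y, x' * y') \<in> G'"
        using G'I[OF polys_mult[OF fg(1,4)]] fg by simp
    next
      fix x x' assume "(x, x') \<in> G'"
      then obtain f f' where f: "(f, f') \<in> polys" "x = poly f \<alpha>" "x' = poly f' \<beta>" by (auto simp: G'_def)
      show "(- x, - x') \<in> G'"
        using G'I[OF polys_uminus[OF f(1)]] f by simp
    qed
    show "G \<subseteq> G'"
    proof
      fix z assume "z \<in> G"
      thus "z \<in> G'"
        using G'I[OF polys_monom[of "fst z" "snd z" 0]] by (simp add: poly_monom)
    qed
    show "(\<alpha>, \<beta>) \<in> G'"
      using G'I[OF polys_monom[OF one, of 1]] by (simp add: poly_monom)
  qed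
qed

end

theorem extend_to_abs_Gal:
  assumes "G \<in> hom_graphs"
  obtains \<sigma> where "\<sigma> \<in> abs_Gal" "\<And>x y. (x, y) \<in> G \<Longrightarrow> \<sigma> x = y"
proof -
  let ?A = "{H \<in> hom_graphs. G \<subseteq> H}"
  have "\<exists>M\<in>?A. \<forall>X\<in>?A. M \<subseteq> X \<longrightarrow> X = M"
  proof (rule subset_Zorn_nonempty)
    show "?A \<noteq> {}" using assms by auto
    fix C assume C: "C \<noteq> {}" "subset.chain ?A C"
    have sub: "C \<subseteq> ?A" and chain: "\<And>X Y. X \<in> C \<Longrightarrow> Y \<in> C \<Longrightarrow> X \<subseteq> Y \<or> Y \<subseteq> X"
      using C(2) by (auto simp: subset_chain_def)
    have two: "\<exists>X\<in>C. u \<in> X \<and> v \<in> X" if "u \<in> \<Union>C" "v \<in> \<Union>C" for u v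
    proof -
      obtain X Y where XY: "X \<in> C" "u \<in> X" "Y \<in> C" "v \<in> Y" using \<open>u \<in> \<Union>C\<close> \<open>v \<in> \<Union>C\<close> by auto
      with chain[of X Y] show ?thesis by auto
    qed
    have hom: "hom_graph X" if "X \<in> C" for X using that sub by (auto simp: hom_graph_def)
    have "\<Union>C \<in> hom_graphs"
      unfolding hom_graphs_def
    proof (intro CollectI conjI allI impI)
      show "\<Union>C \<subseteq> Qbar \<times> Qbar" using hom_graph.in_Qbar[OF hom] by auto
      show "single_valued (\<Union>C)"
      proof (rule single_valuedI)
        fix x y z assume "(x, y) \<in> \<Union>C" "(x, z) \<in> \<Union>C"
        then obtain X where X: "X \<in> C" "(x, y) \<in> X" "(x, z) \<in> X" using two by meson
        show "y = z" by (rule hom_graph.unique[OF hom[OF X(1)] X(2,3)])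
      qed
      show "(1, 1) \<in> \<Union>C" using C(1) hom_graph.one[OF hom] by auto
    next
      fix x x' y y' assume "(x, x') \<in> \<Union>C" "(y, y') \<in> \<Union>C"
      then obtain X where X: "X \<in> C" "(x, x') \<in> X" "(y, y') \<in> X" using two by meson
      show "(x + y, x' + y') \<in> \<Union>C" using hom_graph.add[OF hom[OF X(1)] X(2,3)] X(1) by blast
      show "(x * y, x' * y') \<in> \<Union>C" using hom_graph.mult[OF hom[OF X(1)] X(2,3)] X(1) by blast
    next
      fix x x' assume "(x, x') \<in> \<Union>C"
      then obtain X where X: "X \<in> C" "(x, x') \<in> X" by blast
      show "(- x, - x') \<in> \<Union>C" using hom_graph.uminus[OF hom[OF X(1)] X(2)] X(1) by blast
    qed
    thus "\<Union>C \<in> ?A" using C(1) sub by auto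
  qed
  then obtain M where M: "M \<in> hom_graphs" "G \<subseteq> M" and max: "\<And>X. X \<in> hom_graphs \<Longrightarrow> M \<subseteq> X \<Longrightarrow> X = M"
    by auto
  interpret hom_graph M by unfold_locales (rule M)
  have total: "\<exists>y. (x, y) \<in> M" if x: "x \<in> Qbar" for x
  proof -
    obtain \<beta> G' where "G' \<in> hom_graphs" "M \<subseteq> G'" "(x, \<beta>) \<in> G'" by (rule extend[OF x])
    thus ?thesis using max by blast
  qed
  define \<sigma> where "\<sigma> = restrict (\<lambda>x. SOME y. (x, y) \<in> M) Qbar"
  have \<sigma>: "(x, \<sigma> x) \<in> M" if "x \<in> Qbar" for x
    using someI_ex[OF total[OF that]] that by (simp add: \<sigma>_def)
  have eq: "\<sigma> x = y" if "(x, y) \<in> M" for x y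
    using unique[OF \<sigma> that] in_Qbar(1)[OF that] by simp
  have add': "\<sigma> (x + y) = \<sigma> x + \<sigma> y" and mult': "\<sigma> (x * y) = \<sigma> x * \<sigma> y" if "x \<in> Qbar" "y \<in> Qbar" for x y
    using that by (auto intro!: eq add mult \<sigma>)
  have inj: "inj_on \<sigma> Qbar"
  proof (rule inj_onI)
    fix x y assume xy: "x \<in> Qbar" "y \<in> Qbar" "\<sigma> x = \<sigma> y"
    have "(x - y, \<sigma> x - \<sigma> y) \<in> M" by (intro diff \<sigma> xy)
    hence "x - y = 0" using xy(3) by (intro zero_imp_zero) simp
    thus "x = y" by simp
  qed
  have "\<sigma> ` Qbar = Qbar"
  proof
    show "\<sigma> ` Qbar \<subseteq> Qbar" using \<sigma> in_Qbar by blast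
    show "Qbar \<subseteq> \<sigma> ` Qbar"
    proof
      \<comment> \<open>The homomorphism maps the finite root set of an integer polynomial into
        itself injectively, hence onto itself.\<close>
      fix y assume y: "y \<in> Qbar"
      then obtain r where r: "r \<noteq> 0" "poly (map_poly of_int r) y = 0"
        using algebraicE' unfolding Qbar_def by blast
      let ?r = "map_poly of_int r :: complex poly"
      let ?R = "{x. poly ?r x = 0}"
      have r0: "?r \<noteq> 0" using r(1) by (metis of_int_eq_0_iff coeff_map_poly poly_eqI coeff_0 of_int_0)
      have fin: "finite ?R" by (rule poly_roots_finite[OF r0])
      have "\<And>i. coeff ?r i \<in> \<int>" by (simp add: coeff_map_poly)
      hence R: "?R \<subseteq> Qbar" using r0 algebraicI unfolding Qbar_def by blast
      have "\<sigma> ` ?R \<subseteq> ?R" using int_poly_root[OF \<sigma>] R by blast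
      hence "\<sigma> ` ?R = ?R" by (intro endo_inj_surj fin inj_on_subset[OF inj R])
      thus "y \<in> \<sigma> ` Qbar" using r(2) R by blast
    qed
  qed
  moreover have "\<sigma> q = q" if rat: "q \<in> \<rat>" for q
  proof -
    obtain m n where q: "q = of_int m / of_int n" "n \<noteq> 0"
      using rat by (elim Rats_cases') auto
    have qQ: "q \<in> Qbar" using q by simp
    have "of_int n * \<sigma> q = \<sigma> (of_int n * q)" using mult'[of "of_int n" q] qQ eq[OF of_int[of n]] by simp
    also have "\<dots> = of_int m" using q eq[OF of_int[of m]] by simp
    also have "\<dots> = of_int n * q" using q by simp
    finally show ?thesis using q(2) by simp
  qed
  ultimately have "\<sigma> \<in> abs_Gal"
    using inj add' mult' by (auto simp: abs_Gal_def bij_betw_def \<sigma>_def)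
  thus ?thesis using that eq M(2) by blast
qed

subsection \<open>Scalings and 2-isogenies\<close>

fun scale_point :: "'k :: field \<Rightarrow> 'k point \<Rightarrow> 'k point" where
  "scale_point u Infinity = Infinity"
| "scale_point u (Affine x y) = Affine (u\<^sup>2 * x) (u ^ 3 * y)"

lemma scale_point_add:
  fixes a u :: "'k :: field"
  assumes "u \<noteq> 0"
  shows "ell_add (u ^ 4 * a) (scale_point u P) (scale_point u Q) = scale_point u (ell_add a P Q)"
proof (cases "P = Infinity \<or> Q = Infinity")
  case False
  then obtain x1 y1 x2 y2 where PQ: "P = Affine x1 y1" "Q = Affine x2 y2" by (cases P; cases Q) auto
  define l where "l = (if x1 = x2 then (3 * x1\<^sup>2 + a) / (2 * y1) else (y2 - y1) / (x2 - x1))"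
  have c: "u\<^sup>2 * x1 = u\<^sup>2 * x2 \<longleftrightarrow> x1 = x2" "u ^ 3 * y1 = - (u ^ 3 * y2) \<longleftrightarrow> y1 = - y2"
    using assms by (simp, metis mult_cancel_left mult_minus_right power_not_zero)
  have "(3 * (u\<^sup>2 * x1)\<^sup>2 + u ^ 4 * a) / (2 * (u ^ 3 * y1)) = (u ^ 3 * (u * (3 * x1\<^sup>2 + a))) / (u ^ 3 * (2 * y1))"
    by (intro arg_cong2[of _ _ _ _ "(/)"]) algebra+
  also have "\<dots> = u * ((3 * x1\<^sup>2 + a) / (2 * y1))"
    using assms by (subst mult_divide_mult_cancel_left) simp_all
  finally have l1: "(3 * (u\<^sup>2 * x1)\<^sup>2 + u ^ 4 * a) / (2 * (u ^ 3 * y1)) = u * ((3 * x1\<^sup>2 + a) / (2 * y1))" .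
  have "(u ^ 3 * y2 - u ^ 3 * y1) / (u\<^sup>2 * x2 - u\<^sup>2 * x1) = (u\<^sup>2 * (u * (y2 - y1))) / (u\<^sup>2 * (x2 - x1))"
    by (intro arg_cong2[of _ _ _ _ "(/)"]) algebra+
  also have "\<dots> = u * ((y2 - y1) / (x2 - x1))"
    using assms by (subst mult_divide_mult_cancel_left) simp_all
  finally have l2: "(u ^ 3 * y2 - u ^ 3 * y1) / (u\<^sup>2 * x2 - u\<^sup>2 * x1) = u * ((y2 - y1) / (x2 - x1))" .
  have l: "(if x1 = x2 then (3 * (u\<^sup>2 * x1)\<^sup>2 + u ^ 4 * a) / (2 * (u ^ 3 * y1))
      else (u ^ 3 * y2 - u ^ 3 * y1) / (u\<^sup>2 * x2 - u\<^sup>2 * x1)) = u * l"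
    unfolding l1 l2 l_def by (simp only: if_distrib[of "\<lambda>z. u * z"])
  have e: "(u * l)\<^sup>2 - u\<^sup>2 * x1 - u\<^sup>2 * x2 = u\<^sup>2 * (l\<^sup>2 - x1 - x2)"
    "u * l * (u\<^sup>2 * x1 - u\<^sup>2 * (l\<^sup>2 - x1 - x2)) - u ^ 3 * y1 = u ^ 3 * (l * (x1 - (l\<^sup>2 - x1 - x2)) - y1)"
    by algebra+
  show ?thesis
    unfolding PQ scale_point.simps ell_add.simps Let_def c l l_def[symmetric] e
    by (simp only: if_distrib[of "scale_point u"] scale_point.simps)
qed auto

lemma scale_point_compose: "scale_point u (scale_point v P) = scale_point (u * v) P"
  by (cases P) (simp_all add: power_mult_distrib)

lemma scale_point_1 [simp]: "scale_point 1 P = P"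
  by (cases P) simp_all

lemma scale_point_uminus: "scale_point (- u) P = ell_neg (scale_point u P)"
  by (cases P) (simp_all add: power2_eq_square power3_eq_cube)

lemma scale_point_neg: "scale_point u (ell_neg P) = ell_neg (scale_point u P)"
  by (cases P) simp_all

lemma scale_point_curve:
  assumes "weierstrass a b" "weierstrass (u ^ 4 * a) (u ^ 6 * b)" "P \<in> weierstrass.curve a b"
  shows "scale_point u P \<in> weierstrass.curve (u ^ 4 * a) (u ^ 6 * b)"
proof (cases P)
  case (Affine x y)
  hence "y\<^sup>2 = x ^ 3 + a * x + b" using assms(3) weierstrass.Affine_in_curve[OF assms(1)] by simp
  hence "(u ^ 3 * y)\<^sup>2 = (u\<^sup>2 * x) ^ 3 + u ^ 4 * a * (u\<^sup>2 * x) + u ^ 6 * b" by algebra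
  thus ?thesis using Affine weierstrass.Affine_in_curve[OF assms(2)] by simp
qed (simp add: weierstrass.Infinity_in_curve[OF assms(2)])

text \<open>Velu's formulas for the 2-isogeny with kernel generated by \<open>(e, 0)\<close>, where \<open>t = 3 e\<^sup>2 + a\<close>.\<close>

fun velu :: "'k :: field \<Rightarrow> 'k \<Rightarrow> 'k point \<Rightarrow> 'k point" where
  "velu e t Infinity = Infinity"
| "velu e t (Affine x y) = (if x = e then Infinity
     else Affine (x + t / (x - e)) (y * (1 - t / (x - e)\<^sup>2)))"

lemma velu_neg: "velu e t (ell_neg P) = ell_neg (velu e t P)"
  by (cases P) auto

locale two_isogeny = E: weierstrass a b + E': weierstrass a' b' for a b a' b' +
  fixes e t :: complex
  assumes root: "e ^ 3 + a * e + b = 0" and t: "t = 3 * e\<^sup>2 + a"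
    and a': "a' = a - 5 * t" and b': "b' = b - 7 * t * e"
begin

lemma t_nonzero: "t \<noteq> 0"
  using E.no_singular_point[OF root] by (simp add: t)

lemma affine_root: "Affine e y \<in> E.curve \<Longrightarrow> y = 0"
  using root by simp

lemma velu_in_curve:
  assumes "P \<in> E.curve"
  shows "velu e t P \<in> E'.curve"
proof (cases P)
  case (Affine x y)
  show ?thesis
  proof (cases "x = e")
    case False
    define v where "v = 1 / (x - e)"
    have v: "(x - e) * v = 1" using False by (simp add: v_def)
    have c: "y\<^sup>2 = x ^ 3 + a * x + b" using assms Affine by simp
    have ab: "a = t - 3 * e\<^sup>2" "b = - (e ^ 3 + a * e)" using t root by algebra+
    have "(y * (1 - t * v\<^sup>2))\<^sup>2 = y\<^sup>2 * (1 - t * v\<^sup>2)\<^sup>2" by algebra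
    also have "\<dots> = (x + t * v) ^ 3 + a' * (x + t * v) + b'"
      unfolding c a' b' ab using v by algebra
    finally show ?thesis
      using Affine False by (simp add: v_def power_one_over)
  qed (use Affine in simp)
qed simp

text \<open>Translation by the kernel point replaces u = x - e by t / u and so leaves u + t / u
  unchanged.\<close>

lemma velu_add_root:
  assumes "P \<in> E.curve"
  shows "velu e t (ell_add a (Affine e 0) P) = velu e t P"
proof (cases P)
  case (Affine x y)
  show ?thesis
  proof (cases "x = e")
    case True
    hence "y = 0" using affine_root assms Affine by blast
    thus ?thesis using Affine True by simp
  next
    case False
    define u where "u = x - e"
    define v where "v = 1 / u"
    have u: "u \<noteq> 0" "x = e + u" using False by (simp_all add: u_def)
    have v: "u * v = 1" using u by (simp add: v_def)
    have c: "y\<^sup>2 = u ^ 3 + 3 * e * u\<^sup>2 + t * u"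
    proof -
      have "y\<^sup>2 = x ^ 3 + a * x + b" using assms Affine by simp
      thus ?thesis using u(2) t root by algebra
    qed
    define x3 where "x3 = (y * v)\<^sup>2 - e - x"
    have "x3 = e + t * v" using c v unfolding x3_def u(2) by algebra
    moreover have "(y - 0) / (x - e) = y * v" by (simp add: v_def u_def)
    moreover have "\<not> (e = x \<and> 0 = - y)" "\<not> e = x" using False by auto
    ultimately have add: "ell_add a (Affine e 0) P = Affine (e + t * v) (y * v * (e - (e + t * v)) - 0)"
      unfolding Affine ell_add.simps Let_def by (simp only: if_False x3_def)
    have ne: "t * v \<noteq> 0" using t_nonzero v by auto
    have tv: "t / (t * v) = u" using v t_nonzero by (simp add: v_def)
    have "t / (t * v)\<^sup>2 = u * (1 / (t * v))" using tv by (simp add: power2_eq_square flip: divide_divide_eq_left)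
    moreover have "1 / (t * v) = u / t" using t_nonzero u by (simp add: v_def)
    ultimately have tv2: "t * (t / (t * v)\<^sup>2) = u\<^sup>2" using t_nonzero by (simp add: power2_eq_square)
    define w where "w = t / (t * v)\<^sup>2"
    have "- (y * v * (t * v)) * (1 - w) = y * (1 - t * v\<^sup>2)"
      using tv2 v unfolding w_def[symmetric] by algebra
    moreover have "t * v\<^sup>2 = t / u\<^sup>2" by (simp add: v_def power_one_over)
    moreover have "e + t * v + u = x + t / u" using u by (simp add: v_def)
    ultimately show ?thesis
      unfolding add using Affine False ne tv w_def u_def by simp
  qed
qed simp

text \<open>An isogeny that preserves lines is additive. The elementary symmetric functions of u = x
  - e and of v = 1 / u at the three points are expressed by the line, so the final identities no
  longer mention individual points.\<close>

lemma velu_collinear: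
  assumes col: "E.collinear l m (Affine x1 y1) (Affine x2 y2) (Affine x3 y3)"
    and ne: "x1 \<noteq> e" "x2 \<noteq> e" "x3 \<noteq> e"
  shows "\<exists>l m. E'.collinear l m (velu e t (Affine x1 y1)) (velu e t (Affine x2 y2)) (velu e t (Affine x3 y3))"
proof -
  have y: "y1 = l * x1 + m" "y2 = l * x2 + m" "y3 = l * x3 + m" and r: "E.cubic_roots l m x1 x2 x3"
    using col by (auto simp: E.collinear_def)
  define \<mu> where "\<mu> = l * e + m"
  have m: "m = \<mu> - l * e" by (simp add: \<mu>_def)
  define u1 u2 u3 where "u1 = x1 - e" and "u2 = x2 - e" and "u3 = x3 - e"
  define v1 v2 v3 where "v1 = 1 / u1" and "v2 = 1 / u2" and "v3 = 1 / u3"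
  have uv: "u1 * v1 = 1" "u2 * v2 = 1" "u3 * v3 = 1"
    using ne by (simp_all add: u1_def u2_def u3_def v1_def v2_def v3_def)
  have x: "x1 = e + u1" "x2 = e + u2" "x3 = e + u3" by (simp_all add: u1_def u2_def u3_def)
  have E1: "u1 + u2 + u3 = l\<^sup>2 - 3 * e" and E2: "u1 * u2 + u1 * u3 + u2 * u3 = t - 2 * l * \<mu>"
    and E3: "u1 * u2 * u3 = \<mu>\<^sup>2"
    using r root t unfolding E.cubic_roots_def x m by algebra+
  \<comment> \<open>\<mu> is the ordinate of the line at \<open>e\<close>; the line misses the
    kernel point, as no abscissa is \<open>e\<close>.\<close>
  have "\<mu> \<noteq> 0" using E3 uv by (metis mult_zero_left mult_zero_right no_zero_divisors power_zero_numeral zero_neq_one)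
  define w where "w = 1 / \<mu>"
  have w: "\<mu> * w = 1" using \<open>\<mu> \<noteq> 0\<close> by (simp add: w_def)
  have V3: "v1 * v2 * v3 = w\<^sup>2" using E3 uv w by algebra
  have V1: "v1 + v2 + v3 = (t - 2 * l * \<mu>) * w\<^sup>2" and V2: "v1 * v2 + v1 * v3 + v2 * v3 = (l\<^sup>2 - 3 * e) * w\<^sup>2"
    using V3 E1 E2 uv by algebra+
  \<comment> \<open>The curve equation divided by u^2 expresses \<mu>^2 v^2 by lower terms.
    Substituted into the new ordinate, it leaves a linear expression in u + t v, with slope
    \<open>L\<close>.\<close>
  define L where "L = l - t * w"
  define M where "M = \<mu> + t * w * (l\<^sup>2 - 3 * e) - L * e"
  have line: "(l * (e + u) + m) * (1 - t * v\<^sup>2) = L * (e + u + t * v) + M"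
    if uv: "u * v = 1" and cub: "u ^ 3 + 3 * e * u\<^sup>2 + t * u = (l * u + \<mu>)\<^sup>2" for u v
  proof -
    have "u + (3 * e - l\<^sup>2) + (t - 2 * l * \<mu>) * v - \<mu>\<^sup>2 * v\<^sup>2 = 0"
      using cub uv by algebra
    thus ?thesis using uv w unfolding L_def M_def m by algebra
  qed
  have cub: "u ^ 3 + 3 * e * u\<^sup>2 + t * u = (l * u + \<mu>)\<^sup>2" if "(u - u1) * (u - u2) * (u - u3) = 0" for u
    using that E1 E2 E3 by algebra
  have lines: "y1 * (1 - t * v1\<^sup>2) = L * (x1 + t * v1) + M" "y2 * (1 - t * v2\<^sup>2) = L * (x2 + t * v2) + M"
    "y3 * (1 - t * v3\<^sup>2) = L * (x3 + t * v3) + M"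
    unfolding y x by (intro line uv cub; simp)+
  define S1 S2 where "S1 = u1 + u2 + u3 + t * (v1 + v2 + v3)"
    and "S2 = (u1 * u2 + u1 * u3 + u2 * u3) + t * ((u1 + u2 + u3) * (v1 + v2 + v3) - 3) + t\<^sup>2 * (v1 * v2 + v1 * v3 + v2 * v3)"
  have S1: "S1 = l\<^sup>2 - 3 * e + t * ((t - 2 * l * \<mu>) * w\<^sup>2)" unfolding S1_def E1 V1 ..
  have S2: "S2 = (t - 2 * l * \<mu>) + t * ((l\<^sup>2 - 3 * e) * ((t - 2 * l * \<mu>) * w\<^sup>2) - 3) + t\<^sup>2 * ((l\<^sup>2 - 3 * e) * w\<^sup>2)"
    unfolding S2_def E1 V1 E2 V2 ..
  define S3 where "S3 = (u1 + t * v1) * (u2 + t * v2) * (u3 + t * v3)"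
  have "S3 = u1 * u2 * u3 + t * ((u1 * u2 + u1 * u3 + u2 * u3) * (v1 + v2 + v3) - 2 * (u1 + u2 + u3))
      + t\<^sup>2 * ((u1 + u2 + u3) * (v1 * v2 + v1 * v3 + v2 * v3) - 2 * (v1 + v2 + v3)) + t ^ 3 * (v1 * v2 * v3)"
    unfolding S3_def using uv by algebra
  hence S3: "S3 = \<mu>\<^sup>2 + t * ((t - 2 * l * \<mu>) * ((t - 2 * l * \<mu>) * w\<^sup>2) - 2 * (l\<^sup>2 - 3 * e))
      + t\<^sup>2 * ((l\<^sup>2 - 3 * e) * ((l\<^sup>2 - 3 * e) * w\<^sup>2) - 2 * ((t - 2 * l * \<mu>) * w\<^sup>2)) + t ^ 3 * w\<^sup>2"
    unfolding E1 E2 E3 V1 V2 V3 .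
  define X1 X2 X3 where "X1 = x1 + t * v1" and "X2 = x2 + t * v2" and "X3 = x3 + t * v3"
  have X1: "X1 + X2 + X3 = S1 + 3 * e" unfolding X1_def X2_def X3_def x S1_def by algebra
  have X2: "X1 * X2 + X1 * X3 + X2 * X3 = S2 + 2 * e * S1 + 3 * e\<^sup>2"
    unfolding X1_def X2_def X3_def x S1_def S2_def using uv by algebra
  have X3: "X1 * X2 * X3 = S3 + e * S2 + e\<^sup>2 * S1 + e ^ 3"
    unfolding X1_def X2_def X3_def x S1_def S2_def S3_def using uv by algebra
  have a: "a = t - 3 * e\<^sup>2" using t by simp
  have b: "b = 2 * e ^ 3 - t * e" using root unfolding a by algebra
  have "L\<^sup>2 = X1 + X2 + X3" unfolding X1 S1 L_def using w by algebra
  moreover have "a' - 2 * L * M = X1 * X2 + X1 * X3 + X2 * X3"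
    unfolding X2 S2 S1 M_def L_def a' a using w by algebra
  moreover have "b' - M\<^sup>2 = - (X1 * X2 * X3)"
    unfolding X3 S3 S2 S1 M_def L_def b' b using w by algebra
  ultimately have "E'.cubic_roots L M X1 X2 X3" by (simp add: E'.cubic_roots_def)
  moreover have "velu e t (Affine x1 y1) = Affine X1 (L * X1 + M)" "velu e t (Affine x2 y2) = Affine X2 (L * X2 + M)"
    "velu e t (Affine x3 y3) = Affine X3 (L * X3 + M)"
    using ne lines by (simp_all add: X1_def X2_def X3_def v1_def v2_def v3_def u1_def u2_def u3_def power_one_over)
  ultimately show ?thesis unfolding E'.collinear_def by blast
qed

text \<open>If P, Q or P + Q lies in the kernel, the image has no affine coordinates; these cases
  rest on cancellation and \<open>velu_add_root\<close>, and the remaining ones on lines.\<close>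

theorem velu_add:
  assumes P: "P \<in> E.curve" and Q: "Q \<in> E.curve"
  shows "velu e t (ell_add a P Q) = ell_add a' (velu e t P) (velu e t Q)"
proof -
  let ?K = "Affine e 0"
  have KK: "ell_add a ?K ?K = Infinity" by simp
  have K: "velu e t ?K = Infinity" by simp
  have x_ne: "x \<noteq> e" if "Affine x y \<in> E.curve" "Affine x y \<noteq> ?K" for x y
    using that affine_root by blast
  consider "P = Infinity" | "Q = Infinity" | "P = ?K" | "Q = ?K" | "P = ell_neg Q" | "ell_add a P Q = ?K"
    | "P \<notin> {Infinity, ?K}" "Q \<notin> {Infinity, ?K}" "P \<noteq> ell_neg Q" "ell_add a P Q \<noteq> ?K" by blast
  thus ?thesis
  proof cases
    case 3
    thus ?thesis using velu_add_root[OF Q] K by simp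
  next
    case 4
    thus ?thesis using velu_add_root[OF P] E.add_commute[OF P Q] K by simp
  next
    case 5
    thus ?thesis by (simp add: velu_neg)
  next
    case 6
    have "ell_add a ?K (ell_neg Q) = P" using E.add_neg_cancel[OF P Q] 6 by simp
    hence "velu e t P = ell_neg (velu e t Q)"
      using velu_add_root[of "ell_neg Q"] Q by (simp add: velu_neg)
    thus ?thesis using 6 by simp
  next
    case 7
    obtain x1 y1 where P': "P = Affine x1 y1" using 7 by (cases P) auto
    obtain x2 y2 where Q': "Q = Affine x2 y2" using 7 by (cases Q) auto
    obtain l m where col: "E.collinear l m P Q (ell_neg (ell_add a P Q))"
      using E.add_collinear[OF P Q] 7 by blast
    then obtain x3 y3 where R: "ell_neg (ell_add a P Q) = Affine x3 y3" by (auto simp: E.collinear_def)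
    have "Affine x3 y3 \<in> E.curve" using E.collinear_in_curve(3)[OF col] R by simp
    moreover have "Affine x3 y3 \<noteq> ?K"
    proof
      assume "Affine x3 y3 = ?K"
      hence "ell_add a P Q = ell_neg ?K" using R by (metis ell_neg_neg)
      thus False using 7 by simp
    qed
    ultimately have "x1 \<noteq> e" "x2 \<noteq> e" "x3 \<noteq> e"
      using x_ne P Q 7 unfolding P' Q' by blast+
    then obtain L M where "E'.collinear L M (velu e t P) (velu e t Q) (velu e t (ell_neg (ell_add a P Q)))"
      using velu_collinear col unfolding P' Q' R[unfolded P' Q'] by blast
    hence "ell_add a' (velu e t P) (velu e t Q) = ell_neg (velu e t (ell_neg (ell_add a P Q)))"
      by (rule E'.collinear_add)
    thus ?thesis by (simp add: velu_neg)
  qed simp_all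
qed

text \<open>The last conclusion allows division by 2 within the algebraic points.\<close>

lemma velu_surj:
  assumes Q: "Q \<in> E'.curve"
  obtains P where "P \<in> E.curve" "velu e t P = Q"
    "{a, b, e} \<union> set_point Q \<subseteq> Qbar \<Longrightarrow> set_point P \<subseteq> Qbar"
proof (cases Q)
  case Infinity
  thus ?thesis using that[of Infinity] by simp
next
  case (Affine X Y)
  \<comment> \<open>\<open>s\<close> is the root of the discriminant for u + t / u = X - e. An
    abscissa above \<open>X\<close> fixes the ordinate up to sign, and the sign can be changed on
    the source.\<close>
  define s where "s = csqrt ((X - e)\<^sup>2 - 4 * t)"
  define u where "u = (X - e + s) / 2"
  have "s\<^sup>2 = (X - e)\<^sup>2 - 4 * t" by (simp add: s_def)
  moreover have "2 * u = X - e + s" by (simp add: u_def)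
  ultimately have "4 * (u\<^sup>2 - (X - e) * u + t) = 0" by algebra
  hence u: "u\<^sup>2 - (X - e) * u + t = 0" by (simp only: mult_eq_0_iff) simp
  hence "u \<noteq> 0" using t_nonzero by auto
  hence X: "e + u + t / u = X" using u by (simp add: field_simps power2_eq_square)
  define y where "y = csqrt ((e + u) ^ 3 + a * (e + u) + b)"
  have P: "Affine (e + u) y \<in> E.curve" by (simp add: y_def)
  have alg: "{e + u, y, - y} \<subseteq> Qbar" if "{a, b, e} \<union> set_point Q \<subseteq> Qbar"
    using that by (simp add: Affine y_def u_def s_def t)
  obtain Y' where Y': "velu e t (Affine (e + u) y) = Affine X Y'"
    using X \<open>u \<noteq> 0\<close> by simp
  have "Affine X Y' \<in> E'.curve" using velu_in_curve[OF P] Y' by simp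
  hence "Y'\<^sup>2 = Y\<^sup>2" using Q Affine by simp
  hence "Y' = Y \<or> Y' = - Y" by (simp add: power2_eq_iff)
  thus ?thesis
  proof
    assume "Y' = Y"
    thus ?thesis using that[OF P] Y' Affine alg by simp
  next
    assume "Y' = - Y"
    hence Q': "velu e t (ell_neg (Affine (e + u) y)) = Q"
      unfolding velu_neg Y' using Affine by simp
    have P': "ell_neg (Affine (e + u) y) \<in> E.curve" using P by (simp only: E.ell_neg_in_curve)
    show ?thesis by (rule that[OF P' Q']) (use alg in simp)
  qed
qed

end

subsection \<open>Tate modules of abelian groups\<close>

primrec nmul :: "nat \<Rightarrow> 'a :: ab_group_add \<Rightarrow> 'a" where
  "nmul 0 p = 0"
| "nmul (Suc n) p = p + nmul n p"

lemma nmul_add: "nmul (m + n) p = nmul m p + nmul n p"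
  by (induction m) (simp_all add: add.assoc)

lemma nmul_add_right: "nmul n (p + q) = nmul n p + nmul n q"
  by (induction n) (simp_all add: algebra_simps)

lemma nmul_uminus: "nmul n (- p) = - nmul n p"
  by (induction n) simp_all

definition imul :: "int \<Rightarrow> 'a :: ab_group_add \<Rightarrow> 'a" where
  "imul k p = nmul (nat k) p - nmul (nat (- k)) p"

lemma imul_diff_nat: "imul (int m - int n) p = nmul m p - nmul n p"
proof (cases "m \<ge> n")
  case True
  then obtain k where "m = n + k" by (metis le_Suc_ex)
  thus ?thesis by (simp add: imul_def nmul_add)
next
  case False
  then obtain k where "n = m + k" by (metis le_Suc_ex nat_le_linear)
  thus ?thesis by (simp add: imul_def nmul_add)
qed

lemma imul_of_nat: "imul (int n) p = nmul n p"
  by (simp add: imul_def)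

lemma imul_0 [simp]: "imul 0 p = 0" and imul_1 [simp]: "imul 1 p = p"
  by (simp_all add: imul_def)

lemma int_cases_diff: obtains m n where "k = int m - int n"
  by (metis diff_0 diff_zero int_cases2 of_nat_0)

lemma imul_add: "imul (k + l) p = imul k p + imul l p"
proof -
  obtain m n m' n' where kl: "k = int m - int n" "l = int m' - int n'" by (metis int_cases_diff)
  have "imul (k + l) p = imul (int (m + m') - int (n + n')) p" by (simp add: kl algebra_simps)
  thus ?thesis by (simp only: kl imul_diff_nat nmul_add) (simp add: algebra_simps)
qed

lemma imul_uminus: "imul (- k) p = - imul k p"
  by (simp add: imul_def)

lemma imul_diff: "imul (k - l) p = imul k p - imul l p"
  using imul_add[of k "- l" p] by (simp add: imul_uminus)

lemma imul_add_right: "imul k (p + q) = imul k p + imul k q"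
  by (simp add: imul_def nmul_add_right algebra_simps)

lemma imul_uminus_right: "imul k (- p) = - imul k p"
  by (simp add: imul_def nmul_uminus)

lemma imul_diff_right: "imul k (p - q) = imul k p - imul k q"
  using imul_add_right[of k p "- q"] by (simp add: imul_uminus_right)

lemma imul_zero_right [simp]: "imul k 0 = 0"
  using imul_add_right[of k 0 0] by simp

lemma imul_mult: "imul (k * l) p = imul k (imul l p)"
proof (cases k rule: int_cases_diff)
  case (1 m n)
  have *: "imul (int m * l) p = nmul m (imul l p)" for m
    by (induction m) (simp_all add: distrib_right imul_add)
  have "imul (k * l) p = imul (int m * l - int n * l) p" by (simp add: 1 algebra_simps)
  also have "\<dots> = nmul m (imul l p) - nmul n (imul l p)" by (simp only: imul_diff *)
  finally show ?thesis by (simp add: 1 imul_diff_nat)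
qed

lemma imul_2: "imul 2 p = p + p"
  using imul_add[of 1 1 p] by simp

definition additive_map :: "('a :: ab_group_add \<Rightarrow> 'b :: ab_group_add) \<Rightarrow> bool" where
  "additive_map g \<longleftrightarrow> (\<forall>p q. g (p + q) = g p + g q)"

lemma additive_mapD:
  assumes "additive_map g"
  shows "g (p + q) = g p + g q" "g 0 = 0" "g (- p) = - g p" "g (imul k p) = imul k (g p)"
proof -
  show add: "g (p + q) = g p + g q" for p q using assms by (simp add: additive_map_def)
  show 0: "g 0 = 0" using add[of 0 0] by simp
  show neg: "g (- p) = - g p" for p using add[of p "- p"] 0 by (simp add: eq_neg_iff_add_eq_0 add.commute)
  have "g (nmul n p) = nmul n (g p)" for n by (induction n) (simp_all add: 0 add)
  thus "g (imul k p) = imul k (g p)"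
    using add[of "nmul (nat k) p" "- nmul (nat (- k)) p"] by (simp add: imul_def neg)
qed

section \<open>Compatible sequences and 2-adic coordinates\<close>

definition tate_seq :: "(nat \<Rightarrow> 'a :: ab_group_add) set" where
  "tate_seq = {P. P 0 = 0 \<and> (\<forall>n. P (Suc n) + P (Suc n) = P n)}"

text \<open>The n-th term of a sequence in \<open>tate_seq\<close> is killed by
  \<open>2 ^ n\<close>, so only the residues of the coefficients modulo \<open>2 ^ n\<close> matter
  there.\<close>

definition lincomb :: "z2 \<Rightarrow> (nat \<Rightarrow> 'a :: ab_group_add) \<Rightarrow> z2 \<Rightarrow> (nat \<Rightarrow> 'a) \<Rightarrow> nat \<Rightarrow> 'a" where
  "lincomb x P y Q = (\<lambda>n. imul (res x n) (P n) + imul (res y n) (Q n))"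

lemma tate_seq_0: "P \<in> tate_seq \<Longrightarrow> P 0 = 0"
  and tate_seq_double: "P \<in> tate_seq \<Longrightarrow> P (Suc n) + P (Suc n) = P n"
  by (simp_all add: tate_seq_def)

lemma tate_seq_imul:
  assumes "P \<in> tate_seq"
  shows "imul (2 ^ k) (P (n + k)) = P n"
proof (induction k)
  case (Suc k)
  have "imul (2 ^ Suc k) (P (n + Suc k)) = imul (2 ^ k) (imul 2 (P (Suc (n + k))))"
    by (simp flip: imul_mult add: mult.commute)
  thus ?case using Suc tate_seq_double[OF assms] by (simp add: imul_2)
qed simp

lemma tate_seq_torsion: "P \<in> tate_seq \<Longrightarrow> imul (2 ^ n) (P n) = 0"
  using tate_seq_imul[of P n 0] tate_seq_0[of P] by simp

lemma imul_cong:
  assumes "P \<in> tate_seq" "2 ^ n dvd k - l"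
  shows "imul k (P n) = imul l (P n)"
proof -
  obtain m where "k - l = 2 ^ n * m" using assms(2) ..
  hence "imul (k - l) (P n) = imul m (imul (2 ^ n) (P n))" by (simp flip: imul_mult add: mult.commute)
  thus ?thesis using tate_seq_torsion[OF assms(1)] by (simp add: imul_diff)
qed

lemma imul_mod: "P \<in> tate_seq \<Longrightarrow> imul (k mod 2 ^ n) (P n) = imul k (P n)"
  by (rule imul_cong) (simp_all add: mod_eq_dvd_iff[symmetric])

lemma imul_half: "P \<in> tate_seq \<Longrightarrow> imul (2 * k) (P (Suc n)) = imul k (P n)"
  using imul_mult[of k 2 "P (Suc n)"] tate_seq_double[of P n] by (simp add: imul_2 mult.commute)

lemma lincomb_in_tate_seq:
  assumes "P \<in> tate_seq" "Q \<in> tate_seq"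
  shows "lincomb x P y Q \<in> tate_seq"
proof -
  have *: "imul (res x (Suc n)) (R (Suc n)) + imul (res x (Suc n)) (R (Suc n)) = imul (res x n) (R n)"
    if "R \<in> tate_seq" for R :: "nat \<Rightarrow> 'a" and x n
  proof -
    have "imul (res x (Suc n)) (R (Suc n)) + imul (res x (Suc n)) (R (Suc n)) = imul (res x (Suc n)) (R n)"
      using tate_seq_double[OF that] by (simp flip: imul_add_right)
    also have "\<dots> = imul (res x n) (R n)"
      using imul_mod[OF that, of "res x (Suc n)" n] by (simp add: res_Suc_mod)
    finally show ?thesis .
  qed
  have "lincomb x P y Q (Suc n) + lincomb x P y Q (Suc n) = lincomb x P y Q n" for n
    using *[OF assms(1), of x n] *[OF assms(2), of y n] unfolding lincomb_def
    by (metis (no_types, lifting) add.assoc add.left_commute)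
  moreover have "lincomb x P y Q 0 = 0" by (simp add: lincomb_def)
  ultimately show ?thesis by (simp add: tate_seq_def)
qed

lemma lincomb_lincomb:
  assumes P: "P \<in> tate_seq" and Q: "Q \<in> tate_seq"
  shows "lincomb x (lincomb a P c Q) y (lincomb b P d Q) = lincomb (a * x + b * y) P (c * x + d * y) Q"
proof
  fix n
  have *: "imul (res (a * x + b * y) n) (R n) = imul (res x n * res a n) (R n) + imul (res y n * res b n) (R n)"
    if "R \<in> tate_seq" for R :: "nat \<Rightarrow> 'a" and a b
  proof -
    have "imul (res (a * x + b * y) n) (R n) = imul (res a n * res x n + res b n * res y n) (R n)"
      by (simp add: plus_z2.rep_eq times_z2.rep_eq imul_mod[OF that] mod_add_eq)
    thus ?thesis by (simp add: imul_add mult.commute)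
  qed
  show "lincomb x (lincomb a P c Q) y (lincomb b P d Q) n = lincomb (a * x + b * y) P (c * x + d * y) Q n"
    unfolding lincomb_def *[OF P] *[OF Q] by (simp add: imul_add_right imul_mult add_ac)
qed

lemma additive_lincomb: "additive_map g \<Longrightarrow> g \<circ> lincomb x P y Q = lincomb x (g \<circ> P) y (g \<circ> Q)"
  by (simp add: fun_eq_iff lincomb_def additive_mapD)

lemma additive_tate_seq: "additive_map g \<Longrightarrow> P \<in> tate_seq \<Longrightarrow> g \<circ> P \<in> tate_seq"
  by (auto simp: tate_seq_def additive_mapD simp flip: additive_mapD(1))

definition is_tate_basis :: "(nat \<Rightarrow> 'a :: ab_group_add) \<Rightarrow> (nat \<Rightarrow> 'a) \<Rightarrow> bool" where
  "is_tate_basis P Q \<longleftrightarrow> P \<in> tate_seq \<and> Q \<in> tate_seq \<and>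
     (\<forall>R\<in>tate_seq. \<exists>!xy. R = lincomb (fst xy) P (snd xy) Q)"

lemma is_tate_basisD:
  assumes "is_tate_basis P Q"
  shows "P \<in> tate_seq" "Q \<in> tate_seq" "R \<in> tate_seq \<Longrightarrow> \<exists>x y. R = lincomb x P y Q"
    "lincomb x P y Q = lincomb x' P y' Q \<Longrightarrow> x = x' \<and> y = y'"
proof -
  show PQ: "P \<in> tate_seq" "Q \<in> tate_seq" using assms by (simp_all add: is_tate_basis_def)
  show "\<exists>x y. R = lincomb x P y Q" if "R \<in> tate_seq"
    using assms that unfolding is_tate_basis_def by blast
  assume eq: "lincomb x P y Q = lincomb x' P y' Q"
  have "\<exists>!xy. lincomb x P y Q = lincomb (fst xy) P (snd xy) Q"
    using assms lincomb_in_tate_seq[OF PQ] unfolding is_tate_basis_def by blast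
  hence "(x, y) = (x', y')" using eq by (metis fst_conv snd_conv)
  thus "x = x' \<and> y = y'" by simp
qed

lemma z2_of_compatible:
  fixes X :: "nat \<Rightarrow> int"
  assumes "\<And>n. 2 ^ n dvd X (Suc n) - X n"
  obtains x where "\<And>n. res x n = X n mod 2 ^ n"
proof -
  have "X (Suc n) mod 2 ^ Suc n mod 2 ^ n = X n mod 2 ^ n" for n
    using assms[of n] by (simp add: mod_mod_pow2 mod_eq_dvd_iff)
  hence "res (Abs_z2 (\<lambda>n. X n mod 2 ^ n)) n = X n mod 2 ^ n" for n
    by (subst Abs_z2_inverse) auto
  thus ?thesis by (rule that)
qed

text \<open>A form of Nakayama's lemma: two sequences whose first terms are a basis of the 2-torsion
  form a basis of the Tate module.\<close>

lemma is_tate_basisI: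
  fixes P Q :: "nat \<Rightarrow> 'a :: ab_group_add"
  assumes P: "P \<in> tate_seq" and Q: "Q \<in> tate_seq"
    and ne: "P 1 \<noteq> 0" "Q 1 \<noteq> 0" "P 1 \<noteq> Q 1"
    and two: "\<And>r :: 'a. r + r = 0 \<Longrightarrow> r \<in> {0, P 1, Q 1, P 1 + Q 1}"
  shows "is_tate_basis P Q"
proof -
  have order2: "imul k (R 1) = (if even k then 0 else R 1)" if R: "R \<in> tate_seq" for k and R :: "nat \<Rightarrow> 'a"
    using imul_cong[OF R, of 1 k "if even k then 0 else 1"] by auto
  have neg1: "- Q 1 = Q 1"
    using tate_seq_double[OF Q, of 0] tate_seq_0[OF Q] by (simp add: neg_eq_iff_add_eq_0)
  \<comment> \<open>Multiplication by \<open>2 ^ n\<close> carries a relation at level n + 1 to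
    level 1, where it makes both coefficients even; halving them leads to level n.\<close>
  have indep: "2 ^ n dvd x \<and> 2 ^ n dvd y" if "imul x (P n) + imul y (Q n) = 0" for x y n
    using that
  proof (induction n arbitrary: x y)
    case (Suc n)
    have "imul (2 ^ n) (imul x (P (Suc n)) + imul y (Q (Suc n))) = 0" using Suc.prems by simp
    hence "imul x (imul (2 ^ n) (P (1 + n))) + imul y (imul (2 ^ n) (Q (1 + n))) = 0"
      by (simp add: imul_add_right mult.commute flip: imul_mult)
    hence "imul x (P 1) + imul y (Q 1) = 0" by (simp only: tate_seq_imul[OF P] tate_seq_imul[OF Q])
    hence "even x \<and> even y"
      using ne neg1 unfolding order2[OF P] order2[OF Q] by (auto split: if_splits simp: add_eq_0_iff2)
    then obtain x' y' where xy: "x = 2 * x'" "y = 2 * y'" by (auto elim!: evenE)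
    have "imul x' (P n) + imul y' (Q n) = 0"
      using Suc.prems unfolding xy imul_half[OF P] imul_half[OF Q] .
    thus ?case using Suc.IH xy by auto
  qed simp
  show ?thesis
    unfolding is_tate_basis_def
  proof (intro conjI ballI P Q)
    fix R :: "nat \<Rightarrow> 'a" assume R: "R \<in> tate_seq"
    have "\<exists>x y. R n = imul x (P n) + imul y (Q n)" for n
    proof (induction n)
      case 0
      show ?case using tate_seq_0[OF R] tate_seq_0[OF P] tate_seq_0[OF Q] by simp
    next
      case (Suc n)
      then obtain x y where xy: "R n = imul x (P n) + imul y (Q n)" by blast
      \<comment> \<open>Coordinates at level n, used at the next level, are wrong only by a
        2-torsion element, which is a combination of the first terms.\<close>
      define r where "r = R (Suc n) - (imul x (P (Suc n)) + imul y (Q (Suc n)))"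
      have "imul 2 r = imul 2 (R (Suc n)) - (imul (2 * x) (P (Suc n)) + imul (2 * y) (Q (Suc n)))"
        unfolding r_def imul_diff_right imul_add_right imul_mult ..
      also have "\<dots> = 0"
        unfolding imul_half[OF P] imul_half[OF Q] using tate_seq_double[OF R] xy by (simp add: imul_2)
      finally have "r + r = 0" by (simp add: imul_2)
      hence "r \<in> {0, P 1, Q 1, P 1 + Q 1}" by (rule two)
      moreover have "P 1 = imul (2 ^ n) (P (Suc n))" "Q 1 = imul (2 ^ n) (Q (Suc n))"
        using tate_seq_imul[OF P, of n 1] tate_seq_imul[OF Q, of n 1] by simp_all
      ultimately have "\<exists>i j. r = imul i (P (Suc n)) + imul j (Q (Suc n))"
        by (auto intro: exI[of _ 0] exI[of _ "2 ^ n"])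
          (metis imul_0 add_0 add_0_right)+
      then obtain i j where "r = imul i (P (Suc n)) + imul j (Q (Suc n))" by blast
      hence "R (Suc n) = imul (x + i) (P (Suc n)) + imul (y + j) (Q (Suc n))"
        by (simp add: r_def imul_add algebra_simps)
      thus ?case by blast
    qed
    then obtain X Y where XY: "\<And>n. R n = imul (X n) (P n) + imul (Y n) (Q n)" by metis
    \<comment> \<open>The coordinates are chosen separately at each level; independence makes them
      congruent, so they define 2-adic integers.\<close>
    have cong: "2 ^ n dvd X (Suc n) - X n \<and> 2 ^ n dvd Y (Suc n) - Y n" for n
    proof (rule indep)
      have "imul (X n) (P n) + imul (Y n) (Q n) = imul 2 (R (Suc n))"
        using XY[of n] tate_seq_double[OF R, of n] by (simp add: imul_2)
      also have "\<dots> = imul (2 * X (Suc n)) (P (Suc n)) + imul (2 * Y (Suc n)) (Q (Suc n))"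
        unfolding XY[of "Suc n"] by (simp add: imul_add_right imul_mult)
      also have "\<dots> = imul (X (Suc n)) (P n) + imul (Y (Suc n)) (Q n)"
        unfolding imul_half[OF P] imul_half[OF Q] ..
      finally show "imul (X (Suc n) - X n) (P n) + imul (Y (Suc n) - Y n) (Q n) = 0"
        by (simp add: imul_diff algebra_simps)
    qed
    obtain x where x: "\<And>n. res x n = X n mod 2 ^ n" using z2_of_compatible[of X] cong by blast
    obtain y where y: "\<And>n. res y n = Y n mod 2 ^ n" using z2_of_compatible[of Y] cong by blast
    show "\<exists>!xy. R = lincomb (fst xy) P (snd xy) Q"
    proof (rule ex1I[of _ "(x, y)"])
      show "R = lincomb (fst (x, y)) P (snd (x, y)) Q"
        by (simp add: fun_eq_iff lincomb_def x y imul_mod[OF P] imul_mod[OF Q] XY)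
      fix uv assume uv: "R = lincomb (fst uv) P (snd uv) Q"
      have "2 ^ n dvd res (fst uv) n - X n \<and> 2 ^ n dvd res (snd uv) n - Y n" for n
      proof (rule indep)
        have "imul (X n) (P n) + imul (Y n) (Q n) = imul (res (fst uv) n) (P n) + imul (res (snd uv) n) (Q n)"
          using XY[of n] fun_cong[OF uv, of n] by (simp add: lincomb_def)
        thus "imul (res (fst uv) n - X n) (P n) + imul (res (snd uv) n - Y n) (Q n) = 0"
          by (simp add: imul_diff algebra_simps)
      qed
      hence "res (fst uv) n = res x n \<and> res (snd uv) n = res y n" for n
        unfolding x y by (metis mod_eq_dvd_iff res_mod)
      hence "fst uv = x" "snd uv = y" by (auto intro: z2_eqI)
      thus "uv = (x, y)" by (simp add: prod_eq_iff)
    qed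
  qed
qed

section \<open>Matrices of additive maps and change of basis\<close>

definition mat_col :: "(nat \<Rightarrow> 'a :: ab_group_add) \<Rightarrow> (nat \<Rightarrow> 'a) \<Rightarrow> z2 ^ 2 ^ 2 \<Rightarrow> 2 \<Rightarrow> nat \<Rightarrow> 'a" where
  "mat_col P Q A j = lincomb (A $ 1 $ j) P (A $ 2 $ j) Q"

definition rep_image :: "('a :: ab_group_add \<Rightarrow> 'a) set \<Rightarrow> (nat \<Rightarrow> 'a) \<Rightarrow> (nat \<Rightarrow> 'a) \<Rightarrow> (z2 ^ 2 ^ 2) set" where
  "rep_image \<Gamma> P Q = {M. \<exists>g\<in>\<Gamma>. g \<circ> P = mat_col P Q M 1 \<and> g \<circ> Q = mat_col P Q M 2}"

lemma mat_col_mat_col: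
  assumes "P \<in> tate_seq" "Q \<in> tate_seq"
  shows "mat_col (mat_col P Q B 1) (mat_col P Q B 2) A j = mat_col P Q (B ** A) j"
  unfolding mat_col_def lincomb_lincomb[OF assms] matrix_mult_nth ..

lemma lincomb_1_0:
  assumes "P \<in> tate_seq" "Q \<in> tate_seq"
  shows "lincomb 1 P 0 Q = P" "lincomb 0 P 1 Q = Q"
  using imul_mod[OF assms(1), of 1] imul_mod[OF assms(2), of 1]
  by (simp_all add: fun_eq_iff lincomb_def zero_z2.rep_eq one_z2.rep_eq del: one_mod_2_pow_eq)

lemma mat_col_one:
  assumes "P \<in> tate_seq" "Q \<in> tate_seq"
  shows "mat_col P Q (mat 1) 1 = P" "mat_col P Q (mat 1) 2 = Q"
  using lincomb_1_0[OF assms] by (simp_all add: mat_col_def mat_eq_mat2)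

lemma additive_mat_col: "additive_map g \<Longrightarrow> g \<circ> mat_col P Q A j = mat_col (g \<circ> P) (g \<circ> Q) A j"
  unfolding mat_col_def by (rule additive_lincomb)

lemma mat_col_in_tate_seq: "P \<in> tate_seq \<Longrightarrow> Q \<in> tate_seq \<Longrightarrow> mat_col P Q A j \<in> tate_seq"
  unfolding mat_col_def by (rule lincomb_in_tate_seq)

lemma mat_col_ex:
  assumes "is_tate_basis P Q" "R \<in> tate_seq" "S \<in> tate_seq"
  obtains A where "R = mat_col P Q A 1" "S = mat_col P Q A 2"
proof -
  obtain a c where "R = lincomb a P c Q" using is_tate_basisD(3)[OF assms(1,2)] by blast
  moreover obtain b d where "S = lincomb b P d Q" using is_tate_basisD(3)[OF assms(1,3)] by blast
  ultimately show ?thesis using that[of "mat2 a b c d"] by (simp add: mat_col_def)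
qed

lemma mat_col_inj:
  assumes "is_tate_basis P Q" "mat_col P Q A 1 = mat_col P Q B 1" "mat_col P Q A 2 = mat_col P Q B 2"
  shows "A = B"
  using is_tate_basisD(4)[OF assms(1) assms(2)[unfolded mat_col_def]]
    is_tate_basisD(4)[OF assms(1) assms(3)[unfolded mat_col_def]]
  by (intro mat2_eqI) simp_all

lemma rep_image_change_basis:
  assumes PQ: "is_tate_basis P Q" and P': "P' = mat_col P Q B 1" and Q': "Q' = mat_col P Q B 2"
    and P: "P = mat_col P' Q' B' 1" and Q: "Q = mat_col P' Q' B' 2"
    and g: "\<And>g. g \<in> \<Gamma> \<Longrightarrow> additive_map g" and M: "M \<in> rep_image \<Gamma> P Q"
  shows "B' ** M ** B \<in> rep_image \<Gamma> P' Q'"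
proof -
  note t = is_tate_basisD(1,2)[OF PQ]
  have t': "P' \<in> tate_seq" "Q' \<in> tate_seq" unfolding P' Q' using t by (rule mat_col_in_tate_seq)+
  obtain g where gM: "g \<in> \<Gamma>" "g \<circ> P = mat_col P Q M 1" "g \<circ> Q = mat_col P Q M 2"
    using M by (auto simp: rep_image_def)
  have "g \<circ> mat_col P Q B j = mat_col P' Q' (B' ** M ** B) j" for j
  proof -
    have "g \<circ> mat_col P Q B j = mat_col P Q (M ** B) j"
      unfolding additive_mat_col[OF g[OF gM(1)]] gM(2,3) mat_col_mat_col[OF t] ..
    also have "\<dots> = mat_col (mat_col P' Q' B' 1) (mat_col P' Q' B' 2) (M ** B) j"
      unfolding P[symmetric] Q[symmetric] ..
    also have "\<dots> = mat_col P' Q' (B' ** M ** B) j"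
      unfolding mat_col_mat_col[OF t'] by (simp add: matrix_mul_assoc)
    finally show ?thesis .
  qed
  from this[of 1] this[of 2] show ?thesis
    unfolding rep_image_def P'[symmetric] Q'[symmetric] using gM(1) by blast
qed

lemma rep_image_conj:
  assumes PQ: "is_tate_basis P Q" and PQ': "is_tate_basis P' Q'"
    and g: "\<And>g. g \<in> \<Gamma> \<Longrightarrow> additive_map g"
  shows "(rep_image \<Gamma> P' Q', rep_image \<Gamma> P Q) \<in> conj_rel"
proof -
  note t = is_tate_basisD(1,2)[OF PQ] and t' = is_tate_basisD(1,2)[OF PQ']
  obtain B where B: "P' = mat_col P Q B 1" "Q' = mat_col P Q B 2" using mat_col_ex[OF PQ t'] .
  obtain B' where B': "P = mat_col P' Q' B' 1" "Q = mat_col P' Q' B' 2" using mat_col_ex[OF PQ' t] .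
  have BB': "B ** B' = mat 1"
  proof (rule mat_col_inj[OF PQ])
    show "mat_col P Q (B ** B') 1 = mat_col P Q (mat 1) 1" "mat_col P Q (B ** B') 2 = mat_col P Q (mat 1) 2"
      unfolding mat_col_one[OF t] mat_col_mat_col[OF t, symmetric] B[symmetric] B'[symmetric] by (rule refl)+
  qed
  have B'B: "B' ** B = mat 1"
  proof (rule mat_col_inj[OF PQ'])
    show "mat_col P' Q' (B' ** B) 1 = mat_col P' Q' (mat 1) 1" "mat_col P' Q' (B' ** B) 2 = mat_col P' Q' (mat 1) 2"
      unfolding mat_col_one[OF t'] mat_col_mat_col[OF t', symmetric] B[symmetric] B'[symmetric] by (rule refl)+
  qed
  have "rep_image \<Gamma> P Q = (\<lambda>A. B ** A ** B') ` rep_image \<Gamma> P' Q'"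
  proof (rule equalityI; rule subsetI)
    fix M assume "M \<in> rep_image \<Gamma> P Q"
    hence "B' ** M ** B \<in> rep_image \<Gamma> P' Q'" by (intro rep_image_change_basis[OF PQ B B']) (auto intro: g)
    moreover have "M = B ** (B' ** M ** B) ** B'"
      using BB' by (metis matrix_mul_assoc matrix_mul_lid matrix_mul_rid)
    ultimately show "M \<in> (\<lambda>A. B ** A ** B') ` rep_image \<Gamma> P' Q'" by (rule rev_image_eqI)
  next
    fix M assume "M \<in> (\<lambda>A. B ** A ** B') ` rep_image \<Gamma> P' Q'"
    thus "M \<in> rep_image \<Gamma> P Q" by (auto intro!: rep_image_change_basis[OF PQ' B' B] g)
  qed
  thus ?thesis by (rule conj_relI[OF BB' B'B])
qed

lemma subgroup_rep_image:
  assumes PQ: "is_tate_basis P Q" and add: "\<And>g. g \<in> \<Gamma> \<Longrightarrow> additive_map g"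
    and id: "id \<in> \<Gamma>" and comp: "\<And>g h. g \<in> \<Gamma> \<Longrightarrow> h \<in> \<Gamma> \<Longrightarrow> g \<circ> h \<in> \<Gamma>"
    and inv: "\<And>g. g \<in> \<Gamma> \<Longrightarrow> \<exists>h\<in>\<Gamma>. g \<circ> h = id \<and> h \<circ> g = id"
  shows "subgroup (rep_image \<Gamma> P Q) GL2"
proof -
  note t = is_tate_basisD(1,2)[OF PQ]
  have mult: "g \<circ> h \<circ> P = mat_col P Q (M ** N) 1 \<and> g \<circ> h \<circ> Q = mat_col P Q (M ** N) 2"
    if "g \<in> \<Gamma>" "h \<in> \<Gamma>" "g \<circ> P = mat_col P Q M 1" "g \<circ> Q = mat_col P Q M 2"
      "h \<circ> P = mat_col P Q N 1" "h \<circ> Q = mat_col P Q N 2" for g h M N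
    using that(3-6) additive_mat_col[OF add[OF that(1)]] mat_col_mat_col[OF t]
    by (metis comp_assoc)
  have ex_inv: "\<exists>N\<in>rep_image \<Gamma> P Q. M ** N = mat 1 \<and> N ** M = mat 1" if "M \<in> rep_image \<Gamma> P Q" for M
  proof -
    obtain g where g: "g \<in> \<Gamma>" "g \<circ> P = mat_col P Q M 1" "g \<circ> Q = mat_col P Q M 2"
      using \<open>M \<in> rep_image \<Gamma> P Q\<close> by (auto simp: rep_image_def)
    obtain h where h: "h \<in> \<Gamma>" "g \<circ> h = id" "h \<circ> g = id" using inv[OF g(1)] by blast
    obtain N where N: "h \<circ> P = mat_col P Q N 1" "h \<circ> Q = mat_col P Q N 2"
      using mat_col_ex[OF PQ, of "h \<circ> P" "h \<circ> Q"] additive_tate_seq[OF add[OF h(1)]] t by metis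
    have "M ** N = mat 1"
      using mult[OF g(1) h(1) g(2,3) N] mat_col_one[OF t] h(2) by (intro mat_col_inj[OF PQ]) simp_all
    moreover have "N ** M = mat 1"
      using mult[OF h(1) g(1) N g(2,3)] mat_col_one[OF t] h(3) by (intro mat_col_inj[OF PQ]) simp_all
    moreover have "N \<in> rep_image \<Gamma> P Q" using h(1) N by (auto simp: rep_image_def)
    ultimately show ?thesis by blast
  qed
  show ?thesis
  proof (rule group.subgroupI[OF group_GL2])
    show "rep_image \<Gamma> P Q \<subseteq> carrier GL2"
      using ex_inv by (auto simp: invertible_def) blast
    have "mat 1 \<in> rep_image \<Gamma> P Q"
      unfolding rep_image_def using id mat_col_one[OF t] by (intro CollectI bexI[of _ id]) simp_all
    thus "rep_image \<Gamma> P Q \<noteq> {}" by blast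
  next
    fix M assume "M \<in> rep_image \<Gamma> P Q"
    then obtain N where N: "N \<in> rep_image \<Gamma> P Q" "M ** N = mat 1" "N ** M = mat 1" using ex_inv by blast
    thus "inv\<^bsub>GL2\<^esub> M \<in> rep_image \<Gamma> P Q" using inv_GL2_eq(2)[of M N] by simp
  next
    fix M N assume "M \<in> rep_image \<Gamma> P Q" "N \<in> rep_image \<Gamma> P Q"
    then obtain g h where "g \<in> \<Gamma>" "h \<in> \<Gamma>" "g \<circ> P = mat_col P Q M 1" "g \<circ> Q = mat_col P Q M 2"
      "h \<circ> P = mat_col P Q N 1" "h \<circ> Q = mat_col P Q N 2" by (auto simp: rep_image_def)
    thus "M \<otimes>\<^bsub>GL2\<^esub> N \<in> rep_image \<Gamma> P Q"
      using mult comp unfolding rep_image_def mult_GL2 by blast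
  qed
qed

subsection \<open>The curve \<open>y\<^sup>2 = x\<^sup>3 - 11 x + 14\<close> and its endomorphism \<open>2 i\<close>\<close>

interpretation E1: weierstrass "- 11" 14
  by unfold_locales (simp add: ell_disc_def)

text \<open>The curve with j-invariant 1728, on which \<open>scale_point \<i>\<close> is an
  automorphism.\<close>

interpretation E2: weierstrass "- 16" 0
  by unfold_locales (simp add: ell_disc_def)

text \<open>E^1 scaled by 2: the coefficients are multiplied by 2^4 and 2^6.\<close>

interpretation E3: weierstrass "- 176" 896
  by unfold_locales (simp add: ell_disc_def)

text \<open>The kernel is generated by (2, 0), and t = 3 * 2^2 - 11 = 1.\<close>

interpretation phi: two_isogeny "- 11" 14 "- 16" 0 2 1
  by unfold_locales simp_all

text \<open>The kernel point (-4, 0) is the image of the other two points of order 2 of E^1. Hence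
  this isogeny is dual to the first one up to scaling; t = 3 * 4^2 - 16 = 32.\<close>

interpretation psi: two_isogeny "- 16" 0 "- 176" 896 "- 4" 32
  by unfold_locales simp_all

text \<open>The factor 1 / 2 leads from the scaled curve back to E^1.\<close>

definition psi2 :: "complex point \<Rightarrow> complex point" where
  "psi2 P = scale_point (1 / 2) (velu (- 4) 32 P)"

definition eta :: "complex point \<Rightarrow> complex point" where
  "eta P = psi2 (scale_point \<i> (velu 2 1 P))"

lemma psi2_in_curve: "P \<in> E2.curve \<Longrightarrow> psi2 P \<in> E1.curve"
  using scale_point_curve[of "- 176" 896 "1 / 2" "velu (- 4) 32 P"] psi.velu_in_curve[of P]
    E1.weierstrass_axioms E3.weierstrass_axioms
  by (simp add: psi2_def power_one_over)

lemma psi2_add: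
  assumes "P \<in> E2.curve" "Q \<in> E2.curve"
  shows "psi2 (ell_add (- 16) P Q) = ell_add (- 11) (psi2 P) (psi2 Q)"
  using scale_point_add[of "1 / 2" "- 176 :: complex" "velu (- 4) 32 P" "velu (- 4) 32 Q"] psi.velu_add[OF assms]
  by (simp add: psi2_def power_one_over)

lemma psi2_neg: "psi2 (ell_neg P) = ell_neg (psi2 P)"
  by (simp add: psi2_def velu_neg scale_point_neg)

lemma scale_i_in_curve: "P \<in> E2.curve \<Longrightarrow> scale_point \<i> P \<in> E2.curve"
  using scale_point_curve[of "- 16" 0 \<i> P] E2.weierstrass_axioms by simp

lemma scale_i_add: "scale_point \<i> (ell_add (- 16) P Q) = ell_add (- 16) (scale_point \<i> P) (scale_point \<i> Q)"
  using scale_point_add[of \<i> "- 16" P Q] by simp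

lemma scale_i_i: "scale_point \<i> (scale_point \<i> P) = ell_neg P"
  by (simp add: scale_point_compose scale_point_uminus)

lemma eta_in_curve: "P \<in> E1.curve \<Longrightarrow> eta P \<in> E1.curve"
  unfolding eta_def by (intro psi2_in_curve scale_i_in_curve phi.velu_in_curve)

lemma eta_add: "P \<in> E1.curve \<Longrightarrow> Q \<in> E1.curve \<Longrightarrow> eta (ell_add (- 11) P Q) = ell_add (- 11) (eta P) (eta Q)"
  unfolding eta_def by (simp add: phi.velu_add scale_i_add psi2_add scale_i_in_curve phi.velu_in_curve)

text \<open>This makes \<open>psi2\<close> the dual isogeny. With u = x - 2 the curve is y^2 = u
  (u^2 + 6 u + 1), which keeps both sides rational in u and y.\<close>

lemma psi2_phi:
  assumes P: "P \<in> E1.curve"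
  shows "psi2 (velu 2 1 P) = ell_add (- 11) P P"
proof (cases P)
  case (Affine x y)
  have c: "y\<^sup>2 = x ^ 3 - 11 * x + 14" using P Affine by simp
  show ?thesis
  proof (cases "x = 2 \<or> y = 0")
    case True
    have "psi2 (velu 2 1 P) = Infinity"
    proof (cases "x = 2")
      case True
      thus ?thesis using Affine by (simp add: psi2_def)
    next
      case False
      hence "y = 0" using True by blast
      hence "x ^ 3 - 11 * x + 14 = 0" using c by simp
      \<comment> \<open>The quadratic factor says that x + 1 / (x - 2) is -4, the kernel abscissa of
        the second isogeny.\<close>
      hence "(x - 2) * (x\<^sup>2 + 2 * x - 7) = 0" by algebra
      hence "x\<^sup>2 + 2 * x - 7 = 0" using False by simp
      hence "(x - 2) * (x + 4) + 1 = 0" by algebra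
      hence "(x + 4) * (x - 2) + 1 = 0" by (simp only: mult.commute)
      hence "x + 1 / (x - 2) = - 4" using False by (simp add: field_simps)
      thus ?thesis using Affine False by (simp add: psi2_def)
    qed
    moreover have "y = - y" using True c by auto
    hence "ell_add (- 11) P P = Infinity" using Affine by simp
    ultimately show ?thesis by (simp only:)
  next
    case False
    define u where "u = x - 2"
    define v where "v = 1 / u"
    define w where "w = 1 / y"
    have x: "x = u + 2" by (simp add: u_def)
    have uv: "u * v = 1" and yw: "y * w = 1" using False by (simp_all add: u_def v_def w_def)
    have c': "y\<^sup>2 = u * (u\<^sup>2 + 6 * u + 1)" using c unfolding x by algebra
    define l where "l = (3 * x\<^sup>2 - 11) / (2 * y)"
    have l: "l = (3 * u\<^sup>2 + 12 * u + 1) * w / 2"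
    proof -
      have "3 * x\<^sup>2 - 11 = 3 * u\<^sup>2 + 12 * u + 1" unfolding x by algebra
      thus ?thesis by (simp add: l_def w_def mult.commute)
    qed
    have "y \<noteq> - y" using False complex_eq_neg_imp_0 by blast
    hence rhs: "ell_add (- 11) P P = Affine (l\<^sup>2 - x - x) (l * (x - (l\<^sup>2 - x - x)) - y)"
      by (simp add: Affine Let_def l_def)
    \<comment> \<open>The image abscissa plus 4 is y^2 / u^2, so the denominators of the second
      isogeny turn into powers of u / y.\<close>
    have X4: "x + v + 4 = y\<^sup>2 * v\<^sup>2" using uv c' unfolding x by algebra
    have "y\<^sup>2 * v\<^sup>2 \<noteq> 0" using uv yw by auto
    hence ne: "x + v \<noteq> - 4" using X4 by (metis add.left_inverse)
    have vu: "1 / (y\<^sup>2 * v\<^sup>2) = u\<^sup>2 * w\<^sup>2"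
      using False by (simp add: v_def w_def u_def power_one_over)
    have velu1: "velu 2 1 P = Affine (x + v) (y * (1 - v\<^sup>2))"
      using False by (simp add: Affine v_def u_def power_one_over)
    have "32 / (x + v - - 4) = 32 * (u\<^sup>2 * w\<^sup>2)" "32 / (x + v - - 4)\<^sup>2 = 32 * (u\<^sup>2 * w\<^sup>2)\<^sup>2"
      unfolding diff_minus_eq_add X4 using vu by (simp_all add: power_one_over flip: vu)
    hence "psi2 (velu 2 1 P) = Affine ((x + v + 32 * (u\<^sup>2 * w\<^sup>2)) / 4)
        (y * (1 - v\<^sup>2) * (1 - 32 * (u\<^sup>2 * w\<^sup>2)\<^sup>2) / 8)"
      unfolding velu1 psi2_def using ne by (simp add: power_one_over)
    moreover have x3: "(x + v + 32 * (u\<^sup>2 * w\<^sup>2)) / 4 = l\<^sup>2 - x - x"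
    proof -
      have "x + v + 32 * (u\<^sup>2 * w\<^sup>2) = (3 * u\<^sup>2 + 12 * u + 1)\<^sup>2 * w\<^sup>2 - 8 * x"
        using uv yw c' unfolding x by algebra
      moreover have "4 * (l\<^sup>2 - x - x) = (2 * l)\<^sup>2 - 8 * x" by algebra
      moreover have "2 * l = (3 * u\<^sup>2 + 12 * u + 1) * w" by (simp add: l)
      ultimately have "x + v + 32 * (u\<^sup>2 * w\<^sup>2) = 4 * (l\<^sup>2 - x - x)" by (simp only: power_mult_distrib)
      thus ?thesis by simp
    qed
    moreover have "y * (1 - v\<^sup>2) * (1 - 32 * (u\<^sup>2 * w\<^sup>2)\<^sup>2) / 8 = l * (x - (l\<^sup>2 - x - x)) - y"
    proof -
      define Z where "Z = l * (x - (l\<^sup>2 - x - x)) - y"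
      have l2: "2 * l = (3 * u\<^sup>2 + 12 * u + 1) * w" by (simp add: l)
      have "4 * (l\<^sup>2 - x - x) = x + v + 32 * (u\<^sup>2 * w\<^sup>2)" using x3 by simp
      hence "8 * Z = 2 * l * (4 * x - (x + v + 32 * (u\<^sup>2 * w\<^sup>2))) - 8 * y"
        unfolding Z_def by algebra
      also have "\<dots> = (3 * u\<^sup>2 + 12 * u + 1) * w * (4 * x - (x + v + 32 * (u\<^sup>2 * w\<^sup>2))) - 8 * y"
        unfolding l2 ..
      also have "\<dots> = y * (1 - v\<^sup>2) * (1 - 32 * (u\<^sup>2 * w\<^sup>2)\<^sup>2)"
        using uv yw c' unfolding x by algebra
      finally have "8 * Z = y * (1 - v\<^sup>2) * (1 - 32 * (u\<^sup>2 * w\<^sup>2)\<^sup>2)" .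
      hence "y * (1 - v\<^sup>2) * (1 - 32 * (u\<^sup>2 * w\<^sup>2)\<^sup>2) / 8 = 8 * Z / 8" by (simp only:)
      also have "\<dots> = Z" by simp
      finally show ?thesis unfolding Z_def .
    qed
    ultimately show ?thesis unfolding rhs by (simp only:)
  qed
qed (simp add: psi2_def)

text \<open>The first isogeny is surjective and additive, so this order of composition follows from
  \<open>psi2_phi\<close> without another computation.\<close>

lemma phi_psi2:
  assumes "R \<in> E2.curve"
  shows "velu 2 1 (psi2 R) = ell_add (- 16) R R"
proof -
  obtain P where P: "P \<in> E1.curve" "velu 2 1 P = R" using phi.velu_surj[OF assms] by blast
  have "velu 2 1 (psi2 R) = velu 2 1 (ell_add (- 11) P P)" using psi2_phi[OF P(1)] P(2) by simp
  thus ?thesis using phi.velu_add[OF P(1) P(1)] P(2) by simp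
qed

text \<open>The inner composition of the isogenies is doubling, which commutes with
  \<open>scale_point \<i>\<close>. The two factors i give -1, and the outer composition doubles once
  more.\<close>

lemma eta_eta:
  assumes P: "P \<in> E1.curve"
  shows "eta (eta P) = ell_neg (ell_add (- 11) (ell_add (- 11) P P) (ell_add (- 11) P P))"
proof -
  define R where "R = velu 2 1 P"
  have R: "R \<in> E2.curve" "scale_point \<i> R \<in> E2.curve"
    using phi.velu_in_curve[OF P] scale_i_in_curve by (simp_all add: R_def)
  have "eta (eta P) = psi2 (scale_point \<i> (ell_add (- 16) (scale_point \<i> R) (scale_point \<i> R)))"
    unfolding eta_def R_def[symmetric] phi_psi2[OF R(2)] ..
  also have "\<dots> = psi2 (ell_add (- 16) (ell_neg R) (ell_neg R))"
    by (simp add: scale_i_add scale_i_i)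
  also have "\<dots> = ell_add (- 11) (ell_neg (psi2 R)) (ell_neg (psi2 R))"
    using R by (simp add: psi2_add psi2_neg)
  also have "\<dots> = ell_neg (ell_add (- 11) (psi2 R) (psi2 R))" by (simp add: E1.neg_add)
  finally show ?thesis unfolding R_def psi2_phi[OF P] .
qed

text \<open>Outside the kernel of the first isogeny, the image must have abscissa 4, which the
  factor i turns into -4. The equation x + 1 / (x - 2) = 4 has the double root 3.\<close>

lemma eta_eq_Infinity:
  assumes P: "Affine x y \<in> E1.curve" and eta: "eta (Affine x y) = Infinity"
  shows "x = 2 \<or> x = 3"
proof (rule ccontr)
  assume ne: "\<not> ?thesis"
  have sc: "scale_point u Q = Infinity \<longleftrightarrow> Q = Infinity" for u :: complex and Q
    by (cases Q) auto
  have "- (x + 1 / (x - 2)) = - 4"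
    using eta ne by (auto simp: eta_def psi2_def sc split: if_splits)
  hence "x + 1 / (x - 2) = 4" by (metis neg_equal_iff_equal)
  hence "(x + 1 / (x - 2)) * (x - 2) = 4 * (x - 2)" by (rule arg_cong)
  hence "x * (x - 2) + 1 = 4 * (x - 2)" using ne by (simp add: distrib_right)
  hence "(x - 3)\<^sup>2 = 0" by algebra
  thus False using ne by simp
qed

lemma set_point_ell_add:
  assumes "a \<in> Qbar" "set_point P \<subseteq> Qbar" "set_point Q \<subseteq> Qbar"
  shows "set_point (ell_add a P Q) \<subseteq> Qbar"
proof (cases "P = Infinity \<or> Q = Infinity")
  case False
  then obtain x1 y1 x2 y2 where "P = Affine x1 y1" "Q = Affine x2 y2" by (cases P; cases Q) auto
  thus ?thesis using assms by (simp add: Let_def)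
qed (use assms in auto)

lemma set_point_ell_neg: "set_point P \<subseteq> Qbar \<Longrightarrow> set_point (ell_neg P) \<subseteq> Qbar"
  by (cases P) auto

lemma set_point_scale: "u \<in> Qbar \<Longrightarrow> set_point P \<subseteq> Qbar \<Longrightarrow> set_point (scale_point u P) \<subseteq> Qbar"
  by (cases P) auto

lemma set_point_velu: "e \<in> Qbar \<Longrightarrow> t \<in> Qbar \<Longrightarrow> set_point P \<subseteq> Qbar \<Longrightarrow> set_point (velu e t P) \<subseteq> Qbar"
  by (cases P) auto

lemma set_point_eta: "set_point P \<subseteq> Qbar \<Longrightarrow> set_point (eta P) \<subseteq> Qbar"
  unfolding eta_def psi2_def by (intro set_point_scale set_point_velu) auto

subsection \<open>The group of algebraic points\<close>

lemma ell_points_iff: "P \<in> ell_points (- 11) 14 \<longleftrightarrow> P \<in> E1.curve \<and> set_point P \<subseteq> Qbar"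
  by (cases P) (auto simp: ell_points_def of_rat_minus)

text \<open>As a type, the algebraic points become an instance of \<open>ab_group_add\<close>, to
  which the abstract Tate modules apply.\<close>

typedef ept = "ell_points (- 11) 14"
  by (rule exI[of _ Infinity]) (simp add: ell_points_def)

setup_lifting type_definition_ept

lemma Rep_in_curve [simp]: "Rep_ept p \<in> E1.curve" and set_point_Rep [simp]: "set_point (Rep_ept p) \<subseteq> Qbar"
  using Rep_ept[of p] by (simp_all add: ell_points_iff)

instantiation ept :: ab_group_add
begin

lift_definition zero_ept :: ept is Infinity by (simp add: ell_points_iff)

lift_definition plus_ept :: "ept \<Rightarrow> ept \<Rightarrow> ept" is "ell_add (- 11)"
  by (simp add: ell_points_iff set_point_ell_add)

lift_definition uminus_ept :: "ept \<Rightarrow> ept" is ell_neg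
  by (simp add: ell_points_iff set_point_ell_neg)

definition minus_ept :: "ept \<Rightarrow> ept \<Rightarrow> ept" where "minus_ept p q = p + - q"

instance
proof
  fix p q r :: ept
  show "p + q + r = p + (q + r)" by transfer (simp add: ell_points_iff E1.add_assoc)
  show "p + q = q + p" by transfer (simp add: ell_points_iff E1.add_commute)
  show "0 + p = p" by transfer simp
  show "- p + p = 0" by transfer simp
  show "p - q = p + - q" by (rule minus_ept_def)
qed

end

lift_definition eta_ept :: "ept \<Rightarrow> ept" is eta
  by (simp add: ell_points_iff eta_in_curve set_point_eta)

lemma additive_eta: "additive_map eta_ept"
  unfolding additive_map_def by transfer (simp add: ell_points_iff eta_add)

lemma eta_ept_eta_ept: "eta_ept (eta_ept p) = - (p + p + (p + p))"
  by transfer (simp add: ell_points_iff eta_eta)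

text \<open>Doubling is a composition of two isogenies, each surjective on algebraic points.\<close>

lemma ept_double_surj: "\<exists>q :: ept. q + q = p"
proof -
  \<comment> \<open>The factor 2 undoes the factor 1 / 2 in \<open>psi2\<close>.\<close>
  define R where "R = scale_point 2 (Rep_ept p)"
  have "R \<in> E3.curve"
    using scale_point_curve[of "- 11" 14 2 "Rep_ept p"] E1.weierstrass_axioms E3.weierstrass_axioms
    by (simp add: R_def)
  moreover have "set_point R \<subseteq> Qbar" by (simp add: R_def set_point_scale)
  ultimately obtain S where S: "S \<in> E2.curve" "velu (- 4) 32 S = R" "set_point S \<subseteq> Qbar"
    using psi.velu_surj[of R] by auto
  then obtain P where P: "P \<in> E1.curve" "velu 2 1 P = S" "set_point P \<subseteq> Qbar"
    using phi.velu_surj[of S] by auto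
  have "ell_add (- 11) P P = psi2 S" using psi2_phi[OF P(1)] P(2) by simp
  also have "\<dots> = Rep_ept p" by (simp add: psi2_def S(2) R_def scale_point_compose)
  finally have "ell_add (- 11) P P = Rep_ept p" .
  moreover have "P \<in> ell_points (- 11) 14" using P by (simp add: ell_points_iff)
  ultimately have "Abs_ept P + Abs_ept P = p"
    by (metis Abs_ept_inverse Rep_ept_inject plus_ept.rep_eq)
  thus ?thesis by blast
qed

section \<open>Points of order 2 and 4\<close>

definition sqrt2 :: complex where "sqrt2 = csqrt 2"

lemma sqrt2_square [simp]: "sqrt2\<^sup>2 = 2" and sqrt2_Qbar [simp]: "sqrt2 \<in> Qbar"
  using power2_csqrt[of 2] Qbar_csqrt[of 2] by (simp_all only: sqrt2_def Qbar_numeral)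

definition ept_of :: "complex \<Rightarrow> complex \<Rightarrow> ept" where "ept_of x y = Abs_ept (Affine x y)"

lemma Rep_ept_of: "y\<^sup>2 = x ^ 3 - 11 * x + 14 \<Longrightarrow> x \<in> Qbar \<Longrightarrow> y \<in> Qbar \<Longrightarrow> Rep_ept (ept_of x y) = Affine x y"
  unfolding ept_of_def by (rule Abs_ept_inverse) (simp add: ell_points_iff)

definition K1 :: ept where "K1 = ept_of 2 0"
text \<open>The two points of order 2 other than \<open>K1\<close> have the roots of x^2 + 2 x - 7
  as abscissas, so the Galois action on them shows the action on sqrt 2.\<close>

definition Q1 :: ept where "Q1 = ept_of (- 1 + 2 * sqrt2) 0"

lemma Rep_K1: "Rep_ept K1 = Affine 2 0"
  unfolding K1_def by (rule Rep_ept_of) simp_all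

lemma Rep_Q1: "Rep_ept Q1 = Affine (- 1 + 2 * sqrt2) 0"
proof -
  have "(- 1 + 2 * s) ^ 3 - 11 * (- 1 + 2 * s) + 14 = (s\<^sup>2 - 2) * (8 * s - 12)" for s :: complex
    by algebra
  hence "(- 1 + 2 * sqrt2) ^ 3 - 11 * (- 1 + 2 * sqrt2) + 14 = 0" by simp
  thus ?thesis unfolding Q1_def by (intro Rep_ept_of) simp_all
qed

lemma ept_double_eq_0:
  fixes p :: ept
  assumes "p + p = 0"
  shows "p = 0 \<or> (\<exists>x. Rep_ept p = Affine x 0 \<and> (x = 2 \<or> x = - 1 + 2 * sqrt2 \<or> x = - 1 - 2 * sqrt2))"
proof (cases "Rep_ept p")
  case Infinity
  thus ?thesis by (metis Rep_ept_inject zero_ept.rep_eq)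
next
  case (Affine x y)
  have "p = - p" using assms by (simp add: eq_neg_iff_add_eq_0)
  hence "Rep_ept p = ell_neg (Rep_ept p)" by (metis uminus_ept.rep_eq)
  hence y: "y = 0" using Affine complex_eq_neg_imp_0 by simp
  have "y\<^sup>2 = x ^ 3 + - 11 * x + 14" using Rep_in_curve[of p] Affine by simp
  hence "(x - 2) * ((x - (- 1 + 2 * sqrt2)) * (x - (- 1 - 2 * sqrt2))) = 0"
    using sqrt2_square y by algebra
  thus ?thesis using Affine y by auto
qed

lemma sqrt2_not_rat: "sqrt2 \<noteq> of_rat q"
proof
  assume "sqrt2 = of_rat q"
  hence "of_rat (q\<^sup>2) = (of_rat 2 :: complex)" by (metis of_rat_numeral_eq of_rat_power sqrt2_square)
  hence q: "q\<^sup>2 = 2" by (simp only: of_rat_eq_iff)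
  obtain m n where mn: "q = of_int m / of_int n" "n > 0" "coprime m n"
    by (metis quotient_of_div quotient_of_denom_pos quotient_of_coprime surj_pair)
  hence "of_int m = q * of_int n" by simp
  hence "of_int (m\<^sup>2) = (of_int (2 * n\<^sup>2) :: rat)" using q by (simp add: power_mult_distrib)
  hence e: "m\<^sup>2 = 2 * n\<^sup>2" by (simp only: of_int_eq_iff)
  hence "even (m\<^sup>2)" by simp
  hence "even m" by simp
  then obtain k where "m = 2 * k" by (auto elim: evenE)
  hence "n\<^sup>2 = 2 * k\<^sup>2" using e by (simp add: power_mult_distrib)
  hence "even (n\<^sup>2)" by simp
  hence "even n" by simp
  thus False using \<open>even m\<close> mn(3) by (metis coprime_common_divisor odd_one)
qed

lemma Q1_x_ne: "- 1 + 2 * sqrt2 \<noteq> 2" "- 1 + 2 * sqrt2 \<noteq> 3" "sqrt2 \<noteq> 0"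
proof -
  show "- 1 + 2 * sqrt2 \<noteq> 2"
  proof
    assume "- 1 + 2 * sqrt2 = 2"
    hence "sqrt2 = of_rat (3 / 2)" by (simp add: of_rat_divide field_simps add_eq_0_iff2)
    thus False using sqrt2_not_rat by blast
  qed
  show "- 1 + 2 * sqrt2 \<noteq> 3"
  proof
    assume "- 1 + 2 * sqrt2 = 3"
    hence "sqrt2 = of_rat 2" by (simp add: field_simps)
    thus False using sqrt2_not_rat by blast
  qed
  show "sqrt2 \<noteq> 0" using sqrt2_not_rat[of 0] by simp
qed

lemma K1_Q1: "K1 + K1 = 0" "Q1 + Q1 = 0" "K1 \<noteq> 0" "Q1 \<noteq> 0" "K1 \<noteq> Q1"
proof -
  have "Rep_ept (K1 + K1) = Rep_ept 0" "Rep_ept (Q1 + Q1) = Rep_ept 0"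
    by (simp_all add: plus_ept.rep_eq zero_ept.rep_eq Rep_K1 Rep_Q1)
  thus "K1 + K1 = 0" "Q1 + Q1 = 0" by (simp_all only: Rep_ept_inject)
  show "K1 \<noteq> 0" "Q1 \<noteq> 0" using Rep_K1 Rep_Q1 zero_ept.rep_eq by auto
  show "K1 \<noteq> Q1" using Rep_K1 Rep_Q1 Q1_x_ne(1) by auto
qed

lemma ept_two_torsion:
  assumes "p + p = (0 :: ept)"
  shows "p \<in> {0, K1, Q1, K1 + Q1}"
proof -
  have cases: "p \<in> {0, K1, Q1} \<or> Rep_ept p = Affine (- 1 - 2 * sqrt2) 0" if "p + p = 0" for p
    using ept_double_eq_0[OF that] Rep_K1 Rep_Q1 by (metis Rep_ept_inject insertCI)
  have sum: "(K1 + Q1) + (K1 + Q1) = 0" using K1_Q1(1,2) by (metis add.left_commute add.right_neutral add.assoc)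
  have "K1 + Q1 \<noteq> 0" using K1_Q1 by (metis add.left_cancel)
  hence "K1 + Q1 \<notin> {0, K1, Q1}" using K1_Q1 by auto
  \<comment> \<open>The sum is identified by elimination, as the only point of order 2 left.\<close>
  hence "Rep_ept (K1 + Q1) = Affine (- 1 - 2 * sqrt2) 0" using cases[OF sum] by blast
  thus ?thesis using cases[OF assms] Rep_ept_inject[of p "K1 + Q1"] by auto
qed

lemma eta_ept_eq_0:
  assumes "eta_ept p = 0"
  shows "p = 0 \<or> p = K1 \<or> (\<exists>y. Rep_ept p = Affine 3 y \<and> y\<^sup>2 = 8)"
proof (cases "Rep_ept p")
  case Infinity
  thus ?thesis by (metis Rep_ept_inject zero_ept.rep_eq)
next
  case (Affine x y)
  have c: "Affine x y \<in> E1.curve" using Rep_in_curve[of p] Affine by simp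
  have "eta (Affine x y) = Infinity" using assms Affine by (metis eta_ept.rep_eq zero_ept.rep_eq)
  hence x: "x = 2 \<or> x = 3" using eta_eq_Infinity[OF c] by blast
  have y: "y\<^sup>2 = x ^ 3 + - 11 * x + 14" using c by simp
  show ?thesis
  proof (cases "x = 2")
    case True
    hence "y = 0" using y by simp
    thus ?thesis using Affine True Rep_K1 by (metis Rep_ept_inject)
  next
    case False
    thus ?thesis using x y Affine by simp
  qed
qed

lemma tate_seq_ex: "\<exists>Q \<in> tate_seq. Q 1 = Q1"
proof -
  obtain half :: "ept \<Rightarrow> ept" where half: "\<And>p. half p + half p = p" using ept_double_surj by metis
  define Q where "Q n = (case n of 0 \<Rightarrow> 0 | Suc n \<Rightarrow> (half ^^ n) Q1)" for n
  have "Q (Suc n) + Q (Suc n) = Q n" for n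
    by (cases n) (simp_all add: Q_def half K1_Q1)
  hence "Q \<in> tate_seq" by (simp add: tate_seq_def Q_def)
  moreover have "Q 1 = Q1" by (simp add: Q_def)
  ultimately show ?thesis by blast
qed

lemma eta_eta_tate:
  assumes "Q \<in> tate_seq"
  shows "eta_ept (eta_ept (Q (Suc (Suc n)))) = - Q n"
  using tate_seq_double[OF assms] by (simp add: eta_ept_eta_ept)

text \<open>The image of \<open>Q1\<close> has order 2 and is killed by \<open>eta_ept\<close>,
  whose square is -4, so it can only be \<open>K1\<close>. One level up, the image of
  \<open>Q 2\<close> is killed as well but is not of order 2, which leaves abscissa 3.\<close>

lemma eta_basis:
  assumes Q: "Q \<in> tate_seq" "Q 1 = Q1"
  shows "is_tate_basis (eta_ept \<circ> Q) Q" "eta_ept (Q 1) = K1" "\<exists>y. Rep_ept (eta_ept (Q 2)) = Affine 3 y \<and> y\<^sup>2 = 8"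
proof -
  have P: "eta_ept \<circ> Q \<in> tate_seq" by (rule additive_tate_seq[OF additive_eta Q(1)])
  have 2: "eta_ept Q1 + eta_ept Q1 = 0"
    using K1_Q1(2) additive_mapD(1,2)[OF additive_eta] by metis
  have "eta_ept Q1 \<noteq> 0"
    using eta_ept_eq_0[of Q1] K1_Q1 Rep_Q1 Q1_x_ne by auto
  moreover have "eta_ept (eta_ept Q1) = 0"
    using eta_ept_eta_ept[of Q1] K1_Q1(2) by simp
  ultimately have "eta_ept Q1 = K1"
    using eta_ept_eq_0[of "eta_ept Q1"] ept_double_eq_0[OF 2] by auto
  thus 1: "eta_ept (Q 1) = K1" using Q by simp
  show "is_tate_basis (eta_ept \<circ> Q) Q"
    by (rule is_tate_basisI[OF P Q(1)]) (use 1 Q K1_Q1 ept_two_torsion in auto)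
  have "eta_ept (eta_ept (Q 2)) = 0"
    using eta_eta_tate[OF Q(1), of 0] tate_seq_0[OF Q(1)] by (simp add: numeral_2_eq_2)
  moreover have "eta_ept (Q 2) + eta_ept (Q 2) = K1"
    using tate_seq_double[OF P, of 1] 1 by (simp add: numeral_2_eq_2)
  hence "eta_ept (Q 2) \<noteq> 0" "eta_ept (Q 2) \<noteq> K1" using K1_Q1 by auto
  ultimately show "\<exists>y. Rep_ept (eta_ept (Q 2)) = Affine 3 y \<and> y\<^sup>2 = 8"
    using eta_ept_eq_0[of "eta_ept (Q 2)"] by blast
qed

subsection \<open>The Galois action\<close>

locale galois =
  fixes \<sigma> assumes \<sigma>: "\<sigma> \<in> abs_Gal"
begin

lemma add: "x \<in> Qbar \<Longrightarrow> y \<in> Qbar \<Longrightarrow> \<sigma> (x + y) = \<sigma> x + \<sigma> y"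
  and mult: "x \<in> Qbar \<Longrightarrow> y \<in> Qbar \<Longrightarrow> \<sigma> (x * y) = \<sigma> x * \<sigma> y"
  and rat: "q \<in> \<rat> \<Longrightarrow> \<sigma> q = q"
  using \<sigma> by (simp_all add: abs_Gal_def)

lemma in_Qbar [simp]: "x \<in> Qbar \<Longrightarrow> \<sigma> x \<in> Qbar"
  and inj: "x \<in> Qbar \<Longrightarrow> y \<in> Qbar \<Longrightarrow> \<sigma> x = \<sigma> y \<longleftrightarrow> x = y"
  using \<sigma> by (auto simp: abs_Gal_def bij_betw_def inj_on_def)

lemma zero [simp]: "\<sigma> 0 = 0" and one [simp]: "\<sigma> 1 = 1" and num [simp]: "\<sigma> (numeral n) = numeral n"
  and of_int [simp]: "\<sigma> (of_int k) = of_int k"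
  by (rule rat; simp)+

lemma uminus: "x \<in> Qbar \<Longrightarrow> \<sigma> (- x) = - \<sigma> x"
  using add[of x "- x"] by (simp add: eq_neg_iff_add_eq_0 add.commute)

lemma diff: "x \<in> Qbar \<Longrightarrow> y \<in> Qbar \<Longrightarrow> \<sigma> (x - y) = \<sigma> x - \<sigma> y"
  using add[of x "- y"] by (simp add: uminus)

lemma divide:
  assumes "x \<in> Qbar" "y \<in> Qbar"
  shows "\<sigma> (x / y) = \<sigma> x / \<sigma> y"
proof (cases "y = 0")
  case False
  have "\<sigma> y \<noteq> 0" using inj[OF assms(2), of 0] False by simp
  moreover have "\<sigma> (x / y) * \<sigma> y = \<sigma> x"
    using mult[of "x / y" y] assms False by simp
  ultimately show ?thesis by (simp add: field_simps)
qed simp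

lemma power: "x \<in> Qbar \<Longrightarrow> \<sigma> (x ^ n) = \<sigma> x ^ n"
  by (induction n) (simp_all add: mult)

lemma square_root:
  assumes "x \<in> Qbar" "x\<^sup>2 \<in> \<rat>"
  shows "\<sigma> x = x \<or> \<sigma> x = - x"
proof -
  have "(\<sigma> x)\<^sup>2 = x\<^sup>2" using power[OF assms(1), of 2] rat[OF assms(2)] by simp
  thus ?thesis by (simp only: power2_eq_iff)
qed

lemma half [simp]: "\<sigma> (1 / 2) = 1 / 2"
  by (rule rat) simp

lemma map_add:
  assumes a: "a \<in> \<rat>" and P: "set_point P \<subseteq> Qbar" and Q: "set_point Q \<subseteq> Qbar"
  shows "map_point \<sigma> (ell_add a P Q) = ell_add a (map_point \<sigma> P) (map_point \<sigma> Q)"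
proof (cases "P = Infinity \<or> Q = Infinity")
  case False
  then obtain x1 y1 x2 y2 where PQ: "P = Affine x1 y1" "Q = Affine x2 y2" by (cases P; cases Q) auto
  have c: "x1 \<in> Qbar" "y1 \<in> Qbar" "x2 \<in> Qbar" "y2 \<in> Qbar" using P Q by (simp_all add: PQ)
  have aQ: "a \<in> Qbar" using a by (auto elim: Rats_cases)
  define l where "l = (if x1 = x2 then (3 * x1\<^sup>2 + a) / (2 * y1) else (y2 - y1) / (x2 - x1))"
  have l: "l \<in> Qbar" using c aQ by (simp add: l_def)
  have \<sigma>l: "\<sigma> l = (if \<sigma> x1 = \<sigma> x2 then (3 * (\<sigma> x1)\<^sup>2 + a) / (2 * \<sigma> y1) else (\<sigma> y2 - \<sigma> y1) / (\<sigma> x2 - \<sigma> x1))"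
    using c aQ rat[OF a] by (simp add: l_def inj divide add mult power diff)
  have cond: "\<sigma> x1 = \<sigma> x2 \<and> \<sigma> y1 = - \<sigma> y2 \<longleftrightarrow> x1 = x2 \<and> y1 = - y2"
    using c inj[of x1 x2] inj[of y1 "- y2"] by (simp add: uminus)
  show ?thesis
    unfolding PQ point.map ell_add.simps Let_def l_def[symmetric] \<sigma>l[symmetric] cond
    using c l
    by (simp only: if_distrib[of "map_point \<sigma>"] point.map diff mult power Qbar_diff Qbar_mult Qbar_power)
qed auto

lemma map_scale:
  "u \<in> Qbar \<Longrightarrow> set_point P \<subseteq> Qbar \<Longrightarrow> map_point \<sigma> (scale_point u P) = scale_point (\<sigma> u) (map_point \<sigma> P)"
  by (cases P) (simp_all add: mult power)

lemma map_velu: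
  assumes "e \<in> \<rat>" "t \<in> \<rat>" "set_point P \<subseteq> Qbar"
  shows "map_point \<sigma> (velu e t P) = velu e t (map_point \<sigma> P)"
proof (cases P)
  case (Affine x y)
  have et: "e \<in> Qbar" "t \<in> Qbar" using assms by (auto elim: Rats_cases)
  have "\<sigma> x = e \<longleftrightarrow> x = e" using inj[of x e] rat[OF assms(1)] et assms Affine by simp
  thus ?thesis
    using assms(3) et rat[OF assms(1)] rat[OF assms(2)] unfolding Affine
    by (simp add: add mult diff divide power)
qed simp

lemma set_point_map: "set_point P \<subseteq> Qbar \<Longrightarrow> set_point (map_point \<sigma> P) \<subseteq> Qbar"
  by (cases P) auto

text \<open>The only irrational constant in \<open>eta\<close> is i, and scaling by -i differs from
  scaling by i by a negation.\<close>

lemma map_eta: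
  assumes "set_point P \<subseteq> Qbar"
  shows "map_point \<sigma> (eta P) = (if \<sigma> \<i> = \<i> then eta (map_point \<sigma> P) else ell_neg (eta (map_point \<sigma> P)))"
proof -
  have "\<sigma> \<i> = \<i> \<or> \<sigma> \<i> = - \<i>" by (rule square_root) simp_all
  thus ?thesis
    using assms unfolding eta_def psi2_def
    by (auto simp: map_scale map_velu set_point_scale set_point_velu scale_point_uminus velu_neg scale_point_neg)
qed

lemma map_in_curve:
  assumes "set_point P \<subseteq> Qbar" "P \<in> E1.curve"
  shows "map_point \<sigma> P \<in> E1.curve"
proof (cases P)
  case (Affine x y)
  have "\<sigma> (y\<^sup>2) = \<sigma> (x ^ 3 - 11 * x + 14)" using assms Affine by simp
  thus ?thesis using assms(1) Affine by (simp add: add mult diff power)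
qed simp

definition act :: "ept \<Rightarrow> ept" where
  "act p = Abs_ept (map_point \<sigma> (Rep_ept p))"

lemma Rep_act: "Rep_ept (act p) = map_point \<sigma> (Rep_ept p)"
  unfolding act_def by (rule Abs_ept_inverse) (simp add: ell_points_iff map_in_curve set_point_map)

lemma additive_act: "additive_map act"
  unfolding additive_map_def by (simp add: Rep_act plus_ept.rep_eq map_add flip: Rep_ept_inject)

lemma act_eta: "act (eta_ept p) = (if \<sigma> \<i> = \<i> then eta_ept (act p) else - eta_ept (act p))"
  by (simp add: Rep_act uminus_ept.rep_eq eta_ept.rep_eq map_eta flip: Rep_ept_inject)

end

section \<open>Group operations and limits of automorphisms\<close>

lemma abs_Gal_id: "restrict id Qbar \<in> abs_Gal"
  by (auto simp: abs_Gal_def bij_betw_def inj_on_def elim!: Rats_cases)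

lemma abs_Gal_comp:
  assumes "\<sigma> \<in> abs_Gal" "\<tau> \<in> abs_Gal"
  shows "restrict (\<sigma> \<circ> \<tau>) Qbar \<in> abs_Gal"
proof -
  interpret \<sigma>: galois \<sigma> by unfold_locales (rule assms)
  interpret \<tau>: galois \<tau> by unfold_locales (rule assms)
  have "bij_betw (\<sigma> \<circ> \<tau>) Qbar Qbar"
    using assms by (intro bij_betw_trans[of \<tau> _ Qbar]) (simp_all add: abs_Gal_def)
  hence "bij_betw (restrict (\<sigma> \<circ> \<tau>) Qbar) Qbar Qbar" by (simp cong: bij_betw_cong)
  thus ?thesis
    by (auto simp: abs_Gal_def \<sigma>.add \<tau>.add \<sigma>.mult \<tau>.mult elim!: Rats_cases)
      (auto simp: \<sigma>.rat \<tau>.rat)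
qed

lemma abs_Gal_inverse:
  assumes "\<sigma> \<in> abs_Gal"
  obtains \<tau> where "\<tau> \<in> abs_Gal" "\<And>x. x \<in> Qbar \<Longrightarrow> \<tau> (\<sigma> x) = x" "\<And>x. x \<in> Qbar \<Longrightarrow> \<sigma> (\<tau> x) = x"
proof -
  interpret \<sigma>: galois \<sigma> by unfold_locales (rule assms)
  have bij: "bij_betw \<sigma> Qbar Qbar" using assms by (simp add: abs_Gal_def)
  define \<tau> where "\<tau> = restrict (inv_into Qbar \<sigma>) Qbar"
  have 1: "\<tau> (\<sigma> x) = x" if "x \<in> Qbar" for x
    using that bij_betw_inv_into_left[OF bij] by (simp add: \<tau>_def)
  have 2: "\<sigma> (\<tau> x) = x" if "x \<in> Qbar" for x
    using that bij_betw_inv_into_right[OF bij] by (simp add: \<tau>_def)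
  have Q: "\<tau> x \<in> Qbar" if "x \<in> Qbar" for x
    using that bij_betw_apply[OF bij_betw_inv_into[OF bij]] by (simp add: \<tau>_def)
  have "bij_betw \<tau> Qbar Qbar"
    using bij_betw_inv_into[OF bij] by (simp add: \<tau>_def cong: bij_betw_cong)
  moreover have "\<tau> (x + y) = \<tau> x + \<tau> y \<and> \<tau> (x * y) = \<tau> x * \<tau> y" if "x \<in> Qbar" "y \<in> Qbar" for x y
  proof -
    have "\<sigma> (\<tau> (x + y)) = \<sigma> (\<tau> x + \<tau> y)" "\<sigma> (\<tau> (x * y)) = \<sigma> (\<tau> x * \<tau> y)"
      using that by (simp_all add: 2 Q \<sigma>.add \<sigma>.mult)
    thus ?thesis using that \<sigma>.inj Q by simp
  qed
  moreover have "\<tau> q = q" if "q \<in> \<rat>" for q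
  proof -
    have "q \<in> Qbar" using that by (auto elim: Rats_cases)
    thus ?thesis using 1[of q] \<sigma>.rat[OF that] by simp
  qed
  ultimately have "\<tau> \<in> abs_Gal" by (simp add: abs_Gal_def \<tau>_def)
  thus ?thesis using 1 2 that by blast
qed

lemma gal_image_closed:
  assumes alg: "\<And>n. set_point (P n) \<subseteq> Qbar" "\<And>n. set_point (Q n) \<subseteq> Qbar"
    and M: "\<And>n. \<exists>N\<in>gal_image a b P Q. mat_cong n M N"
  shows "M \<in> gal_image a b P Q"
proof -
  obtain N where N: "\<And>n. N n \<in> gal_image a b P Q" "\<And>n. mat_cong n M (N n)" using M by metis
  obtain \<sigma> where \<sigma>: "\<And>n. \<sigma> n \<in> abs_Gal"
      "\<And>n. gal_act (\<sigma> n) P = tate_comb a (N n $ 1 $ 1) P (N n $ 2 $ 1) Q"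
      "\<And>n. gal_act (\<sigma> n) Q = tate_comb a (N n $ 1 $ 2) P (N n $ 2 $ 2) Q"
    using N(1) unfolding gal_image_def by (simp, metis)
  have gal: "galois (\<sigma> n)" for n by unfold_locales (rule \<sigma>)
  \<comment> \<open>The graph of the pointwise limit, on those algebraic numbers where the sequence
    becomes constant.\<close>
  define G where "G = {(x, y). x \<in> Qbar \<and> (\<exists>n. \<forall>m\<ge>n. \<sigma> m x = y)}"
  have "G \<in> hom_graphs"
    unfolding hom_graphs_def
  proof (intro CollectI conjI allI impI)
    show "G \<subseteq> Qbar \<times> Qbar" using galois.in_Qbar[OF gal] by (auto simp: G_def)
    show "single_valued G"
    proof (rule single_valuedI)
      fix x y z assume "(x, y) \<in> G" "(x, z) \<in> G"
      then obtain n n' where "\<forall>m\<ge>n. \<sigma> m x = y" "\<forall>m\<ge>n'. \<sigma> m x = z" by (auto simp: G_def)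
      hence "\<sigma> (max n n') x = y" "\<sigma> (max n n') x = z" by (meson max.cobounded1 max.cobounded2)+
      thus "y = z" by (rule trans[OF sym])
    qed
    show "(1, 1) \<in> G" using galois.one[OF gal] by (simp add: G_def)
  next
    fix x x' y y' assume "(x, x') \<in> G" "(y, y') \<in> G"
    then obtain n n' where n: "x \<in> Qbar" "y \<in> Qbar" "\<forall>m\<ge>n. \<sigma> m x = x'" "\<forall>m\<ge>n'. \<sigma> m y = y'" by (auto simp: G_def)
    have "\<forall>m\<ge>max n n'. \<sigma> m (x + y) = x' + y'" "\<forall>m\<ge>max n n'. \<sigma> m (x * y) = x' * y'"
      using n galois.add[OF gal] galois.mult[OF gal] by simp_all
    thus "(x + y, x' + y') \<in> G" "(x * y, x' * y') \<in> G"
      unfolding G_def using n by (auto intro: exI[of _ "max n n'"])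
  next
    fix x x' assume "(x, x') \<in> G"
    thus "(- x, - x') \<in> G" using galois.uminus[OF gal] by (fastforce simp: G_def)
  qed
  then obtain \<tau> where \<tau>: "\<tau> \<in> abs_Gal" "\<And>x y. (x, y) \<in> G \<Longrightarrow> \<tau> x = y" by (rule extend_to_abs_Gal) blast
  have res: "res (N m $ i $ j) n = res (M $ i $ j) n" if "n \<le> m" for m n i j
    using mat_cong_mono[OF N(2) that] by (simp add: mat_cong_def)
  \<comment> \<open>From index n on, the matrices agree modulo \<open>2 ^ n\<close>, so the action
    on the n-th terms no longer changes and their coordinates lie in the domain of
    \<open>G\<close>.\<close>
  have lim: "map_point \<tau> (R n) = C n"
    if R: "\<And>n. set_point (R n) \<subseteq> Qbar" and C: "\<And>m. n \<le> m \<Longrightarrow> map_point (\<sigma> m) (R n) = C n" for R C n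
  proof (cases "R n")
    case (Affine x y)
    obtain x' y' where C': "C n = Affine x' y'" using C[of n] Affine by (cases "C n") auto
    have "\<forall>m\<ge>n. \<sigma> m x = x'" "\<forall>m\<ge>n. \<sigma> m y = y'" using C Affine C' by auto
    hence "(x, x') \<in> G" "(y, y') \<in> G" using R[of n] Affine by (auto simp: G_def)
    thus ?thesis using \<tau>(2) Affine C' by simp
  qed (use C[of n] in simp)
  have "gal_act \<tau> P = tate_comb a (M $ 1 $ 1) P (M $ 2 $ 1) Q"
  proof
    fix n
    have "map_point (\<sigma> m) (P n) = tate_comb a (M $ 1 $ 1) P (M $ 2 $ 1) Q n" if "n \<le> m" for m
      using fun_cong[OF \<sigma>(2)[of m], of n] by (simp add: gal_act_def tate_comb_def res[OF that])
    thus "gal_act \<tau> P n = tate_comb a (M $ 1 $ 1) P (M $ 2 $ 1) Q n"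
      unfolding gal_act_def by (intro lim alg)
  qed
  moreover have "gal_act \<tau> Q = tate_comb a (M $ 1 $ 2) P (M $ 2 $ 2) Q"
  proof
    fix n
    have "map_point (\<sigma> m) (Q n) = tate_comb a (M $ 1 $ 2) P (M $ 2 $ 2) Q n" if "n \<le> m" for m
      using fun_cong[OF \<sigma>(3)[of m], of n] by (simp add: gal_act_def tate_comb_def res[OF that])
    thus "gal_act \<tau> Q n = tate_comb a (M $ 1 $ 2) P (M $ 2 $ 2) Q n"
      unfolding gal_act_def by (intro lim alg)
  qed
  ultimately show ?thesis using \<tau>(1) unfolding gal_image_def by blast
qed

text \<open>Conjugation on the quadratic field generated by \<open>z\<close> is a partial
  homomorphism and extends to all algebraic numbers.\<close>

lemma move_sqrt:
  assumes z: "z\<^sup>2 = of_rat q" "z \<notin> \<rat>"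
  obtains \<sigma> where "\<sigma> \<in> abs_Gal" "\<sigma> z = - z"
proof -
  have zQ: "z \<in> Qbar"
  proof -
    have "z = csqrt (of_rat q) \<or> z = - csqrt (of_rat q)"
      using z(1) power2_csqrt[of "of_rat q"] by (metis power2_eq_iff)
    thus ?thesis by auto
  qed
  define G where "G = {(x + y * z, x - y * z) | x y. x \<in> \<rat> \<and> y \<in> \<rat>}"
  have rQ: "x \<in> Qbar" if "x \<in> \<rat>" for x using that by (auto elim: Rats_cases)
  have GI: "(x + y * z, x - y * z) \<in> G" if "x \<in> \<rat>" "y \<in> \<rat>" for x y using that by (auto simp: G_def)
  have "G \<in> hom_graphs"
    unfolding hom_graphs_def
  proof (intro CollectI conjI allI impI)
    show "G \<subseteq> Qbar \<times> Qbar" using zQ rQ by (auto simp: G_def)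
    show "single_valued G"
    proof (rule single_valuedI)
      fix s t t' assume "(s, t) \<in> G" "(s, t') \<in> G"
      obtain x y where xy: "s = x + y * z" "t = x - y * z" "x \<in> \<rat>" "y \<in> \<rat>"
        using \<open>(s, t) \<in> G\<close> by (auto simp: G_def)
      obtain x' y' where xy': "s = x' + y' * z" "t' = x' - y' * z" "x' \<in> \<rat>" "y' \<in> \<rat>"
        using \<open>(s, t') \<in> G\<close> by (auto simp: G_def)
      have e: "(y - y') * z = x' - x" using xy(1) xy'(1) by (simp add: algebra_simps)
      have "y = y'"
      proof (rule ccontr)
        assume "y \<noteq> y'"
        hence "z = (x' - x) / (y - y')" using e by (simp add: field_simps)
        thus False using z(2) xy xy' by simp
      qed
      thus "t = t'" using xy(2) xy'(2) e by simp
    qed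
    show "(1, 1) \<in> G" using GI[of 1 0] by simp
  next
    fix s s' t t' assume "(s, s') \<in> G" "(t, t') \<in> G"
    then obtain x y x' y' where xy: "s = x + y * z" "s' = x - y * z" "t = x' + y' * z" "t' = x' - y' * z"
        "x \<in> \<rat>" "y \<in> \<rat>" "x' \<in> \<rat>" "y' \<in> \<rat>" by (auto simp: G_def)
    show "(s + t, s' + t') \<in> G" using GI[of "x + x'" "y + y'"] xy(5-8) unfolding xy(1-4) by (simp add: algebra_simps)
    have "s * t = (x * x' + y * y' * of_rat q) + (x * y' + x' * y) * z"
      "s' * t' = (x * x' + y * y' * of_rat q) - (x * y' + x' * y) * z"
      unfolding xy z(1)[symmetric] by algebra+
    thus "(s * t, s' * t') \<in> G" using GI[of "x * x' + y * y' * of_rat q" "x * y' + x' * y"] xy by simp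
  next
    fix s s' assume "(s, s') \<in> G"
    then obtain x y where xy: "s = x + y * z" "s' = x - y * z" "x \<in> \<rat>" "y \<in> \<rat>" by (auto simp: G_def)
    thus "(- s, - s') \<in> G" using GI[of "- x" "- y"] by simp
  qed
  then obtain \<sigma> where "\<sigma> \<in> abs_Gal" "\<And>x y. (x, y) \<in> G \<Longrightarrow> \<sigma> x = y" by (rule extend_to_abs_Gal) blast
  thus ?thesis using that GI[of 0 1] by force
qed

subsection \<open>The twists \<open>E\<^sup>d\<close>\<close>

locale twist =
  fixes d :: int
  assumes d: "d \<noteq> 0"
begin

definition u :: complex where "u = csqrt (of_int d)"

lemma u_square [simp]: "u\<^sup>2 = of_int d" and u_Qbar [simp]: "u \<in> Qbar" and u_nonzero [simp]: "u \<noteq> 0"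
  using d by (simp_all add: u_def)

lemma u_power: "u ^ 4 = (of_int d)\<^sup>2" "u ^ 6 = of_int d ^ 3"
proof -
  have "u ^ (2 * 2) = (u\<^sup>2)\<^sup>2" "u ^ (2 * 3) = (u\<^sup>2) ^ 3" by (rule power_mult)+
  thus "u ^ 4 = (of_int d)\<^sup>2" "u ^ 6 = of_int d ^ 3" by simp_all
qed

lemma Ed_coeffs: "of_rat (Ed_a d) = u ^ 4 * (- 11)" "of_rat (Ed_b d) = u ^ 6 * 14"
  unfolding u_power by (simp_all add: Ed_a_def Ed_b_def of_rat_mult of_rat_power of_rat_minus)

text \<open>The isomorphism from E^1 to E^d, which is defined over the field generated by
  \<open>u\<close>.\<close>

definition S :: "ept \<Rightarrow> complex point" where "S p = scale_point u (Rep_ept p)"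

lemma S_add: "ell_add (of_rat (Ed_a d)) (S p) (S q) = S (p + q)"
  by (simp only: Ed_coeffs S_def plus_ept.rep_eq scale_point_add[OF u_nonzero])

lemma S_0: "S 0 = Infinity"
  by (simp add: S_def zero_ept.rep_eq)

lemma S_inj: "S p = S q \<longleftrightarrow> p = q"
proof
  assume "S p = S q"
  hence "scale_point (1 / u) (S p) = scale_point (1 / u) (S q)" by simp
  thus "p = q" by (simp add: S_def scale_point_compose Rep_ept_inject)
qed simp

lemma S_eq_Infinity: "S p = Infinity \<longleftrightarrow> p = 0"
  using S_inj[of p 0] by (simp add: S_0)

lemma S_mult: "ell_mult (of_rat (Ed_a d)) n (S p) = S (nmul n p)"
  by (induction n) (simp_all add: S_0 S_add)

lemma set_point_S: "set_point (S p) \<subseteq> Qbar"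
  unfolding S_def by (rule set_point_scale) simp_all

lemma S_in_points: "S p \<in> ell_points (Ed_a d) (Ed_b d)"
proof (cases "Rep_ept p")
  case (Affine x y)
  have "y\<^sup>2 = x ^ 3 + - 11 * x + 14" using Rep_in_curve[of p] Affine by simp
  hence "(u ^ 3 * y)\<^sup>2 = (u\<^sup>2 * x) ^ 3 + u ^ 4 * (- 11) * (u\<^sup>2 * x) + u ^ 6 * 14" by algebra
  moreover have "x \<in> Qbar" "y \<in> Qbar" using set_point_Rep[of p] Affine by simp_all
  ultimately show ?thesis
    unfolding S_def Affine ell_points_def Ed_coeffs by (simp del: u_square)
qed (simp add: S_def ell_points_def)

lemma S_surj:
  assumes "P \<in> ell_points (Ed_a d) (Ed_b d)"
  obtains p where "P = S p"
proof (cases P)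
  case Infinity
  thus ?thesis using that[of 0] by (simp add: S_0)
next
  case (Affine x y)
  define v where "v = 1 / u"
  have uv: "u * v = 1" by (simp add: v_def)
  have xy: "x \<in> Qbar" "y \<in> Qbar" "y\<^sup>2 = x ^ 3 + u ^ 4 * (- 11) * x + u ^ 6 * 14"
    using assms Affine unfolding ell_points_def Ed_coeffs by auto
  have "(v ^ 3 * y)\<^sup>2 = (v\<^sup>2 * x) ^ 3 - 11 * (v\<^sup>2 * x) + 14"
    using xy(3) uv by algebra
  moreover have "v \<in> Qbar" by (simp add: v_def)
  ultimately have "Rep_ept (ept_of (v\<^sup>2 * x) (v ^ 3 * y)) = Affine (v\<^sup>2 * x) (v ^ 3 * y)"
    using xy by (intro Rep_ept_of) simp_all
  moreover have "u\<^sup>2 * (v\<^sup>2 * x) = x" "u ^ 3 * (v ^ 3 * y) = y" using uv by algebra+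
  ultimately have "S (ept_of (v\<^sup>2 * x) (v ^ 3 * y)) = P"
    unfolding S_def Affine by (simp only: scale_point.simps)
  thus ?thesis using that by blast
qed

lemma in_torsion_S: "S p \<in> ell_torsion (Ed_a d) (Ed_b d) n \<longleftrightarrow> nmul n p = 0"
  by (simp add: ell_torsion_def S_in_points S_mult S_eq_Infinity)

lemma tate_eq: "tate (Ed_a d) (Ed_b d) = (\<lambda>P. S \<circ> P) ` tate_seq"
proof (rule equalityI; rule subsetI)
  fix R assume R: "R \<in> tate (Ed_a d) (Ed_b d)"
  have "\<exists>p. R n = S p" for n
    using R S_surj[of "R n"] by (auto simp: tate_def ell_torsion_def)
  then obtain P where P: "\<And>n. R n = S (P n)" by metis
  have "P 0 = 0" using R P[of 0] in_torsion_S[of "P 0" 1] by (auto simp: tate_def dest: spec[of _ 0])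
  moreover have "P (Suc n) + P (Suc n) = P n" for n
  proof -
    have "S (nmul 2 (P (Suc n))) = S (P n)" using R P by (simp add: tate_def flip: S_mult)
    thus ?thesis by (simp add: S_inj numeral_2_eq_2)
  qed
  ultimately have "P \<in> tate_seq" by (simp add: tate_seq_def)
  moreover have "R = S \<circ> P" using P by auto
  ultimately show "R \<in> (\<lambda>P. S \<circ> P) ` tate_seq" by blast
next
  fix R assume "R \<in> (\<lambda>P. S \<circ> P) ` tate_seq"
  then obtain P where P: "P \<in> tate_seq" "R = S \<circ> P" by blast
  have "nmul (2 ^ n) (P n) = 0" for n
    using tate_seq_torsion[OF P(1), of n] imul_of_nat[of "2 ^ n" "P n"] by simp
  moreover have "nmul 2 (P (Suc n)) = P n" for n
    using tate_seq_double[OF P(1)] by (simp add: numeral_2_eq_2)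
  ultimately show "R \<in> tate (Ed_a d) (Ed_b d)"
    by (simp add: tate_def P(2) in_torsion_S S_mult)
qed

lemma tate_comb_eq: "tate_comb (Ed_a d) x (S \<circ> P) y (S \<circ> Q) = S \<circ> lincomb x P y Q"
  by (simp add: fun_eq_iff tate_comb_def lincomb_def S_mult S_add imul_def)

lemma S_comp_inj: "S \<circ> P = S \<circ> Q \<longleftrightarrow> P = Q"
  by (simp add: fun_eq_iff S_inj)

lemma tate_basis_iff: "tate_basis (Ed_a d) (Ed_b d) (S \<circ> P) (S \<circ> Q) \<longleftrightarrow> is_tate_basis P Q"
proof -
  have "S \<circ> R \<in> tate (Ed_a d) (Ed_b d) \<longleftrightarrow> R \<in> tate_seq" for R
    unfolding tate_eq image_iff S_comp_inj by simp
  thus ?thesis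
    unfolding tate_basis_def is_tate_basis_def
    by (simp only:) (simp only: tate_eq ball_simps tate_comb_eq S_comp_inj)
qed

text \<open>The action on E^d carried back to E^1: moving \<open>u\<close> to \<open>- u\<close> in
  the scaling amounts to a negation.\<close>

definition tw :: "(complex \<Rightarrow> complex) \<Rightarrow> ept \<Rightarrow> ept" where
  "tw \<sigma> p = (if \<sigma> u = u then galois.act \<sigma> p else - galois.act \<sigma> p)"

lemma u_cases: "\<sigma> \<in> abs_Gal \<Longrightarrow> \<sigma> u = u \<or> \<sigma> u = - u"
  by (rule galois.square_root) (simp_all add: galois_def)

lemma map_S:
  assumes "\<sigma> \<in> abs_Gal"
  shows "map_point \<sigma> (S p) = S (tw \<sigma> p)"
proof -
  interpret galois \<sigma> by unfold_locales (rule assms)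
  show ?thesis
    using u_cases[OF assms] unfolding S_def
    by (auto simp: map_scale tw_def Rep_act uminus_ept.rep_eq scale_point_uminus scale_point_neg)
qed

definition \<Gamma> :: "(ept \<Rightarrow> ept) set" where "\<Gamma> = tw ` abs_Gal"

lemma gal_image_eq: "gal_image (Ed_a d) (Ed_b d) (S \<circ> P) (S \<circ> Q) = rep_image \<Gamma> P Q"
proof -
  have "gal_act \<sigma> (S \<circ> R) = S \<circ> (tw \<sigma> \<circ> R)" if "\<sigma> \<in> abs_Gal" for \<sigma> R
    using map_S[OF that] by (simp add: gal_act_def fun_eq_iff)
  thus ?thesis
    unfolding gal_image_def rep_image_def \<Gamma>_def mat_col_def tate_comb_eq by (auto simp: S_comp_inj)
qed

lemma additive_tw: "\<sigma> \<in> abs_Gal \<Longrightarrow> additive_map (tw \<sigma>)"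
  using galois.additive_act[of \<sigma>] by (simp add: galois_def additive_map_def tw_def)

lemma tw_comp:
  assumes "\<sigma> \<in> abs_Gal" "\<tau> \<in> abs_Gal" "\<rho> \<in> abs_Gal" "\<And>x. x \<in> Qbar \<Longrightarrow> \<rho> x = \<sigma> (\<tau> x)"
  shows "tw \<sigma> \<circ> tw \<tau> = tw \<rho>"
proof
  fix p
  have "map_point \<rho> P = map_point \<sigma> (map_point \<tau> P)" if "set_point P \<subseteq> Qbar" for P
    using that assms(4) by (cases P) auto
  hence "S ((tw \<sigma> \<circ> tw \<tau>) p) = S (tw \<rho> p)"
    using set_point_S by (simp flip: map_S[OF assms(1)] map_S[OF assms(2)] map_S[OF assms(3)])
  thus "(tw \<sigma> \<circ> tw \<tau>) p = tw \<rho> p" by (simp only: S_inj)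
qed

lemma tw_id: "tw (restrict id Qbar) = id"
proof
  fix p
  have "map_point (restrict id Qbar) P = P" if "set_point P \<subseteq> Qbar" for P
    using that by (cases P) auto
  hence "S (tw (restrict id Qbar) p) = S p"
    using set_point_S by (simp flip: map_S[OF abs_Gal_id])
  thus "tw (restrict id Qbar) p = id p" by (simp add: S_inj)
qed

lemma \<Gamma>_group:
  "g \<in> \<Gamma> \<Longrightarrow> additive_map g" "id \<in> \<Gamma>" "g \<in> \<Gamma> \<Longrightarrow> h \<in> \<Gamma> \<Longrightarrow> g \<circ> h \<in> \<Gamma>"
  "g \<in> \<Gamma> \<Longrightarrow> \<exists>h\<in>\<Gamma>. g \<circ> h = id \<and> h \<circ> g = id"
proof -
  show "g \<in> \<Gamma> \<Longrightarrow> additive_map g" by (auto simp: \<Gamma>_def additive_tw)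
  show "id \<in> \<Gamma>" unfolding \<Gamma>_def using abs_Gal_id tw_id by (metis imageI)
  show "g \<circ> h \<in> \<Gamma>" if gh: "g \<in> \<Gamma>" "h \<in> \<Gamma>"
  proof -
    obtain \<sigma> \<tau> where \<sigma>: "\<sigma> \<in> abs_Gal" "g = tw \<sigma>" and \<tau>: "\<tau> \<in> abs_Gal" "h = tw \<tau>" using gh by (auto simp: \<Gamma>_def)
    have "tw \<sigma> \<circ> tw \<tau> = tw (restrict (\<sigma> \<circ> \<tau>) Qbar)"
      by (rule tw_comp[OF \<sigma>(1) \<tau>(1) abs_Gal_comp[OF \<sigma>(1) \<tau>(1)]]) simp
    thus ?thesis using abs_Gal_comp[OF \<sigma>(1) \<tau>(1)] \<sigma>(2) \<tau>(2) by (simp add: \<Gamma>_def)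
  qed
  show "\<exists>h\<in>\<Gamma>. g \<circ> h = id \<and> h \<circ> g = id" if g: "g \<in> \<Gamma>"
  proof -
    obtain \<sigma> where \<sigma>: "\<sigma> \<in> abs_Gal" "g = tw \<sigma>" using g by (auto simp: \<Gamma>_def)
    obtain \<tau> where \<tau>: "\<tau> \<in> abs_Gal" "\<And>x. x \<in> Qbar \<Longrightarrow> \<tau> (\<sigma> x) = x" "\<And>x. x \<in> Qbar \<Longrightarrow> \<sigma> (\<tau> x) = x"
      using abs_Gal_inverse[OF \<sigma>(1)] by blast
    have "tw \<sigma> \<circ> tw \<tau> = id" "tw \<tau> \<circ> tw \<sigma> = id"
      unfolding tw_id[symmetric] by (rule tw_comp[OF \<sigma>(1) \<tau>(1) abs_Gal_id] tw_comp[OF \<tau>(1) \<sigma>(1) abs_Gal_id]; simp add: \<tau>)+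
    thus ?thesis using \<tau>(1) \<sigma>(2) by (auto simp: \<Gamma>_def)
  qed
qed

text \<open>Automorphisms change \<open>u\<close> and \<open>sqrt2\<close> at most by signs, so the
  first component tells whether \<open>u * sqrt2\<close>, a square root of 2 d, is moved.\<close>

definition signs :: "(complex \<Rightarrow> complex) \<Rightarrow> bool \<times> bool \<times> bool" where
  "signs \<sigma> = ((\<sigma> u \<noteq> u) \<noteq> (\<sigma> sqrt2 \<noteq> sqrt2), \<sigma> sqrt2 \<noteq> sqrt2, \<sigma> \<i> \<noteq> \<i>)"

lemma eta_lincomb:
  assumes Q: "Q \<in> tate_seq"
  shows "eta_ept \<circ> lincomb x (eta_ept \<circ> Q) y Q = lincomb y (eta_ept \<circ> Q) (- 4 * x) Q"
proof -
  have P: "eta_ept \<circ> Q \<in> tate_seq" by (rule additive_tate_seq[OF additive_eta Q])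
  have "eta_ept (eta_ept (Q n)) = imul (res (- 4) n) (Q n)" for n
  proof -
    have "res (- 4) n = (- 4) mod 2 ^ n" using res_of_int[of "- 4" n] by simp
    hence "imul (res (- 4) n) (Q n) = imul (- 4) (Q n)" by (simp add: imul_mod[OF Q])
    also have "\<dots> = - (imul 2 (imul 2 (Q n)))" by (simp add: imul_uminus flip: imul_mult)
    finally show ?thesis by (simp add: eta_ept_eta_ept imul_2)
  qed
  hence "eta_ept \<circ> (eta_ept \<circ> Q) = lincomb 0 (eta_ept \<circ> Q) (- 4) Q"
    by (simp add: fun_eq_iff lincomb_def zero_z2.rep_eq)
  moreover have "eta_ept \<circ> Q = lincomb 1 (eta_ept \<circ> Q) 0 Q" using lincomb_1_0(1)[OF P Q] by simp
  ultimately have "eta_ept \<circ> lincomb x (eta_ept \<circ> Q) y Q =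
      lincomb x (lincomb 0 (eta_ept \<circ> Q) (- 4) Q) y (lincomb 1 (eta_ept \<circ> Q) 0 Q)"
    by (simp only: additive_lincomb[OF additive_eta])
  thus ?thesis unfolding lincomb_lincomb[OF P Q] by simp
qed

text \<open>Commutation with \<open>eta_ept\<close> up to sign gives the shape of the matrix; the
  torsion at levels 1 and 2 gives its entries modulo 2 and 4.\<close>

lemma bits_matrix:
  assumes Q: "Q \<in> tate_seq" "Q 1 = Q1" and \<sigma>: "\<sigma> \<in> abs_Gal"
    and M: "tw \<sigma> \<circ> (eta_ept \<circ> Q) = mat_col (eta_ept \<circ> Q) Q M 1" "tw \<sigma> \<circ> Q = mat_col (eta_ept \<circ> Q) Q M 2"
  shows "M \<in> norm_cartan" "bits M = signs \<sigma>"
proof -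
  interpret galois \<sigma> by unfold_locales (rule \<sigma>)
  define P where "P = eta_ept \<circ> Q"
  note basis = eta_basis(1)[OF Q, folded P_def] and P1 = eta_basis(2)[OF Q]
  have PT: "P \<in> tate_seq" by (rule is_tate_basisD[OF basis])
  have P1: "P 1 = K1" using eta_basis(2)[OF Q] by (simp add: P_def)
  note gP = M(1)[folded P_def, unfolded mat_col_def] and gQ = M(2)[folded P_def, unfolded mat_col_def]
  define s :: z2 where "s = (if \<sigma> \<i> = \<i> then 1 else - 1)"
  have s: "s = 1 \<or> s = - 1" "s \<noteq> 1 \<longleftrightarrow> \<sigma> \<i> \<noteq> \<i>" by (simp_all add: s_def)
  have neg: "(\<lambda>n. - lincomb x P y Q n) = lincomb (- x) P (- y) Q" for x y
  proof
    fix n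
    have "imul (res (- x) n) (R n) = - imul (res x n) (R n)" if "R \<in> tate_seq" for R :: "nat \<Rightarrow> ept" and x
      by (simp add: uminus_z2.rep_eq imul_mod[OF that] imul_uminus)
    thus "- lincomb x P y Q n = lincomb (- x) P (- y) Q n" using PT Q(1) by (simp add: lincomb_def)
  qed
  \<comment> \<open>Applied to \<open>Q\<close>, this determines the first column of
    \<open>M\<close> from the second.\<close>
  have "tw \<sigma> (eta_ept p) = (if \<sigma> \<i> = \<i> then eta_ept (tw \<sigma> p) else - eta_ept (tw \<sigma> p))" for p
    by (simp add: tw_def act_eta additive_mapD(3)[OF additive_eta])
  hence "tw \<sigma> \<circ> P = (if \<sigma> \<i> = \<i> then eta_ept \<circ> (tw \<sigma> \<circ> Q) else (\<lambda>n. - (eta_ept \<circ> (tw \<sigma> \<circ> Q)) n))"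
    by (auto simp: P_def fun_eq_iff)
  also have "\<dots> = lincomb (s * M $ 2 $ 2) P (- 4 * s * M $ 1 $ 2) Q"
    unfolding gQ eta_lincomb[OF Q(1), folded P_def] neg by (simp add: s_def)
  finally have "M $ 1 $ 1 = s * M $ 2 $ 2 \<and> M $ 2 $ 1 = - 4 * s * M $ 1 $ 2"
    using is_tate_basisD(4)[OF basis] gP by metis
  hence M22: "M $ 2 $ 2 = s * M $ 1 $ 1" and M21: "M $ 2 $ 1 = - 4 * s * M $ 1 $ 2" using s by auto
  have tw_eq: "tw \<sigma> p = q \<longleftrightarrow> act p = (if \<sigma> u = u then q else - q)" for p q
    by (auto simp: tw_def)
  have res1: "imul (res x 1) p = (if 2 dvd x then 0 else p)" for x and p :: ept
  proof -
    have "res x 1 = 0 \<or> res x 1 = 1" using res_lower[of x 1] res_upper[of x 1]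
      by (simp del: One_nat_def res_lower res_upper) linarith
    thus ?thesis using two_power_dvd_iff_res[of 1 x] by auto
  qed
  have tw_ne: "tw \<sigma> p \<noteq> 0" if "p \<noteq> 0" for p
  proof -
    have "Rep_ept (act p) \<noteq> Infinity"
      using that by (cases "Rep_ept p") (auto simp: Rep_act zero_ept.rep_eq simp flip: Rep_ept_inject)
    hence "act p \<noteq> 0" by (auto simp: zero_ept.rep_eq)
    thus ?thesis by (simp add: tw_def)
  qed
  have odd: "\<not> 2 dvd M $ 1 $ 1"
  proof
    assume "2 dvd M $ 1 $ 1"
    moreover have "2 dvd M $ 2 $ 1" unfolding M21 by simp
    ultimately have "tw \<sigma> (P 1) = 0" using fun_cong[OF gP, of 1] by (simp add: lincomb_def res1 del: One_nat_def)
    thus False using tw_ne[of K1] P1 K1_Q1 by simp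
  qed
  have M_eq: "M = nmat s (M $ 1 $ 1) (M $ 1 $ 2)"
    by (rule mat2_eqI) (simp_all add: nmat_def M21 M22)
  show "M \<in> norm_cartan" by (subst M_eq) (use s odd in \<open>auto simp: norm_cartan_def\<close>)
  have \<beta>: "2 dvd M $ 1 $ 2 \<longleftrightarrow> \<sigma> sqrt2 = sqrt2"
  proof -
    \<comment> \<open>At level 1, \<open>Q1\<close> goes to itself or to \<open>K1 + Q1\<close>
      according to the parity of the upper right entry. The twist is invisible on points of order 2,
      so only sqrt 2 counts.\<close>
    have "\<not> 2 dvd M $ 2 $ 2" unfolding M22 using odd s by auto
    hence "tw \<sigma> Q1 = (if 2 dvd M $ 1 $ 2 then 0 else K1) + Q1"
      using fun_cong[OF gQ, of 1] P1 Q(2) by (simp add: lincomb_def res1 del: One_nat_def)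
    hence "2 dvd M $ 1 $ 2 \<longleftrightarrow> tw \<sigma> Q1 = Q1" using K1_Q1 by simp
    also have "\<dots> \<longleftrightarrow> act Q1 = Q1"
    proof -
      have "- Q1 = Q1" using K1_Q1(2) by (simp add: neg_eq_iff_add_eq_0)
      thus ?thesis unfolding tw_eq by simp
    qed
    also have "\<dots> \<longleftrightarrow> \<sigma> (- 1 + 2 * sqrt2) = - 1 + 2 * sqrt2"
      by (simp add: Rep_act Rep_Q1 flip: Rep_ept_inject)
    also have "\<dots> \<longleftrightarrow> \<sigma> sqrt2 = sqrt2" by (simp add: add mult uminus diff)
    finally show ?thesis .
  qed
  have \<alpha>: "4 dvd M $ 1 $ 1 - 1 \<longleftrightarrow> (\<sigma> u = u \<longleftrightarrow> \<sigma> sqrt2 = sqrt2)"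
  proof -
    obtain y where y: "Rep_ept (P 2) = Affine 3 y" "y\<^sup>2 = 8" using eta_basis(3)[OF Q] by (auto simp: P_def)
    have "y \<noteq> 0" using y(2) by auto
    have "y = 2 * sqrt2 \<or> y = - (2 * sqrt2)"
      using y(2) by (simp add: power2_eq_iff[symmetric] power_mult_distrib)
    moreover have yQ: "y \<in> Qbar" using set_point_Rep[of "P 2"] y by simp
    ultimately have \<sigma>y: "\<sigma> y = y \<longleftrightarrow> \<sigma> sqrt2 = sqrt2"
      by (auto simp: mult uminus)
    have \<sigma>y': "\<sigma> y = y \<or> \<sigma> y = - y" using y(2) yQ by (intro square_root) simp_all
    have ne: "y \<noteq> - y" using \<open>y \<noteq> 0\<close> complex_eq_neg_imp_0 by blast
    have P2: "P 2 \<noteq> - P 2" using y ne uminus_ept.rep_eq[of "P 2"] by auto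
    \<comment> \<open>The lower left entry is divisible by 4, so \<open>P 2\<close> is multiplied by
      the upper left entry alone. Its ordinate is 2 sqrt 2 up to sign, and the twist adds the sign
      on \<open>u\<close>.\<close>
    have "res (M $ 2 $ 1) 2 = 0"
      using two_power_dvd_iff_res[of 2 "M $ 2 $ 1"] unfolding M21 by simp
    hence gP2: "tw \<sigma> (P 2) = imul (res (M $ 1 $ 1) 2) (P 2)"
      using fun_cong[OF gP, of 2] by (simp add: lincomb_def)
    have "4 dvd M $ 1 $ 1 - 1 \<longleftrightarrow> tw \<sigma> (P 2) = P 2"
    proof
      assume "4 dvd M $ 1 $ 1 - 1"
      hence "res (M $ 1 $ 1) 2 = 1" using res_eq_iff_dvd[of "M $ 1 $ 1" 2 1] by (simp add: one_z2.rep_eq)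
      thus "tw \<sigma> (P 2) = P 2" using gP2 by simp
    next
      assume fixed: "tw \<sigma> (P 2) = P 2"
      show "4 dvd M $ 1 $ 1 - 1"
      proof (rule ccontr)
        assume "\<not> 4 dvd M $ 1 $ 1 - 1"
        hence "4 dvd M $ 1 $ 1 + 1" using z2_odd_mod4[OF odd] by simp
        hence "res (M $ 1 $ 1) 2 = res (- 1) 2" using res_eq_iff_dvd[of "M $ 1 $ 1" 2 "- 1"] by simp
        also have "\<dots> = (- 1) mod 2 ^ 2" using res_of_int[of "- 1" 2] by simp
        finally have "tw \<sigma> (P 2) = - P 2"
          using gP2 imul_mod[OF PT, of "- 1" 2] by (simp add: imul_uminus del: minus_one_mod_numeral)
        thus False using fixed P2 by simp
      qed
    qed
    also have "\<dots> \<longleftrightarrow> (\<sigma> u = u \<longleftrightarrow> \<sigma> y = y)"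
    proof -
      have "Rep_ept (act (P 2)) = Affine 3 (\<sigma> y)" by (simp add: Rep_act y)
      moreover have "Rep_ept (- P 2) = Affine 3 (- y)" by (simp add: uminus_ept.rep_eq y)
      ultimately show ?thesis
        using \<sigma>y' ne y(1) unfolding tw_eq by (auto simp flip: Rep_ept_inject)
    qed
    finally show ?thesis unfolding \<sigma>y .
  qed
  show "bits M = signs \<sigma>"
    by (subst M_eq) (simp add: bits_nmat[OF odd s(1)] signs_def s(2) \<alpha> \<beta>)
qed

lemma rep_image_properties:
  assumes Q: "Q \<in> tate_seq" "Q 1 = Q1"
  defines "H \<equiv> rep_image \<Gamma> (eta_ept \<circ> Q) Q"
  shows "closed_subgroup_GL2 H" "H \<subseteq> norm_cartan" "bits ` H = signs ` abs_Gal"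
proof -
  note basis = eta_basis(1)[OF Q]
  show sub: "H \<subseteq> norm_cartan" using bits_matrix(1)[OF Q] by (auto simp: H_def rep_image_def \<Gamma>_def)
  show "bits ` H = signs ` abs_Gal"
  proof (rule equalityI; rule subsetI)
    fix x assume "x \<in> bits ` H"
    then obtain M where M: "M \<in> H" "x = bits M" by blast
    then obtain \<sigma> where "\<sigma> \<in> abs_Gal" "tw \<sigma> \<circ> (eta_ept \<circ> Q) = mat_col (eta_ept \<circ> Q) Q M 1"
      "tw \<sigma> \<circ> Q = mat_col (eta_ept \<circ> Q) Q M 2" by (auto simp: H_def rep_image_def \<Gamma>_def)
    thus "x \<in> signs ` abs_Gal" using bits_matrix(2)[OF Q] M(2) by auto
  next
    fix x assume "x \<in> signs ` abs_Gal"
    then obtain \<sigma> where \<sigma>: "\<sigma> \<in> abs_Gal" "x = signs \<sigma>" by blast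
    note t = is_tate_basisD(1,2)[OF basis] and a = additive_tate_seq[OF additive_tw[OF \<sigma>(1)]]
    obtain M where M: "tw \<sigma> \<circ> (eta_ept \<circ> Q) = mat_col (eta_ept \<circ> Q) Q M 1"
      "tw \<sigma> \<circ> Q = mat_col (eta_ept \<circ> Q) Q M 2" using mat_col_ex[OF basis a[OF t(1)] a[OF t(2)]] by blast
    hence "M \<in> H" using \<sigma>(1) by (auto simp: H_def rep_image_def \<Gamma>_def)
    moreover have "bits M = x" using bits_matrix(2)[OF Q \<sigma>(1) M] \<sigma>(2) by simp
    ultimately show "x \<in> bits ` H" by blast
  qed
  have "subgroup H GL2" unfolding H_def by (rule subgroup_rep_image[OF basis]) (use \<Gamma>_group in blast)+
  moreover have "closedin (top_of_set (carrier GL2)) H"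
  proof (subst closedin_GL2_iff)
    show "H \<subseteq> carrier GL2" using sub norm_cartan_inverse by auto
    have "M \<in> H" if "\<And>n. \<exists>N\<in>H. mat_cong n M N" for M
      using gal_image_closed[of "S \<circ> (eta_ept \<circ> Q)" "S \<circ> Q" "Ed_a d" "Ed_b d" M] that set_point_S
      unfolding gal_image_eq H_def by simp
    thus "\<forall>M\<in>carrier GL2. (\<forall>n. \<exists>N\<in>H. mat_cong n M N) \<longrightarrow> M \<in> H" by blast
  qed
  ultimately show "closed_subgroup_GL2 H" ..
qed

end

subsection \<open>The images\<close>

lemma exists_sign_change:
  assumes "z\<^sup>2 = of_int m" "\<nexists>q :: rat. q\<^sup>2 = of_int m"
  shows "\<exists>\<sigma>\<in>abs_Gal. \<sigma> z \<noteq> z"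
proof -
  have "z \<notin> \<rat>"
  proof
    assume "z \<in> \<rat>"
    then obtain q where "z = of_rat q" by (auto elim: Rats_cases)
    hence "of_rat (q\<^sup>2) = (of_rat (of_int m) :: complex)" using assms(1) by (simp add: of_rat_power)
    hence "q\<^sup>2 = of_int m" by (simp only: of_rat_eq_iff)
    thus False using assms(2) by blast
  qed
  moreover have "z\<^sup>2 = of_rat (of_int m)" using assms(1) by simp
  ultimately obtain \<sigma> where "\<sigma> \<in> abs_Gal" "\<sigma> z = - z" using move_sqrt by blast
  moreover have "z \<noteq> 0" using \<open>z \<notin> \<rat>\<close> by auto
  hence "z \<noteq> - z" using complex_eq_neg_imp_0 by blast
  ultimately show ?thesis by metis
qed

lemma sign_mult:
  assumes "\<sigma> \<in> abs_Gal" "x \<in> Qbar" "y \<in> Qbar" "x\<^sup>2 \<in> \<rat>" "y\<^sup>2 \<in> \<rat>" "x \<noteq> 0" "y \<noteq> 0"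
  shows "\<sigma> (x * y) \<noteq> x * y \<longleftrightarrow> (\<sigma> x \<noteq> x) \<noteq> (\<sigma> y \<noteq> y)"
proof -
  interpret galois \<sigma> by unfold_locales (rule assms)
  have ne: "x \<noteq> - x" "y \<noteq> - y" "x * y \<noteq> - (x * y)" using assms(6,7) complex_eq_neg_imp_0 no_zero_divisors by blast+
  have "\<sigma> x = x \<or> \<sigma> x = - x" "\<sigma> y = y \<or> \<sigma> y = - y"
    using assms by (simp_all add: square_root)
  thus ?thesis
    using ne ne[symmetric] by (elim disjE) (simp_all add: mult[OF assms(2,3)])
qed

section \<open>Rational squares and square-free integers\<close>

lemma rat_square_int:
  assumes "(q :: rat)\<^sup>2 = of_int k"
  obtains m where "q = of_int m"
proof -
  obtain m n where mn: "q = of_int m / of_int n" "n > 0" "coprime m n"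
    by (metis quotient_of_div quotient_of_denom_pos quotient_of_coprime surj_pair)
  hence "of_int m = q * of_int n" by simp
  hence "of_int (m\<^sup>2) = (of_int (k * n\<^sup>2) :: rat)" using assms by (simp add: power_mult_distrib)
  hence "m\<^sup>2 = k * n\<^sup>2" by (simp only: of_int_eq_iff)
  hence "n dvd m * m" by (simp add: power2_eq_square)
  hence "n dvd m" using mn(3) by (simp add: coprime_commute coprime_dvd_mult_left_iff)
  hence "is_unit n" using coprime_common_divisor[OF mn(3), of n] by simp
  hence "n = 1" using mn(2) by (simp add: zdvd1_eq)
  thus ?thesis using that mn(1) by simp
qed

lemma squarefree_square_int:
  assumes "squarefree (k :: int)" "of_int k = (q :: rat)\<^sup>2"
  shows "k = 1"
proof -
  obtain m where m: "q = of_int m" using rat_square_int assms(2) by metis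
  hence "of_int k = (of_int (m\<^sup>2) :: rat)" using assms(2) by simp
  hence k: "k = m\<^sup>2" by (simp only: of_int_eq_iff)
  hence "\<bar>m\<bar> = 1" using assms(1) by (auto simp: squarefree_def)
  hence "m\<^sup>2 = 1" by (metis one_power2 power2_abs)
  thus ?thesis using k by simp
qed

lemma squarefree_twice_square_int:
  assumes "squarefree (k :: int)" "of_int k = 2 * (q :: rat)\<^sup>2"
  shows "k = 2"
proof -
  have "(2 * q)\<^sup>2 = of_int (2 * k)" using assms(2) by (simp add: power_mult_distrib)
  then obtain m where m: "2 * q = of_int m" using rat_square_int by metis
  have "of_int (m\<^sup>2) = (of_int (2 * k) :: rat)" using \<open>(2 * q)\<^sup>2 = _\<close> m by simp
  hence e: "m\<^sup>2 = 2 * k" by (simp only: of_int_eq_iff)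
  hence "even (m\<^sup>2)" by simp
  hence "even m" by simp
  then obtain l where "m = 2 * l" by (auto elim: evenE)
  hence k: "k = 2 * l\<^sup>2" using e by (simp add: power_mult_distrib)
  hence "\<bar>l\<bar> = 1" using assms(1) by (auto simp: squarefree_def)
  hence "l\<^sup>2 = 1" by (metis one_power2 power2_abs)
  thus ?thesis using k by simp
qed

lemma squarefree_uminus_int: "squarefree (- k) \<longleftrightarrow> squarefree (k :: int)"
  by (simp add: squarefree_def)

lemma squarefree_not_square:
  assumes "squarefree (d :: int)" "d \<notin> {1, - 1, 2, - 2}"
  shows "(\<nexists>q :: rat. q \<noteq> 0 \<and> (of_int d = q\<^sup>2 \<or> of_int d = - (q\<^sup>2))) \<and>
    (\<nexists>q :: rat. q \<noteq> 0 \<and> (of_int d = 2 * q\<^sup>2 \<or> of_int d = - (2 * q\<^sup>2)))"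
proof -
  have "of_int d \<noteq> q\<^sup>2" "of_int d \<noteq> 2 * q\<^sup>2" for q :: rat
    using squarefree_square_int[OF assms(1), of q] squarefree_twice_square_int[OF assms(1), of q] assms(2) by auto
  moreover have "of_int d \<noteq> - (q\<^sup>2)" "of_int d \<noteq> - (2 * q\<^sup>2)" for q :: rat
    using squarefree_square_int[of "- d" q] squarefree_twice_square_int[of "- d" q] assms
    by (auto simp: squarefree_uminus_int minus_equation_iff[of "of_int d"])
  ultimately show ?thesis by blast
qed

lemma negative_not_square: "(\<nexists>q :: rat. q\<^sup>2 = of_int (- 1))" "(\<nexists>q :: rat. q\<^sup>2 = of_int (- 2))"
proof -
  have *: "\<nexists>q :: rat. q\<^sup>2 = of_int k" if "k < 0" for k :: int
    using that zero_le_power2 by (metis not_less of_int_less_0_iff)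
  show "(\<nexists>q :: rat. q\<^sup>2 = of_int (- 1))" "(\<nexists>q :: rat. q\<^sup>2 = of_int (- 2))" by (rule *; simp)+
qed

lemma two_not_square: "\<nexists>q :: rat. q\<^sup>2 = of_int 2"
proof
  assume "\<exists>q :: rat. q\<^sup>2 = of_int 2"
  then obtain q :: rat where q: "q\<^sup>2 = 2" by auto
  hence "(of_rat q)\<^sup>2 = sqrt2\<^sup>2" by (simp flip: of_rat_power)
  hence "of_rat q = sqrt2 \<or> of_rat q = - sqrt2" by (simp only: power2_eq_iff)
  hence "sqrt2 = of_rat q \<or> sqrt2 = of_rat (- q)" by (auto simp: of_rat_minus)
  thus False using sqrt2_not_rat by blast
qed

text \<open>Hypotheses 1 to 3 say that none of the three nonzero linear forms on F_2^2 vanishes on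
  the projection of \<open>B\<close>, which is therefore everything.\<close>

lemma xor3_span_all:
  assumes closed: "\<And>x y. x \<in> B \<Longrightarrow> y \<in> B \<Longrightarrow> xor3 x y \<in> B" and zero: "(False, False, False) \<in> B"
    and 1: "\<exists>x\<in>B. fst (snd x)" and 2: "\<exists>x\<in>B. snd (snd x)" and 3: "\<exists>x\<in>B. fst (snd x) \<noteq> snd (snd x)"
  shows "\<exists>p. (p, q, r) \<in> B"
proof -
  obtain x1 where x1: "x1 \<in> B" "fst (snd x1)" using 1 by blast
  obtain x2 where x2: "x2 \<in> B" "snd (snd x2)" using 2 by blast
  obtain x3 where x3: "x3 \<in> B" "fst (snd x3) \<noteq> snd (snd x3)" using 3 by blast
  note mem = x1(1) x2(1) x3(1) closed[OF x1(1) x2(1)] closed[OF x1(1) x3(1)] closed[OF x2(1) x3(1)] zero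
  obtain a1 c1 where e1: "x1 = (a1, True, c1)" using x1(2) by (cases x1) auto
  obtain a2 b2 where e2: "x2 = (a2, b2, True)" using x2(2) by (cases x2) auto
  obtain a3 b3 where e3: "x3 = (a3, b3, \<not> b3)" using x3(2) by (cases x3) auto
  show ?thesis
    using mem unfolding e1 e2 e3 xor3.simps
    by (cases q; cases r; cases c1; cases b2; cases b3) auto
qed

text \<open>A first bit that is a linear form in the other two is one of four forms, and each of the
  four witnesses refutes one of them.\<close>

lemma linear_contradiction:
  assumes "a1 \<longleftrightarrow> (b1 \<and> p) \<noteq> (c1 \<and> q)" "a1 \<noteq> b1" "a2 \<longleftrightarrow> (b2 \<and> p) \<noteq> (c2 \<and> q)" "a2"
    "a3 \<longleftrightarrow> (b3 \<and> p) \<noteq> (c3 \<and> q)" "(a3 \<noteq> b3) \<noteq> c3" "a4 \<longleftrightarrow> (b4 \<and> p) \<noteq> (c4 \<and> q)" "a4 \<noteq> c4"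
  shows False
proof (cases p; cases q)
  show False if p q using assms(5,6) that by blast
  show False if p "\<not> q" using assms(1,2) that by blast
  show False if "\<not> p" q using assms(7,8) that by blast
  show False if "\<not> p" "\<not> q" using assms(3,4) that by blast
qed

section \<open>The signs that occur for a given d\<close>

context twist
begin

text \<open>Read off from the matrix group, which has the same bits.\<close>

lemma signs_group:
  "(False, False, False) \<in> signs ` abs_Gal"
  "x \<in> signs ` abs_Gal \<Longrightarrow> y \<in> signs ` abs_Gal \<Longrightarrow> xor3 x y \<in> signs ` abs_Gal"
proof -
  obtain Q where Q: "Q \<in> tate_seq" "Q 1 = Q1" using tate_seq_ex by blast
  note H = rep_image_properties[OF Q]
  have sub: "subgroup (rep_image \<Gamma> (eta_ept \<circ> Q) Q) GL2" using H(1) ..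
  show "(False, False, False) \<in> signs ` abs_Gal"
    using bits_image_closed(1)[OF sub H(2)] unfolding H(3) .
  show "x \<in> signs ` abs_Gal \<Longrightarrow> y \<in> signs ` abs_Gal \<Longrightarrow> xor3 x y \<in> signs ` abs_Gal"
    using bits_image_closed(2)[OF sub H(2), of x y] unfolding H(3) .
qed

lemma sqrt2_i: "\<sigma> \<in> abs_Gal \<Longrightarrow> \<sigma> (sqrt2 * \<i>) \<noteq> sqrt2 * \<i> \<longleftrightarrow> (\<sigma> sqrt2 \<noteq> sqrt2) \<noteq> (\<sigma> \<i> \<noteq> \<i>)"
  using Q1_x_ne(3) by (intro sign_mult) simp_all

text \<open>Independent of d: none of 2, -1 and -2 is a rational square.\<close>

lemma signs_surj: "\<exists>p. (p, q, r) \<in> signs ` abs_Gal"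
proof (rule xor3_span_all[OF signs_group(2,1)])
  show "\<exists>x\<in>signs ` abs_Gal. fst (snd x)"
    using exists_sign_change[of sqrt2 2] two_not_square by (auto simp: signs_def)
  show "\<exists>x\<in>signs ` abs_Gal. snd (snd x)"
    using exists_sign_change[of \<i> "- 1"] negative_not_square by (auto simp: signs_def)
  have "\<exists>\<sigma>\<in>abs_Gal. \<sigma> (sqrt2 * \<i>) \<noteq> sqrt2 * \<i>"
    by (rule exists_sign_change[of _ "- 2"]) (simp add: power_mult_distrib, rule negative_not_square)
  thus "\<exists>x\<in>signs ` abs_Gal. fst (snd x) \<noteq> snd (snd x)"
    using sqrt2_i by (auto simp: signs_def)
qed

text \<open>Since the last two signs are arbitrary by \<open>signs_surj\<close>, a formula for the
  first one determines the whole set.\<close>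

lemma signs_eq_graph:
  assumes "\<And>\<sigma>. \<sigma> \<in> abs_Gal \<Longrightarrow> fst (signs \<sigma>) = f (snd (signs \<sigma>))"
  shows "signs ` abs_Gal = {x. fst x = f (snd x)}"
proof (rule equalityI; rule subsetI)
  fix x :: "bool \<times> bool \<times> bool" assume "x \<in> {x. fst x = f (snd x)}"
  then obtain q r where x: "x = (f (q, r), q, r)" by (cases x) auto
  obtain p where p: "(p, q, r) \<in> signs ` abs_Gal" using signs_surj by blast
  then obtain \<sigma> where "\<sigma> \<in> abs_Gal" "signs \<sigma> = (p, q, r)" by auto
  hence "p = f (q, r)" using assms[of \<sigma>] by simp
  thus "x \<in> signs ` abs_Gal" using p x by simp
qed (use assms in auto)

lemma signs_generic:
  assumes sq: "\<nexists>q :: rat. q \<noteq> 0 \<and> (of_int d = q\<^sup>2 \<or> of_int d = - (q\<^sup>2))"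
    and sq2: "\<nexists>q :: rat. q \<noteq> 0 \<and> (of_int d = 2 * q\<^sup>2 \<or> of_int d = - (2 * q\<^sup>2))"
  shows "signs ` abs_Gal = UNIV"
proof -
  have nsq: "\<nexists>q :: rat. q\<^sup>2 = of_int k" if k: "k \<in> {d, - d, 2 * d, - (2 * d)}" for k
  proof
    assume "\<exists>q :: rat. q\<^sup>2 = of_int k"
    then obtain q :: rat where q: "q\<^sup>2 = of_int k" by blast
    have "q \<noteq> 0" using q k d by auto
    \<comment> \<open>From q^2 = 2 d one gets d = 2 (q / 2)^2, which brings all four cases into the
      form of the hypotheses.\<close>
    have "of_int d = q\<^sup>2 \<or> of_int d = - (q\<^sup>2) \<or> of_int d = 2 * (q / 2)\<^sup>2 \<or> of_int d = - (2 * (q / 2)\<^sup>2)"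
      using k q by (auto simp: power_divide)
    thus False using sq sq2 \<open>q \<noteq> 0\<close> by (metis divide_eq_0_iff zero_neq_numeral)
  qed
  have uQ: "u\<^sup>2 \<in> \<rat>" by simp
  have s0: "sqrt2 \<noteq> 0" by (rule Q1_x_ne)
  have s: "\<sigma> (u * sqrt2) \<noteq> u * sqrt2 \<longleftrightarrow> fst (signs \<sigma>)"
    "\<sigma> (u * \<i>) \<noteq> u * \<i> \<longleftrightarrow> (\<sigma> u \<noteq> u) \<noteq> (\<sigma> \<i> \<noteq> \<i>)"
    "\<sigma> (u * (sqrt2 * \<i>)) \<noteq> u * (sqrt2 * \<i>) \<longleftrightarrow> fst (signs \<sigma>) \<noteq> (\<sigma> \<i> \<noteq> \<i>)" if "\<sigma> \<in> abs_Gal" for \<sigma>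
    using sign_mult[OF that, of u sqrt2] sign_mult[OF that, of u \<i>] sign_mult[OF that, of u "sqrt2 * \<i>"]
      sqrt2_i[OF that] s0 by (auto simp: signs_def power_mult_distrib)
  have ex: "\<exists>\<sigma>\<in>abs_Gal. \<sigma> u \<noteq> u" "\<exists>\<sigma>\<in>abs_Gal. \<sigma> (u * sqrt2) \<noteq> u * sqrt2"
    "\<exists>\<sigma>\<in>abs_Gal. \<sigma> (u * \<i>) \<noteq> u * \<i>" "\<exists>\<sigma>\<in>abs_Gal. \<sigma> (u * (sqrt2 * \<i>)) \<noteq> u * (sqrt2 * \<i>)"
    using nsq[of d] nsq[of "2 * d"] nsq[of "- d"] nsq[of "- (2 * d)"]
    by (intro exists_sign_change[of u d] exists_sign_change[of "u * sqrt2" "2 * d"]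
      exists_sign_change[of "u * \<i>" "- d"] exists_sign_change[of "u * (sqrt2 * \<i>)" "- (2 * d)"];
      simp add: power_mult_distrib)+
  have top: "(True, False, False) \<in> signs ` abs_Gal"
  proof (rule ccontr)
    assume not: "(True, False, False) \<notin> signs ` abs_Gal"
    define f where "f y = (SOME p. (p, y) \<in> signs ` abs_Gal)" for y :: "bool \<times> bool"
    have f: "(f y, y) \<in> signs ` abs_Gal" for y
      using someI_ex[OF signs_surj[of "fst y" "snd y"]] by (simp add: f_def)
    have uniq: "p = p'" if p: "(p, y) \<in> signs ` abs_Gal" "(p', y) \<in> signs ` abs_Gal" for p p' y
    proof (rule ccontr)
      assume "p \<noteq> p'"
      hence "xor3 (p, y) (p', y) = (True, False, False)" by (cases y) auto
      thus False using signs_group(2)[OF p] not by simp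
    qed
    have lin: "f (q \<noteq> q', r \<noteq> r') = (f (q, r) \<noteq> f (q', r'))" for q q' r r'
      using signs_group(2)[OF f[of "(q, r)"] f[of "(q', r')"]] by (intro uniq[OF f]) simp
    have gr: "fst (signs \<sigma>) = f (\<sigma> sqrt2 \<noteq> sqrt2, \<sigma> \<i> \<noteq> \<i>)" if "\<sigma> \<in> abs_Gal" for \<sigma>
    proof (rule uniq[OF _ f])
      have "(fst (signs \<sigma>), \<sigma> sqrt2 \<noteq> sqrt2, \<sigma> \<i> \<noteq> \<i>) = signs \<sigma>" by (simp add: signs_def)
      thus "(fst (signs \<sigma>), \<sigma> sqrt2 \<noteq> sqrt2, \<sigma> \<i> \<noteq> \<i>) \<in> signs ` abs_Gal" using that by simp
    qed
    have f0: "\<not> f (False, False)" using lin[of False False False False] by simp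
    have fq: "f (q, r) = ((q \<and> f (True, False)) \<noteq> (r \<and> f (False, True)))" for q r
      using lin[of True False False True] f0 by (cases q; cases r) auto
    have gr': "fst (signs \<sigma>) \<longleftrightarrow> (\<sigma> sqrt2 \<noteq> sqrt2 \<and> f (True, False)) \<noteq> (\<sigma> \<i> \<noteq> \<i> \<and> f (False, True))"
      if "\<sigma> \<in> abs_Gal" for \<sigma>
      using gr[OF that] fq[of "\<sigma> sqrt2 \<noteq> sqrt2" "\<sigma> \<i> \<noteq> \<i>"] by (rule trans)
    have \<delta>: "\<sigma> u \<noteq> u \<longleftrightarrow> fst (signs \<sigma>) \<noteq> (\<sigma> sqrt2 \<noteq> sqrt2)" for \<sigma> by (auto simp: signs_def)
    obtain \<sigma>1 where m1: "\<sigma>1 \<in> abs_Gal" and h1: "\<sigma>1 u \<noteq> u" using ex(1) by blast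
    obtain \<sigma>2 where m2: "\<sigma>2 \<in> abs_Gal" and h2: "\<sigma>2 (u * sqrt2) \<noteq> u * sqrt2" using ex(2) by blast
    obtain \<sigma>3 where m3: "\<sigma>3 \<in> abs_Gal" and h3: "\<sigma>3 (u * \<i>) \<noteq> u * \<i>" using ex(3) by blast
    obtain \<sigma>4 where m4: "\<sigma>4 \<in> abs_Gal" and h4: "\<sigma>4 (u * (sqrt2 * \<i>)) \<noteq> u * (sqrt2 * \<i>)"
      using ex(4) by blast
    have k1: "fst (signs \<sigma>1) \<noteq> (\<sigma>1 sqrt2 \<noteq> sqrt2)" using h1 \<delta>[of \<sigma>1] by (rule iffD1[rotated])
    have k2: "fst (signs \<sigma>2)" using h2 s(1)[OF m2] by (rule iffD1[rotated])
    have "(\<sigma>3 u \<noteq> u) \<noteq> (\<sigma>3 \<i> \<noteq> \<i>)" using h3 s(2)[OF m3] by (rule iffD1[rotated])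
    hence k3: "(fst (signs \<sigma>3) \<noteq> (\<sigma>3 sqrt2 \<noteq> sqrt2)) \<noteq> (\<sigma>3 \<i> \<noteq> \<i>)" unfolding \<delta>[of \<sigma>3] .
    have k4: "fst (signs \<sigma>4) \<noteq> (\<sigma>4 \<i> \<noteq> \<i>)" using h4 s(3)[OF m4] by (rule iffD1[rotated])
    show False
      by (rule linear_contradiction[OF gr'[OF m1] k1 gr'[OF m2] k2 gr'[OF m3] k3 gr'[OF m4] k4])
  qed
  have "x \<in> signs ` abs_Gal" for x
  proof -
    obtain p q r where x: "x = (p, q, r)" by (cases x)
    obtain p' where p': "(p', q, r) \<in> signs ` abs_Gal" using signs_surj by blast
    show ?thesis
    proof (cases "p = p'")
      case False
      hence "xor3 (p', q, r) (True, False, False) = x" using x by auto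
      thus ?thesis using signs_group(2)[OF p' top] by simp
    qed (use p' x in simp)
  qed
  thus ?thesis by blast
qed

lemma u_eq: "of_int d = z \<Longrightarrow> u = csqrt z"
  by (simp add: u_def)

text \<open>For d = 1, 2, -1, -2 the number u is 1, sqrt 2, i, sqrt(-2) up to sign, so its sign is
  known from those on sqrt 2 and i.\<close>

lemma signs_eq:
  assumes "squarefree d"
  shows "bit_subgroup (signs ` abs_Gal) = image_of d"
proof -
  consider "d = 1" | "d = 2" | "d = - 1" | "d = - 2" | "d \<notin> {1, - 1, 2, - 2}" by blast
  thus ?thesis
  proof cases
    case 1
    have "u = 1" using u_eq[of 1] 1 by simp
    hence "signs ` abs_Gal = {x. fst x = fst (snd x)}"
      using galois.one by (intro signs_eq_graph) (auto simp: signs_def galois_def)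
    thus ?thesis using 1 by (simp add: image_of_def)
  next
    case 2
    have "u = sqrt2" using u_eq[of 2] 2 by (simp add: sqrt2_def)
    hence "signs ` abs_Gal = {x. fst x = (\<lambda>_. False) (snd x)}"
      by (intro signs_eq_graph) (auto simp: signs_def)
    thus ?thesis using 2 by (simp add: image_of_def)
  next
    case 3
    have "u = \<i>" using u_eq[of "- 1"] 3 by simp
    hence "signs ` abs_Gal = {x. fst x = (\<lambda>y. fst y \<noteq> snd y) (snd x)}"
      by (intro signs_eq_graph) (auto simp: signs_def)
    thus ?thesis using 3 by (simp add: image_of_def)
  next
    case 4
    have "of_int d = (sqrt2 * \<i>)\<^sup>2" using 4 by (simp add: power_mult_distrib)
    hence "u\<^sup>2 = (sqrt2 * \<i>)\<^sup>2" unfolding u_square .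
    hence u: "u = sqrt2 * \<i> \<or> u = - (sqrt2 * \<i>)" by (simp only: power2_eq_iff)
    have "\<sigma> u \<noteq> u \<longleftrightarrow> (\<sigma> sqrt2 \<noteq> sqrt2) \<noteq> (\<sigma> \<i> \<noteq> \<i>)" if "\<sigma> \<in> abs_Gal" for \<sigma>
    proof -
      interpret galois \<sigma> by unfold_locales (rule that)
      have "\<sigma> u \<noteq> u \<longleftrightarrow> \<sigma> (sqrt2 * \<i>) \<noteq> sqrt2 * \<i>" using u by (auto simp: uminus)
      thus ?thesis using sqrt2_i[OF that] by simp
    qed
    hence "signs ` abs_Gal = {x. fst x = snd (snd x)}"
      by (intro signs_eq_graph) (auto simp: signs_def)
    thus ?thesis using 4 by (simp add: image_of_def)
  next
    case 5
    thus ?thesis using signs_generic squarefree_not_square[OF assms 5] by (simp add: image_of_def)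
  qed
qed

theorem Ed_images_conj:
  assumes "squarefree d"
  shows "Ed_images d \<noteq> {}" "G \<in> Ed_images d \<Longrightarrow> (G, image_of d) \<in> conj_rel"
proof -
  obtain Q where Q: "Q \<in> tate_seq" "Q 1 = Q1" using tate_seq_ex by blast
  note H = rep_image_properties[OF Q] and basis = eta_basis(1)[OF Q]
  have ex: "\<exists>A\<in>rep_image \<Gamma> (eta_ept \<circ> Q) Q. snd (bits A) = (q, r)" for q r
  proof -
    obtain p where "(p, q, r) \<in> bits ` rep_image \<Gamma> (eta_ept \<circ> Q) Q"
      using signs_surj[of q r] unfolding H(3) by blast
    then obtain A where "A \<in> rep_image \<Gamma> (eta_ept \<circ> Q) Q" "bits A = (p, q, r)" by auto
    thus ?thesis by (intro bexI[of _ A]) simp_all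
  qed
  \<comment> \<open>\<open>A\<close> and \<open>B\<close> play the parts of \<open>h1\<close> and
    \<open>h2\<close>: both have an odd upper right entry, and only \<open>B\<close> lies outside
    the Cartan group.\<close>
  obtain A where A: "A \<in> rep_image \<Gamma> (eta_ept \<circ> Q) Q" "snd (bits A) = (True, False)" using ex by blast
  obtain B where B: "B \<in> rep_image \<Gamma> (eta_ept \<circ> Q) Q" "snd (bits B) = (True, True)" using ex by blast
  interpret norm_cartan_subgroup "rep_image \<Gamma> (eta_ept \<circ> Q) Q" A B
    by (unfold_locales; use H(1,2) A B in simp)
  have image: "rep_image \<Gamma> (eta_ept \<circ> Q) Q = image_of d"
    using eq_bit_subgroup unfolding H(3) signs_eq[OF assms] .
  show "Ed_images d \<noteq> {}"
    unfolding Ed_images_def adic_images_def using basis tate_basis_iff by blast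
  show "(G, image_of d) \<in> conj_rel" if G: "G \<in> Ed_images d"
  proof -
    obtain P' Q' where PQ: "G = gal_image (Ed_a d) (Ed_b d) P' Q'" "tate_basis (Ed_a d) (Ed_b d) P' Q'"
      using G by (auto simp: Ed_images_def adic_images_def)
    have "P' \<in> tate (Ed_a d) (Ed_b d)" "Q' \<in> tate (Ed_a d) (Ed_b d)" using PQ(2) by (simp_all add: tate_basis_def)
    then obtain P'' Q'' where "P' = S \<circ> P''" "Q' = S \<circ> Q''" unfolding tate_eq by blast
    hence G: "G = rep_image \<Gamma> P'' Q''" "is_tate_basis P'' Q''"
      using PQ by (simp_all add: gal_image_eq tate_basis_iff)
    show ?thesis
      unfolding G(1) image[symmetric] by (rule rep_image_conj[OF basis G(2)]) (rule \<Gamma>_group)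
  qed
qed

end

theorem theorem3p12:
  shows "card ((\<Union>d\<in>{d :: int. d \<noteq> 0 \<and> squarefree d}. Ed_images d) // conj_rel) = 5 \<and>
    (\<forall>d :: int. d \<noteq> 0 \<longrightarrow> squarefree d \<longrightarrow>
      Ed_images d \<noteq> {} \<and>
      (\<forall>G\<in>Ed_images d.
        (d = 2 \<longrightarrow> (G, topgen (G21 \<union> {c_eps 1})) \<in> conj_rel) \<and>
        (d = 1 \<longrightarrow> (G, topgen (G22 \<union> {c_eps 1})) \<in> conj_rel) \<and>
        (d = - 1 \<longrightarrow> (G, topgen (G22 \<union> {c_eps (- 1)})) \<in> conj_rel) \<and>
        (d = - 2 \<longrightarrow> (G, topgen (G21 \<union> {c_eps (- 1)})) \<in> conj_rel) \<and>
        ((\<nexists>q :: rat. q \<noteq> 0 \<and> (of_int d = q\<^sup>2 \<or> of_int d = - (q\<^sup>2))) \<and>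
         (\<nexists>q :: rat. q \<noteq> 0 \<and> (of_int d = 2 * q\<^sup>2 \<or> of_int d = - (2 * q\<^sup>2))) \<longrightarrow>
           (G, normalizer_cartan) \<in> conj_rel)))"
proof
  have images: "Ed_images d \<noteq> {}" "\<And>G. G \<in> Ed_images d \<Longrightarrow> (G, image_of d) \<in> conj_rel"
    if "d \<noteq> 0" "squarefree d" for d
    using twist.Ed_images_conj[of d] that by (auto simp: twist_def)
  define R where "R d = conj_rel `` {image_of d}" for d
  have R_eq: "R d = R d' \<longleftrightarrow> (image_of d, image_of d') \<in> conj_rel" for d d'
    unfolding R_def by (rule eq_equiv_class_iff[OF equiv_conj_rel]) simp_all
  \<comment> \<open>3 represents all square-free d outside the four special values, since these
    share one image.\<close>
  let ?D = "{d :: int. d \<noteq> 0 \<and> squarefree d}" and ?K = "{1, - 1, 2, - 2, 3 :: int}"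
  have K: "?K \<subseteq> ?D"
  proof -
    have "squarefree (2 :: int)" "squarefree (3 :: int)"
      by (intro squarefree_prime_elem prime_imp_prime_elem; simp)+
    moreover have "squarefree (1 :: int)" by simp
    ultimately show ?thesis
      using squarefree_uminus_int[of 1] squarefree_uminus_int[of 2] by simp
  qed
  have cls: "conj_rel `` {G} = R d" if "d \<in> ?D" "G \<in> Ed_images d" for d G
    unfolding R_def using images that by (intro equiv_class_eq[OF equiv_conj_rel]) simp
  have "(\<Union>d\<in>?D. Ed_images d) // conj_rel = R ` ?D"
  proof (rule equalityI; rule subsetI)
    fix X assume "X \<in> (\<Union>d\<in>?D. Ed_images d) // conj_rel"
    then obtain d G where "d \<in> ?D" "G \<in> Ed_images d" "X = conj_rel `` {G}" by (auto elim!: quotientE)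
    thus "X \<in> R ` ?D" using cls by blast
  next
    fix X assume "X \<in> R ` ?D"
    then obtain d where d: "d \<in> ?D" "X = R d" by blast
    then obtain G where G: "G \<in> Ed_images d" using images(1)[of d] by blast
    thus "X \<in> (\<Union>d\<in>?D. Ed_images d) // conj_rel" unfolding d(2) cls[OF d(1) G, symmetric] using d(1) G by (intro quotientI) blast
  qed
  also have "R ` ?D = R ` ?K"
  proof
    have "R d \<in> R ` ?K" for d
    proof (cases "d \<in> ?K")
      case False
      hence "R d = R 3" unfolding R_eq image_of_conj_iff by simp
      thus ?thesis by simp
    qed (rule imageI)
    thus "R ` ?D \<subseteq> R ` ?K" by blast
  qed (use K in blast)
  finally have quot: "(\<Union>d\<in>?D. Ed_images d) // conj_rel = R ` ?K" .
  have "card (R ` ?K) = card ?K"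
  proof (intro card_image inj_onI)
    fix x y assume xy: "x \<in> ?K" "y \<in> ?K" and "R x = R y"
    hence "x = y \<or> x \<notin> {1, - 1, 2, - 2} \<and> y \<notin> {1, - 1, 2, - 2}"
      unfolding R_eq image_of_conj_iff by (simp only:)
    thus "x = y" using xy by blast
  qed
  thus "card ((\<Union>d\<in>?D. Ed_images d) // conj_rel) = 5" unfolding quot by simp
  show "\<forall>d :: int. d \<noteq> 0 \<longrightarrow> squarefree d \<longrightarrow>
      Ed_images d \<noteq> {} \<and>
      (\<forall>G\<in>Ed_images d.
        (d = 2 \<longrightarrow> (G, topgen (G21 \<union> {c_eps 1})) \<in> conj_rel) \<and>
        (d = 1 \<longrightarrow> (G, topgen (G22 \<union> {c_eps 1})) \<in> conj_rel) \<and>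
        (d = - 1 \<longrightarrow> (G, topgen (G22 \<union> {c_eps (- 1)})) \<in> conj_rel) \<and>
        (d = - 2 \<longrightarrow> (G, topgen (G21 \<union> {c_eps (- 1)})) \<in> conj_rel) \<and>
        ((\<nexists>q :: rat. q \<noteq> 0 \<and> (of_int d = q\<^sup>2 \<or> of_int d = - (q\<^sup>2))) \<and>
         (\<nexists>q :: rat. q \<noteq> 0 \<and> (of_int d = 2 * q\<^sup>2 \<or> of_int d = - (2 * q\<^sup>2))) \<longrightarrow>
           (G, normalizer_cartan) \<in> conj_rel))"
  proof (rule allI, rule impI, rule impI, rule conjI)
    fix d :: int
    assume d: "d \<noteq> 0" "squarefree d"
    show "Ed_images d \<noteq> {}" by (rule images(1)[OF d])
    show "\<forall>G\<in>Ed_images d.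
        (d = 2 \<longrightarrow> (G, topgen (G21 \<union> {c_eps 1})) \<in> conj_rel) \<and>
        (d = 1 \<longrightarrow> (G, topgen (G22 \<union> {c_eps 1})) \<in> conj_rel) \<and>
        (d = - 1 \<longrightarrow> (G, topgen (G22 \<union> {c_eps (- 1)})) \<in> conj_rel) \<and>
        (d = - 2 \<longrightarrow> (G, topgen (G21 \<union> {c_eps (- 1)})) \<in> conj_rel) \<and>
        ((\<nexists>q :: rat. q \<noteq> 0 \<and> (of_int d = q\<^sup>2 \<or> of_int d = - (q\<^sup>2))) \<and>
         (\<nexists>q :: rat. q \<noteq> 0 \<and> (of_int d = 2 * q\<^sup>2 \<or> of_int d = - (2 * q\<^sup>2))) \<longrightarrow>
           (G, normalizer_cartan) \<in> conj_rel)"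
    proof (rule ballI)
      fix G assume "G \<in> Ed_images d"
      hence G: "(G, image_of d) \<in> conj_rel" by (rule images(2)[OF d])
      have special: "image_of 2 = topgen (G21 \<union> {c_eps 1})" "image_of 1 = topgen (G22 \<union> {c_eps 1})"
        "image_of (- 1) = topgen (G22 \<union> {c_eps (- 1)})" "image_of (- 2) = topgen (G21 \<union> {c_eps (- 1)})"
        unfolding topgen_G21_c1 topgen_G22_c1 topgen_G22_cm1 topgen_G21_cm1 image_of_def by simp_all
      have generic: "image_of d = normalizer_cartan"
        if "(\<nexists>q :: rat. q \<noteq> 0 \<and> (of_int d = q\<^sup>2 \<or> of_int d = - (q\<^sup>2))) \<and>
         (\<nexists>q :: rat. q \<noteq> 0 \<and> (of_int d = 2 * q\<^sup>2 \<or> of_int d = - (2 * q\<^sup>2)))"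
      proof -
        \<comment> \<open>Taking q = 1 in the two hypotheses excludes exactly these values.\<close>
        have "d \<notin> {1, - 1, 2, - 2}" using that by (auto dest!: spec[of _ "1 :: rat"])
        thus ?thesis by (simp add: normalizer_cartan_eq image_of_def)
      qed
      show "(d = 2 \<longrightarrow> (G, topgen (G21 \<union> {c_eps 1})) \<in> conj_rel) \<and>
        (d = 1 \<longrightarrow> (G, topgen (G22 \<union> {c_eps 1})) \<in> conj_rel) \<and>
        (d = - 1 \<longrightarrow> (G, topgen (G22 \<union> {c_eps (- 1)})) \<in> conj_rel) \<and>
        (d = - 2 \<longrightarrow> (G, topgen (G21 \<union> {c_eps (- 1)})) \<in> conj_rel) \<and>
        ((\<nexists>q :: rat. q \<noteq> 0 \<and> (of_int d = q\<^sup>2 \<or> of_int d = - (q\<^sup>2))) \<and>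
         (\<nexists>q :: rat. q \<noteq> 0 \<and> (of_int d = 2 * q\<^sup>2 \<or> of_int d = - (2 * q\<^sup>2))) \<longrightarrow>
           (G, normalizer_cartan) \<in> conj_rel)"
        unfolding special[symmetric] using G generic by metis
    qed
  qed
qed

end
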